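(* Consider the four-color urn model (white, black, green, yellow) with replacement matrix $$R=\begin{pmatrix} sQ & E\\ 0 & P\end{pmatrix},$$ a stochastic matrix with $2\times2$ blocks, where $0<s<1$ and $P,Q$ are irreducible stochastic matrices with stationary distributions (row vectors) $\boldsymbol\pi_P,\boldsymbol\pi_Q$; the eigenvalues of $Q$ are $\lambda$ and $1$ with $|\lambda|<1$, and those of $P$ are $\beta$ and $1$ with $|\beta|<1$. Assume $W_0+B_0>0$. Let $\boldsymbol\xi$ be a right eigenvector of $Q$ corresponding to $\lambda$, and put $\boldsymbol v_1=(1,1,0,0)'$ and $\boldsymbol v_2=(\boldsymbol\xi',0,0)'$. Then there are random variables $U$ and (when $\lambda>1/2$) $V$ such that: (i) $\boldsymbol C_n\mathbf 1/(n+1)=1$, where $\mathbf 1=(1,1,1,1)'$. (ii) $\boldsymbol C_n/n\to(0,0,\boldsymbol\pi_P)$ almost surely. (iii) $(W_n,B_n)/n^s\to\boldsymbol\pi_QU$ almost surely. (iv) $\boldsymbol C_n\boldsymbol v_1/n^s\to U$ almost surely, as well as in $L^2$. (v) If $\lambda<1/2$, then $\boldsymbol C_n\boldsymbol v_2/n^{s/2}\Rightarrow N\left(0,\frac{s^2\lambda^2}{s(1-2\lambda)}U\boldsymbol\pi_Q\boldsymbol\xi^2\right)$. (vi) If $\lambda=1/2$, then $\boldsymbol C_n\boldsymbol v_2/\sqrt{n^s\log n}\Rightarrow N\left(0,s^2\lambda^2U\boldsymbol\pi_Q\boldsymbol\xi^2\right)$. (vii) If $\lambda>1/2$, then $\boldsymbol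 C_n\boldsymbol v_2/n^{s\lambda}\to V$ almost surely, as well as in $L^2$. Moreover, if the initial vector is $(W_0,B_0,G_0,Y_0)$, then $U$ and $V$ have the same distributions, respectively, as the almost sure (and $L^2$) limits of $(\tilde W_n+\tilde B_n)/(n+1)^s$ (a positive random variable) and, when $\lambda>1/2$, of $(\tilde W_n,\tilde B_n)\boldsymbol\xi/n^{s\lambda}$, where $(\tilde W_n,\tilde B_n,\tilde G_n)$ is the three-color urn with initial vector $(W_0,B_0,G_0+Y_0)$ and replacement matrix $$\begin{pmatrix} sQ & (1-s)(1,1)'\\ (0,0) & 1\end{pmatrix}.$$
   Context: Urn model: there are $K$ colors. $\boldsymbol C_0$ is a row probability vector (non-negative real coordinates summing to $1$) giving the initial "numbers of balls" of each color, and $R=((r_{ij}))$ is a non-random $K\times K$ stochastic matrix. $\boldsymbol C_n$ is the row vector of the numbers of balls of each color after the $n$-th trial; for $K=4$, $\boldsymbol C_n=(W_n,B_n,G_n,Y_n)$. At the $n$-th trial a ball is drawn at random, so that, given the past, color $i$ appears with probability $\boldsymbol C_{i,n-1}/n$ (the total after $n-1$ trials is $n$); if color $i$ appears, then for every $j$ the number of balls of color $j$ is increased by $r_{ij}$. Notation: $'$ denotes transpose. For a vector $\boldsymbol\xi$, $\boldsymbol\xi^2$ is the vector of squared coordinates. $\Rightarrow$ denotes convergence in distribution. For a non-negative random variable $U$ and a constant $c\ge0$, $N(0,cU)$ denotes the variance mixture of normals, i.e. the law of $\sqrt{cU}\,Z$ with $Z$ standard normal independent of $U$. *)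

theory Defs
  imports "HOL-Probability.Probability"
begin

definition probability_vector :: "real^'k \<Rightarrow> bool" where
  "probability_vector p \<longleftrightarrow> (\<forall>i. 0 \<le> p $ i) \<and> (\<Sum>i\<in>UNIV. p $ i) = 1"

definition stochastic_matrix :: "real^'k^'k \<Rightarrow> bool" where
  "stochastic_matrix A \<longleftrightarrow> (\<forall>i. probability_vector (row i A))"

definition irreducible_matrix :: "real^'k^'k \<Rightarrow> bool" where
  "irreducible_matrix A \<longleftrightarrow> (\<forall>i j. (i, j) \<in> {(i, j). A $ i $ j > 0}\<^sup>+)"

definition stationary_distribution :: "real^'k^'k \<Rightarrow> real^'k \<Rightarrow> bool" where
  "stationary_distribution A p \<longleftrightarrow> probability_vector p \<and> p v* A = p"

definition right_eigenvector :: "real^'k^'k \<Rightarrow> real \<Rightarrow> real^'k \<Rightarrow> bool" where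
  "right_eigenvector A c v \<longleftrightarrow> v \<noteq> 0 \<and> A *v v = c *\<^sub>R v"

definition eigenvalues :: "real^'k^'k \<Rightarrow> real set" where
  "eigenvalues A = {c. \<exists>v. right_eigenvector A c v}"

text \<open>Colors of an urn split into two blocks are indexed by a sum type: \<^term>\<open>Inl i\<close> is the
  \<open>i\<close>-th color of the first block and \<^term>\<open>Inr j\<close> the \<open>j\<close>-th color of the second.  With index type
  \<open>2 + 2\<close>, the colors white, black, green, yellow are \<open>Inl 1\<close>, \<open>Inl 2\<close>, \<open>Inr 1\<close>, \<open>Inr 2\<close>.\<close>

definition append_vec :: "'a^'m::finite \<Rightarrow> 'a^'n::finite \<Rightarrow> 'a^('m + 'n)" where
  "append_vec u v = (\<chi> k. case k of Inl i \<Rightarrow> u $ i | Inr j \<Rightarrow> v $ j)"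

definition first_block :: "'a^('m::finite + 'n::finite) \<Rightarrow> 'a^'m" where
  "first_block x = (\<chi> i. x $ Inl i)"

definition block_matrix ::
  "'a^'m::finite^'m \<Rightarrow> 'a^'n::finite^'m \<Rightarrow> 'a^'m^'n \<Rightarrow> 'a^'n^'n \<Rightarrow> 'a^('m + 'n)^('m + 'n)" where
  "block_matrix A B C D =
     (\<chi> k. case k of Inl i \<Rightarrow> append_vec (A $ i) (B $ i) | Inr j \<Rightarrow> append_vec (C $ j) (D $ j))"

text \<open>\<open>X n\<close> is the color drawn at the \<open>n\<close>-th trial (\<open>n \<ge> 1\<close>; \<open>X 0\<close> plays no role), and
  \<open>draw_history M X n\<close> is the sigma-algebra generated by the first \<open>n\<close> draws.\<close>

definition draw_history :: "'a measure \<Rightarrow> (nat \<Rightarrow> 'a \<Rightarrow> 'k) \<Rightarrow> nat \<Rightarrow> 'a measure" where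
  "draw_history M X n = sigma (space M) {X m -` A \<inter> space M | m A. 1 \<le> m \<and> m \<le> n}"

text \<open>The total number of balls after \<open>n\<close> trials is \<open>n + 1\<close>, whence the denominator in
  the drawing rule.\<close>

locale urn_model = prob_space M
  for M :: "'a measure"
    and R :: "real^'k^'k"
    and c :: "real^'k"
    and X :: "nat \<Rightarrow> 'a \<Rightarrow> 'k"
    and C :: "nat \<Rightarrow> 'a \<Rightarrow> real^'k" +
  assumes stochastic: "stochastic_matrix R"
    and initial_probability: "probability_vector c"
    and measurable_draw: "\<And>n. X (Suc n) \<in> measurable M (count_space UNIV)"
    and initial: "\<And>\<omega>. \<omega> \<in> space M \<Longrightarrow> C 0 \<omega> = c"
    and replacement: "\<And>n \<omega>. \<omega> \<in> space M \<Longrightarrow> C (Suc n) \<omega> = C n \<omega> + row (X (Suc n) \<omega>) R"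
    and draw: "\<And>n i. AE \<omega> in M.
      real_cond_exp M (draw_history M X n) (indicator {\<omega> \<in> space M. X (Suc n) \<omega> = i}) \<omega>
        = C n \<omega> $ i / real (Suc n)"

definition tendsto_L2 :: "'a measure \<Rightarrow> (nat \<Rightarrow> 'a \<Rightarrow> real) \<Rightarrow> ('a \<Rightarrow> real) \<Rightarrow> bool" where
  "tendsto_L2 M X Y \<longleftrightarrow>
     (\<forall>n. X n \<in> borel_measurable M \<and> integrable M (\<lambda>\<omega>. (X n \<omega>)\<^sup>2)) \<and>
     Y \<in> borel_measurable M \<and> integrable M (\<lambda>\<omega>. (Y \<omega>)\<^sup>2) \<and>
     (\<lambda>n. \<integral>\<omega>. (X n \<omega> - Y \<omega>)\<^sup>2 \<partial>M) \<longlonglongrightarrow> 0"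

text \<open>The law \<open>N(0, T)\<close> of \<open>sqrt T * Z\<close>, with \<open>Z\<close> standard normal independent of the random
  variance \<open>T\<close>; independence is realized on the product space.\<close>

definition normal_mixture :: "'a measure \<Rightarrow> ('a \<Rightarrow> real) \<Rightarrow> real measure" where
  "normal_mixture M T =
     distr (M \<Otimes>\<^sub>M density lborel std_normal_density) borel (\<lambda>(\<omega>, z). sqrt (T \<omega>) * z)"

definition converges_in_law_to :: "'a measure \<Rightarrow> (nat \<Rightarrow> 'a \<Rightarrow> real) \<Rightarrow> real measure \<Rightarrow> bool" where
  "converges_in_law_to M X \<mu> \<longleftrightarrow>
     (\<forall>n. X n \<in> borel_measurable M) \<and> weak_conv_m (\<lambda>n. distr M borel (X n)) \<mu>"

end

theory Submission
  imports Defs "HOL-Real_Asymp.Real_Asymp"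
begin

text \<open>
The proof follows linear functionals of the urn. The block form of the replacement matrix \<open>R\<close>
makes \<open>u = (1, 1, 0, 0)\<close> and \<open>v = (\<xi>, 0, 0)\<close> right eigenvectors, with eigenvalues \<open>s\<close> and \<open>s * lam\<close>.
Whenever \<open>R *v x = \<mu> *\<^sub>R x\<close>, the conditional mean of \<open>C (n + 1) \<bullet> x\<close> is \<open>(1 + \<mu> / (n + 1)) * (C n \<bullet> x)\<close>,
so that \<open>C n \<bullet> x\<close> divided by \<open>growth \<mu> n\<close>, the product of the factors \<open>1 + \<mu> / m\<close>, is a martingale;
and \<open>growth \<mu> n\<close> is asymptotic to \<open>n powr \<mu> / Gamma (1 + \<mu>)\<close>.

For \<open>x\<close> supported in the first block, the conditional variance of \<open>C (n + 1) \<bullet> x\<close> is at most a constant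
times the probability to draw from that block, whose mean has order \<open>n powr (s - 1)\<close>. So the variance of
the \<open>n\<close>-th increment of the martingale is \<open>O(n powr (s - 1 - 2 * \<mu>))\<close>, which is summable when
\<open>s < 2 * \<mu>\<close>; the martingale then converges almost surely and in square mean
(\<open>martingale_convergence\<close>, via Kolmogorov's maximal inequality). The choice \<open>\<mu> = s\<close> gives \<open>U\<close>, and
\<open>\<mu> = s * lam\<close> with \<open>lam > 1 / 2\<close> gives \<open>V\<close>. Since \<open>s * lam < s\<close>, the functional \<open>C n \<bullet> v\<close> is always
negligible against \<open>n powr s\<close> (\<open>subordinate_eigenvector\<close>). As every functional of two colors is a
combination of \<open>1\<close> and \<open>\<xi>\<close> (\<open>stationary_decomposition\<close>), the first block divided by \<open>n powr s\<close> converges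
to \<open>U\<close> times \<open>\<pi>Q\<close>. The second block is handled in the same way with the eigenvector of \<open>P\<close> for \<open>\<beta>\<close>; the
feed from the first block is a summable perturbation (\<open>perturbed_eigenvector\<close>).

For \<open>lam \<le> 1 / 2\<close> this bound on the variances of the martingale of \<open>v\<close> is no longer summable, but the
conditional variances, suitably rescaled, converge in mean to \<open>(s * lam)\<^sup>2 * U * (\<pi>Q \<bullet> \<xi>\<^sup>2)\<close>. This limit is
random. The characteristic function is therefore compared with a Gaussian one whose variance is the
value at a fixed time \<open>k\<close>: relative to the draws after time \<open>k\<close> that value is a constant, so that
Lindeberg's replacement of one increment after the other applies, and letting \<open>k\<close> tend to infinity
afterwards gives the normal mixture (\<open>martingale_characteristic_limit\<close>). Stolz's theorem evaluates the
sum of the deterministic weights, which yields the two normalizations \<open>n powr (s / 2)\<close> and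
\<open>sqrt (n powr s * ln n)\<close>.

Positivity of \<open>U\<close> comes from a negative moment. A ratio of Gamma functions of \<open>C n \<bullet> u\<close> has an explicit
expectation and dominates a negative power of \<open>C n \<bullet> u\<close>, so negative moments of \<open>(C n \<bullet> u) / n powr s\<close>
stay bounded and the limit puts no mass at \<open>0\<close> (\<open>eigenvector_limit_positive\<close>).

Finally, a draw outside the first block leaves that block unchanged. Hence the first block is a Markov
chain whose transitions depend on \<open>s *\<^sub>R Q\<close> alone, and it has the same law in the four and in the three
color urn (\<open>first_block_law\<close>); the limits, being limits of functions of this chain, have equal laws.
\<close>

section \<open>Null recursions, weighted averages and growth factors\<close>

lemma not_summable_at_top:
  fixes f :: "nat \<Rightarrow> real"
  assumes f: "\<And>n. 0 \<le> f n" "\<not> summable f"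
  shows "filterlim (\<lambda>n. \<Sum>k<n. f k) at_top sequentially"
proof (rule ccontr)
  assume "\<not> ?thesis"
  then obtain Z where Z: "\<not> (\<forall>\<^sub>F n in sequentially. Z \<le> (\<Sum>k<n. f k))"
    unfolding filterlim_at_top by blast
  have "(\<Sum>k<n. f k) \<le> Z" for n
  proof (rule ccontr)
    assume *: "\<not> (\<Sum>k<n. f k) \<le> Z"
    have "Z \<le> (\<Sum>k<m. f k)" if "m \<ge> n" for m
      using * sum_mono2[of "{..<m}" "{..<n}" f] f(1) that by auto
    with Z show False by (auto simp: eventually_sequentially)
  qed
  with f show False using summableI_nonneg_bounded by blast
qed

text \<open>Adding the tail of the convergent series \<open>\<eta>\<close> to \<open>y\<close> turns the recursion into an averaging: the new
  sequence moves to the convex combination of itself and the vanishing tail. The contraction factors multiply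
  to \<open>0\<close> because \<open>\<theta>\<close> is not summable. The typical \<open>\<eta>\<close> is a path of martingale
  increments, whose series converges only conditionally.\<close>

lemma contraction_tendsto_zero:
  fixes y \<theta> \<eta> :: "nat \<Rightarrow> real"
  assumes step: "\<And>n. y (Suc n) = (1 - \<theta> n) * y n + \<eta> n"
    and \<theta>: "\<And>n. 0 \<le> \<theta> n" "\<And>n. \<theta> n \<le> 1" "\<not> summable \<theta>"
    and \<eta>: "summable \<eta>"
  shows "y \<longlonglongrightarrow> 0"
proof -
  define r where "r n = (\<Sum>k. \<eta> (k + n))" for n
  have r: "r \<longlonglongrightarrow> 0"
    unfolding r_def using suminf_exist_split2[OF \<eta>] .
  have r_step: "r n = \<eta> n + r (Suc n)" for n
    unfolding r_def using suminf_split_head[OF summable_ignore_initial_segment[OF \<eta>]]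
    by simp
  define z where "z n = y n + r n" for n
  have z_step: "z (Suc n) = (1 - \<theta> n) * z n + \<theta> n * r n" for n
    unfolding z_def using step[of n] r_step[of n] by (simp add: algebra_simps)
  have "z \<longlonglongrightarrow> 0"
  proof (rule LIMSEQ_I)
    fix e :: real
    assume e: "0 < e"
    then obtain N where N: "\<And>n. n \<ge> N \<Longrightarrow> \<bar>r n\<bar> < e / 2"
      using LIMSEQ_D[OF r, of "e / 2"] by auto
    have bound: "\<bar>z (N + n)\<bar> \<le> e / 2 + \<bar>z N\<bar> * exp (- (\<Sum>k<n. \<theta> (N + k)))" for n
    proof (induction n)
      case (Suc n)
      let ?t = "\<theta> (N + n)"
      have "\<bar>z (N + Suc n)\<bar> \<le> (1 - ?t) * \<bar>z (N + n)\<bar> + ?t * \<bar>r (N + n)\<bar>"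
        using z_step[of "N + n"] \<theta>(1,2)[of "N + n"]
          abs_triangle_ineq[of "(1 - ?t) * z (N + n)" "?t * r (N + n)"]
        by (simp add: abs_mult)
      also have "\<dots> \<le> (1 - ?t) * (e / 2 + \<bar>z N\<bar> * exp (- (\<Sum>k<n. \<theta> (N + k)))) + ?t * (e / 2)"
        using \<theta>(1,2)[of "N + n"] N[of "N + n"] Suc by (intro add_mono mult_left_mono) auto
      also have "\<dots> = e / 2 + \<bar>z N\<bar> * ((1 - ?t) * exp (- (\<Sum>k<n. \<theta> (N + k))))"
        by (simp add: algebra_simps)
      also have "\<dots> \<le> e / 2 + \<bar>z N\<bar> * (exp (- ?t) * exp (- (\<Sum>k<n. \<theta> (N + k))))"
        using exp_ge_add_one_self[of "- ?t"] by (intro add_mono mult_left_mono mult_right_mono) auto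
      also have "exp (- ?t) * exp (- (\<Sum>k<n. \<theta> (N + k))) = exp (- (\<Sum>k<Suc n. \<theta> (N + k)))"
        by (simp add: exp_add[symmetric])
      finally show ?case .
    qed (use e in simp)
    have "\<not> summable (\<lambda>k. \<theta> (N + k))"
      using \<theta>(3) summable_iff_shift[of \<theta> N] by (simp add: add.commute)
    then have "filterlim (\<lambda>n. \<Sum>k<n. \<theta> (N + k)) at_top sequentially"
      using \<theta>(1) not_summable_at_top by simp
    then have "((\<lambda>n. \<bar>z N\<bar> * exp (- (\<Sum>k<n. \<theta> (N + k)))) \<longlongrightarrow> \<bar>z N\<bar> * 0) sequentially"
      by (intro tendsto_mult tendsto_const filterlim_compose[OF exp_at_bot])
        (simp add: filterlim_uminus_at_top[symmetric])
    then obtain M where M: "\<And>n. n \<ge> M \<Longrightarrow> \<bar>\<bar>z N\<bar> * exp (- (\<Sum>k<n. \<theta> (N + k)))\<bar> < e / 2"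
      using e LIMSEQ_D[of "\<lambda>n. \<bar>z N\<bar> * exp (- (\<Sum>k<n. \<theta> (N + k)))" 0 "e / 2"] by auto
    have "norm (z n - 0) < e" if "n \<ge> N + M" for n
    proof -
      have "M \<le> n - N" "N + (n - N) = n" using that by auto
      then show ?thesis using bound[of "n - N"] M[of "n - N"] by simp
    qed
    then show "\<exists>no. \<forall>n\<ge>no. norm (z n - 0) < e" by blast
  qed
  from tendsto_diff[OF this r] show ?thesis
    by (simp add: z_def)
qed

lemma weighted_average_tendsto:
  fixes w x :: "nat \<Rightarrow> real"
  assumes w: "\<And>n. 0 \<le> w n" and W: "filterlim (\<lambda>n. \<Sum>m<n. w m) at_top sequentially"
    and x: "x \<longlonglongrightarrow> l"
  shows "(\<lambda>n. (\<Sum>m<n. w m * x m) / (\<Sum>m<n. w m)) \<longlonglongrightarrow> l"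
proof (rule LIMSEQ_I)
  fix e :: real
  assume e: "0 < e"
  then obtain N where N: "\<And>n. n \<ge> N \<Longrightarrow> \<bar>x n - l\<bar> < e / 2"
    using LIMSEQ_D[OF x, of "e / 2"] by auto
  define K where "K = (\<Sum>m<N. w m * \<bar>x m - l\<bar>)"
  have "(\<lambda>n. K / (\<Sum>m<n. w m)) \<longlonglongrightarrow> 0"
    by (intro real_tendsto_divide_at_top[OF tendsto_const W])
  then obtain M where M: "\<And>n. n \<ge> M \<Longrightarrow> \<bar>K / (\<Sum>m<n. w m)\<bar> < e / 2"
    using e LIMSEQ_D[of "\<lambda>n. K / (\<Sum>m<n. w m)" 0 "e / 2"] by auto
  obtain L where L: "\<And>n. n \<ge> L \<Longrightarrow> 1 \<le> (\<Sum>m<n. w m)"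
    using W[unfolded filterlim_at_top, rule_format, of 1] by (auto simp: eventually_sequentially)
  have "norm ((\<Sum>m<n. w m * x m) / (\<Sum>m<n. w m) - l) < e" if n: "n \<ge> N + M + L" for n
  proof -
    let ?W = "\<Sum>m<n. w m"
    have pos: "?W \<ge> 1" using L n by simp
    have "\<bar>(\<Sum>m<n. w m * x m) - l * ?W\<bar> = \<bar>\<Sum>m<n. w m * (x m - l)\<bar>"
      by (simp add: algebra_simps sum_subtractf sum_distrib_left)
    also have "\<dots> \<le> (\<Sum>m<n. w m * \<bar>x m - l\<bar>)"
      by (rule order_trans[OF sum_abs]) (simp add: abs_mult w)
    also have "\<dots> = K + (\<Sum>m=N..<n. w m * \<bar>x m - l\<bar>)"
      unfolding K_def using n sum.atLeastLessThan_concat[of 0 N n "\<lambda>m. w m * \<bar>x m - l\<bar>"]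
      by (simp add: lessThan_atLeast0)
    also have "(\<Sum>m=N..<n. w m * \<bar>x m - l\<bar>) \<le> (\<Sum>m=N..<n. w m * (e / 2))"
      using N w by (intro sum_mono mult_left_mono) (auto intro: less_imp_le)
    also have "\<dots> \<le> ?W * (e / 2)"
      unfolding sum_distrib_right[symmetric] using w e
      by (intro mult_right_mono sum_mono2) auto
    finally have "\<bar>(\<Sum>m<n. w m * x m) - l * ?W\<bar> \<le> K + ?W * (e / 2)" by simp
    then have "\<bar>(\<Sum>m<n. w m * x m) - l * ?W\<bar> / ?W \<le> K / ?W + e / 2"
      using pos by (simp add: field_simps)
    also have "K / ?W < e / 2" using M[of n] n abs_ge_self[of "K / ?W"] by linarith
    finally have "\<bar>(\<Sum>m<n. w m * x m) - l * ?W\<bar> / ?W < e" by simp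
    moreover have "(\<Sum>m<n. w m * x m) / ?W - l = ((\<Sum>m<n. w m * x m) - l * ?W) / ?W"
      using pos by (simp add: field_simps)
    moreover have "\<bar>((\<Sum>m<n. w m * x m) - l * ?W) / ?W\<bar> = \<bar>(\<Sum>m<n. w m * x m) - l * ?W\<bar> / ?W"
      using pos by simp
    ultimately show ?thesis by (simp only: real_norm_def)
  qed
  then show "\<exists>no. \<forall>n\<ge>no. norm ((\<Sum>m<n. w m * x m) / (\<Sum>m<n. w m) - l) < e" by blast
qed

text \<open>With the increments of \<open>B\<close> as weights, the quotient is a weighted average of the ratios
  \<open>u n / (B (n + 1) - B n)\<close>.\<close>

lemma stolz_cesaro:
  fixes u B :: "nat \<Rightarrow> real"
  assumes mono: "strict_mono B" and B: "filterlim B at_top sequentially"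
    and lim: "(\<lambda>n. u n / (B (Suc n) - B n)) \<longlonglongrightarrow> l"
  shows "(\<lambda>n. (\<Sum>m<n. u m) / B n) \<longlonglongrightarrow> l"
proof -
  let ?w = "\<lambda>n. B (Suc n) - B n"
  have pos: "?w n > 0" for n using mono by (simp add: strict_mono_Suc_iff)
  have tele: "(\<Sum>m<n. ?w m) = B n - B 0" for n by (rule sum_lessThan_telescope)
  have top: "filterlim (\<lambda>n. B n - B 0) at_top sequentially"
    using filterlim_tendsto_add_at_top[OF tendsto_const[of "- B 0"] B] by simp
  have u: "?w m * (u m / ?w m) = u m" for m using pos[of m] by simp
  have "(\<lambda>n. (\<Sum>m<n. u m) / (B n - B 0)) \<longlonglongrightarrow> l"
    using weighted_average_tendsto[of ?w "\<lambda>n. u n / ?w n" l] pos top lim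
    unfolding tele u by (simp add: less_imp_le)
  moreover have "(\<lambda>n. 1 - B 0 / B n) \<longlonglongrightarrow> 1 - 0"
    by (intro tendsto_diff tendsto_const real_tendsto_divide_at_top[OF tendsto_const B])
  ultimately have "(\<lambda>n. (\<Sum>m<n. u m) / (B n - B 0) * (1 - B 0 / B n)) \<longlonglongrightarrow> l * 1"
    by (intro tendsto_mult) auto
  moreover have "\<forall>\<^sub>F n in sequentially. (\<Sum>m<n. u m) / (B n - B 0) * (1 - B 0 / B n) = (\<Sum>m<n. u m) / B n"
  proof -
    have "\<forall>\<^sub>F n in sequentially. B n > max 0 (B 0)"
      using B unfolding filterlim_at_top_dense by blast
    then show ?thesis
      by eventually_elim (auto simp: field_simps)
  qed
  ultimately show ?thesis
    by (auto elim: Lim_transform_eventually)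
qed

lemma filterlim_at_top_of_ratio:
  fixes f g :: "nat \<Rightarrow> real"
  assumes ratio: "(\<lambda>n. f n / g n) \<longlonglongrightarrow> l" and l: "0 < l" and g: "filterlim g at_top sequentially"
  shows "filterlim f at_top sequentially"
proof -
  have "filterlim (\<lambda>n. f n / g n * g n) at_top sequentially"
    by (rule filterlim_tendsto_pos_mult_at_top[OF ratio l g])
  moreover have "\<forall>\<^sub>F n in sequentially. 0 < g n"
    using g unfolding filterlim_at_top_dense by blast
  then have "\<forall>\<^sub>F n in sequentially. f n / g n * g n = f n"
    by eventually_elim simp
  ultimately show ?thesis using filterlim_cong[OF refl refl] by fast
qed

text \<open>The product of the factors \<open>1 + \<mu> / m\<close> for \<open>m = 1, ..., n\<close>. In the closed form the growth rate is
  the limit formula of Gauss for the Gamma function.\<close>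

definition growth :: "real \<Rightarrow> nat \<Rightarrow> real" where
  "growth \<mu> n = pochhammer (1 + \<mu>) n / fact n"

lemma growth_0 [simp]: "growth \<mu> 0 = 1"
  by (simp add: growth_def)

lemma growth_Suc: "growth \<mu> (Suc n) = growth \<mu> n * (1 + \<mu> / (real n + 1))"
  by (simp add: growth_def pochhammer_Suc field_simps)

lemma growth_pos:
  assumes "\<mu> > -1"
  shows "growth \<mu> n > 0"
  unfolding growth_def using assms by (intro divide_pos_pos pochhammer_pos) auto

lemma growth_asymptotics:
  assumes "\<mu> > -1"
  shows "(\<lambda>n. growth \<mu> n / real n powr \<mu>) \<longlonglongrightarrow> inverse (Gamma (1 + \<mu>))"
proof -
  have pos: "Gamma (1 + \<mu>) > 0" using assms by simp
  have "(\<lambda>n. inverse (Gamma_series' (1 + \<mu>) n)) \<longlonglongrightarrow> inverse (Gamma (1 + \<mu>))"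
    using pos by (intro tendsto_inverse Gamma_series'_LIMSEQ) auto
  moreover have "\<forall>\<^sub>F n in sequentially.
      inverse (Gamma_series' (1 + \<mu>) n) = growth \<mu> n / real n powr \<mu>"
    using eventually_gt_at_top[of 0]
  proof eventually_elim
    case (elim n)
    have "exp ((1 + \<mu>) * ln (real n)) = real n * real n powr \<mu>"
      using elim by (simp add: powr_def distrib_right exp_add)
    moreover have "fact n = real n * fact (n - 1)"
      using elim by (simp add: fact_reduce)
    ultimately show ?case
      using elim by (simp add: Gamma_series'_def growth_def field_simps)
  qed
  ultimately show ?thesis
    by (rule Lim_transform_eventually)
qed

lemma growth_ratio:
  assumes \<mu>: "\<mu> > -1" and N: "(\<lambda>n. real n powr \<mu> / N n) \<longlonglongrightarrow> 1"
  shows "(\<lambda>n. growth \<mu> n / N n) \<longlonglongrightarrow> inverse (Gamma (1 + \<mu>))"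
proof -
  have "(\<lambda>n. growth \<mu> n / real n powr \<mu> * (real n powr \<mu> / N n)) \<longlonglongrightarrow> inverse (Gamma (1 + \<mu>)) * 1"
    by (intro tendsto_mult growth_asymptotics \<mu> N)
  moreover have "\<forall>\<^sub>F n in sequentially. growth \<mu> n / real n powr \<mu> * (real n powr \<mu> / N n) = growth \<mu> n / N n"
    using eventually_gt_at_top[of 0] by eventually_elim simp
  ultimately show ?thesis by (auto elim: Lim_transform_eventually)
qed

section \<open>Square mean convergence\<close>

lemma square_integrable_diff:
  fixes f g :: "'a \<Rightarrow> real"
  assumes [measurable]: "f \<in> borel_measurable M" "g \<in> borel_measurable M"
    and int: "integrable M (\<lambda>\<omega>. (f \<omega>)\<^sup>2)" "integrable M (\<lambda>\<omega>. (g \<omega>)\<^sup>2)"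
  shows "integrable M (\<lambda>\<omega>. (f \<omega> - g \<omega>)\<^sup>2)"
proof (rule Bochner_Integration.integrable_bound)
  show "integrable M (\<lambda>\<omega>. 2 * (f \<omega>)\<^sup>2 + 2 * (g \<omega>)\<^sup>2)" using int by simp
  show "AE \<omega> in M. norm ((f \<omega> - g \<omega>)\<^sup>2) \<le> norm (2 * (f \<omega>)\<^sup>2 + 2 * (g \<omega>)\<^sup>2)"
  proof (rule AE_I2)
    fix \<omega>
    have "(f \<omega> - g \<omega>)\<^sup>2 \<le> 2 * (f \<omega>)\<^sup>2 + 2 * (g \<omega>)\<^sup>2"
      using zero_le_power2[of "f \<omega> + g \<omega>"] by (simp add: power2_eq_square algebra_simps)
    then show "norm ((f \<omega> - g \<omega>)\<^sup>2) \<le> norm (2 * (f \<omega>)\<^sup>2 + 2 * (g \<omega>)\<^sup>2)" by simp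
  qed
qed measurable

text \<open>By Fatou's lemma, the distance to the almost sure limit inherits the bound on the distances to later
  members of the sequence. This replaces an appeal to completeness of the space of square integrable functions.\<close>

lemma tendsto_L2_limit:
  assumes meas: "\<And>n. X n \<in> borel_measurable M" "Y \<in> borel_measurable M"
    and int: "\<And>n. integrable M (\<lambda>\<omega>. (X n \<omega>)\<^sup>2)"
    and lim: "AE \<omega> in M. (\<lambda>n. X n \<omega>) \<longlonglongrightarrow> Y \<omega>"
    and cauchy: "\<And>n m. n \<le> m \<Longrightarrow> (\<integral>\<omega>. (X m \<omega> - X n \<omega>)\<^sup>2 \<partial>M) \<le> r n"
    and r: "r \<longlonglongrightarrow> 0"
  shows "tendsto_L2 M X Y"
proof -
  note [measurable] = meas
  have r_nonneg: "0 \<le> r n" for n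
    using cauchy[of n n] by simp
  have nn: "(\<integral>\<^sup>+\<omega>. ennreal ((X n \<omega> - Y \<omega>)\<^sup>2) \<partial>M) \<le> ennreal (r n)" for n
  proof -
    have "AE \<omega> in M. ennreal ((X n \<omega> - Y \<omega>)\<^sup>2) = liminf (\<lambda>m. ennreal ((X (m + n) \<omega> - X n \<omega>)\<^sup>2))"
      using lim
    proof eventually_elim
      case (elim \<omega>)
      have "(\<lambda>m. (X (m + n) \<omega> - X n \<omega>)\<^sup>2) \<longlonglongrightarrow> (Y \<omega> - X n \<omega>)\<^sup>2"
        by (intro tendsto_intros LIMSEQ_ignore_initial_segment elim)
      then have "(\<lambda>m. ennreal ((X (m + n) \<omega> - X n \<omega>)\<^sup>2)) \<longlonglongrightarrow> ennreal ((Y \<omega> - X n \<omega>)\<^sup>2)"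
        by (rule tendsto_ennrealI)
      from lim_imp_Liminf[OF _ this] show ?case
        by (simp add: power2_commute)
    qed
    then have "(\<integral>\<^sup>+\<omega>. ennreal ((X n \<omega> - Y \<omega>)\<^sup>2) \<partial>M) =
        (\<integral>\<^sup>+\<omega>. liminf (\<lambda>m. ennreal ((X (m + n) \<omega> - X n \<omega>)\<^sup>2)) \<partial>M)"
      by (rule nn_integral_cong_AE)
    also have "\<dots> \<le> liminf (\<lambda>m. \<integral>\<^sup>+\<omega>. ennreal ((X (m + n) \<omega> - X n \<omega>)\<^sup>2) \<partial>M)"
      by (rule nn_integral_liminf) measurable
    also have "\<dots> \<le> liminf (\<lambda>m. ennreal (r n))"
    proof (intro Liminf_mono always_eventually allI)
      fix m
      have "(\<integral>\<^sup>+\<omega>. ennreal ((X (m + n) \<omega> - X n \<omega>)\<^sup>2) \<partial>M) =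
          ennreal (\<integral>\<omega>. (X (m + n) \<omega> - X n \<omega>)\<^sup>2 \<partial>M)"
        by (rule nn_integral_eq_integral[OF square_integrable_diff]) (simp_all add: int)
      then show "(\<integral>\<^sup>+\<omega>. ennreal ((X (m + n) \<omega> - X n \<omega>)\<^sup>2) \<partial>M) \<le> ennreal (r n)"
        using cauchy[of n "m + n"] by (simp add: ennreal_leI)
    qed
    also have "\<dots> = ennreal (r n)" by (simp add: Liminf_const)
    finally show ?thesis .
  qed
  have diff: "integrable M (\<lambda>\<omega>. (X n \<omega> - Y \<omega>)\<^sup>2)" for n
    by (rule integrableI_nonneg) (use nn[of n] in \<open>auto simp: order_le_less_trans\<close>)
  have bound: "(\<integral>\<omega>. (X n \<omega> - Y \<omega>)\<^sup>2 \<partial>M) \<le> r n" for n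
    using nn[of n] nn_integral_eq_integral[OF diff[of n]] r_nonneg[of n] by simp
  have "integrable M (\<lambda>\<omega>. (X 0 \<omega> - (X 0 \<omega> - Y \<omega>))\<^sup>2)"
    by (rule square_integrable_diff) (simp_all add: int diff)
  then have "integrable M (\<lambda>\<omega>. (Y \<omega>)\<^sup>2)" by simp
  moreover have "(\<lambda>n. \<integral>\<omega>. (X n \<omega> - Y \<omega>)\<^sup>2 \<partial>M) \<longlonglongrightarrow> 0"
    by (rule tendsto_sandwich[OF _ _ tendsto_const r]) (simp_all add: bound)
  ultimately show ?thesis
    unfolding tendsto_L2_def using meas int by simp
qed

lemma tendsto_L2_mult:
  assumes X: "tendsto_L2 M X Y" and c: "c \<longlonglongrightarrow> (l::real)"
  shows "tendsto_L2 M (\<lambda>n \<omega>. c n * X n \<omega>) (\<lambda>\<omega>. l * Y \<omega>)"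
proof -
  have meas [measurable]: "\<And>n. X n \<in> borel_measurable M" "Y \<in> borel_measurable M"
    and int: "\<And>n. integrable M (\<lambda>\<omega>. (X n \<omega>)\<^sup>2)" "integrable M (\<lambda>\<omega>. (Y \<omega>)\<^sup>2)"
    and lim: "(\<lambda>n. \<integral>\<omega>. (X n \<omega> - Y \<omega>)\<^sup>2 \<partial>M) \<longlonglongrightarrow> 0"
    using X by (simp_all add: tendsto_L2_def)
  have bound: "(a + b)\<^sup>2 \<le> 2 * a\<^sup>2 + 2 * b\<^sup>2" for a b :: real
    using zero_le_power2[of "a - b"] by (simp add: power2_eq_square algebra_simps)
  have diff: "integrable M (\<lambda>\<omega>. (X n \<omega> - Y \<omega>)\<^sup>2)" for n
    by (rule square_integrable_diff[OF meas int])
  have le: "(\<integral>\<omega>. (c n * X n \<omega> - l * Y \<omega>)\<^sup>2 \<partial>M) \<le>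
      2 * (c n)\<^sup>2 * (\<integral>\<omega>. (X n \<omega> - Y \<omega>)\<^sup>2 \<partial>M) + 2 * (c n - l)\<^sup>2 * (\<integral>\<omega>. (Y \<omega>)\<^sup>2 \<partial>M)" for n
  proof -
    have *: "(c n * X n \<omega> - l * Y \<omega>)\<^sup>2 \<le> 2 * (c n)\<^sup>2 * (X n \<omega> - Y \<omega>)\<^sup>2 + 2 * (c n - l)\<^sup>2 * (Y \<omega>)\<^sup>2" for \<omega>
    proof -
      have "c n * X n \<omega> - l * Y \<omega> = c n * (X n \<omega> - Y \<omega>) + (c n - l) * Y \<omega>"
        by (simp add: algebra_simps)
      then show ?thesis
        using bound[of "c n * (X n \<omega> - Y \<omega>)" "(c n - l) * Y \<omega>"]
        by (simp only: power_mult_distrib mult.assoc)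
    qed
    have I: "integrable M (\<lambda>\<omega>. 2 * (c n)\<^sup>2 * (X n \<omega> - Y \<omega>)\<^sup>2 + 2 * (c n - l)\<^sup>2 * (Y \<omega>)\<^sup>2)"
      using diff int by simp
    have "integrable M (\<lambda>\<omega>. (c n * X n \<omega> - l * Y \<omega>)\<^sup>2)"
      by (rule Bochner_Integration.integrable_bound[OF I]) (use * in auto)
    from integral_mono[OF this I *] show ?thesis
      using diff int by simp
  qed
  have "(\<lambda>n. 2 * (c n)\<^sup>2 * (\<integral>\<omega>. (X n \<omega> - Y \<omega>)\<^sup>2 \<partial>M) + 2 * (c n - l)\<^sup>2 * (\<integral>\<omega>. (Y \<omega>)\<^sup>2 \<partial>M)) \<longlonglongrightarrow>
      2 * l\<^sup>2 * 0 + 2 * (l - l)\<^sup>2 * (\<integral>\<omega>. (Y \<omega>)\<^sup>2 \<partial>M)"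
    by (intro tendsto_intros c lim)
  then have lim': "(\<lambda>n. 2 * (c n)\<^sup>2 * (\<integral>\<omega>. (X n \<omega> - Y \<omega>)\<^sup>2 \<partial>M) + 2 * (c n - l)\<^sup>2 * (\<integral>\<omega>. (Y \<omega>)\<^sup>2 \<partial>M)) \<longlonglongrightarrow> 0"
    by simp
  have "(\<lambda>n. \<integral>\<omega>. (c n * X n \<omega> - l * Y \<omega>)\<^sup>2 \<partial>M) \<longlonglongrightarrow> 0"
    by (rule tendsto_sandwich[OF _ _ tendsto_const lim']) (use le in auto)
  then show ?thesis
    unfolding tendsto_L2_def by (simp add: power_mult_distrib int)
qed

lemma tendsto_L2_cong:
  assumes "tendsto_L2 M X Y" "\<And>n \<omega>. \<omega> \<in> space M \<Longrightarrow> X n \<omega> = X' n \<omega>" "\<And>\<omega>. \<omega> \<in> space M \<Longrightarrow> Y \<omega> = Y' \<omega>"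
  shows "tendsto_L2 M X' Y'"
  using assms unfolding tendsto_L2_def
  by (simp cong: measurable_cong Bochner_Integration.integrable_cong Bochner_Integration.integral_cong)

text \<open>The mean of \<open>\<bar>X n - Y\<bar>\<close> is at most the root of its mean square, as the variance of
  \<open>\<bar>X n - Y\<bar>\<close> is nonnegative.\<close>

lemma (in prob_space) tendsto_L2_imp_L1:
  assumes X: "tendsto_L2 M X Y"
  shows "(\<lambda>n. \<integral>\<omega>. \<bar>X n \<omega> - Y \<omega>\<bar> \<partial>M) \<longlonglongrightarrow> 0"
proof -
  have meas [measurable]: "\<And>n. X n \<in> borel_measurable M" "Y \<in> borel_measurable M"
    and int: "\<And>n. integrable M (\<lambda>\<omega>. (X n \<omega>)\<^sup>2)" "integrable M (\<lambda>\<omega>. (Y \<omega>)\<^sup>2)"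
    and lim: "(\<lambda>n. \<integral>\<omega>. (X n \<omega> - Y \<omega>)\<^sup>2 \<partial>M) \<longlonglongrightarrow> 0"
    using X by (simp_all add: tendsto_L2_def)
  have diff: "integrable M (\<lambda>\<omega>. (X n \<omega> - Y \<omega>)\<^sup>2)" for n
    by (rule square_integrable_diff[OF meas int])
  have le: "(\<integral>\<omega>. \<bar>X n \<omega> - Y \<omega>\<bar> \<partial>M) \<le> sqrt (\<integral>\<omega>. (X n \<omega> - Y \<omega>)\<^sup>2 \<partial>M)" for n
  proof (rule real_le_rsqrt)
    have abs: "integrable M (\<lambda>\<omega>. \<bar>X n \<omega> - Y \<omega>\<bar>)"
      by (rule square_integrable_imp_integrable) (use diff in auto)
    then have "variance (\<lambda>\<omega>. \<bar>X n \<omega> - Y \<omega>\<bar>) =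
        expectation (\<lambda>\<omega>. \<bar>X n \<omega> - Y \<omega>\<bar>\<^sup>2) - (expectation (\<lambda>\<omega>. \<bar>X n \<omega> - Y \<omega>\<bar>))\<^sup>2"
      by (rule variance_eq) (use diff in simp)
    then show "(\<integral>\<omega>. \<bar>X n \<omega> - Y \<omega>\<bar> \<partial>M)\<^sup>2 \<le> (\<integral>\<omega>. (X n \<omega> - Y \<omega>)\<^sup>2 \<partial>M)"
      using variance_positive[of "\<lambda>\<omega>. \<bar>X n \<omega> - Y \<omega>\<bar>"] by simp
  qed
  have lim': "(\<lambda>n. sqrt (\<integral>\<omega>. (X n \<omega> - Y \<omega>)\<^sup>2 \<partial>M)) \<longlonglongrightarrow> 0"
    using tendsto_real_sqrt[OF lim] by simp
  show ?thesis
    by (rule tendsto_sandwich[OF _ _ tendsto_const lim']) (use le in auto)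
qed

lemma (in prob_space) tendsto_L2_add_const:
  assumes X: "tendsto_L2 M X Y"
  shows "tendsto_L2 M (\<lambda>n \<omega>. a + X n \<omega>) (\<lambda>\<omega>. a + Y \<omega>)"
proof -
  have meas [measurable]: "\<And>n. X n \<in> borel_measurable M" "Y \<in> borel_measurable M"
    and int: "\<And>n. integrable M (\<lambda>\<omega>. (X n \<omega>)\<^sup>2)" "integrable M (\<lambda>\<omega>. (Y \<omega>)\<^sup>2)"
    using X by (simp_all add: tendsto_L2_def)
  have shift: "integrable M (\<lambda>\<omega>. (a + Z \<omega>)\<^sup>2)"
    if [measurable]: "Z \<in> borel_measurable M" and Z: "integrable M (\<lambda>\<omega>. (Z \<omega>)\<^sup>2)" for Z
  proof -
    have "integrable M Z" by (rule square_integrable_imp_integrable) (use Z in auto)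
    then show ?thesis using Z by (simp add: power2_sum)
  qed
  show ?thesis
    using X unfolding tendsto_L2_def by (auto intro: shift)
qed

section \<open>Urn histories and the drawing rule\<close>

context urn_model
begin

text \<open>The draws \<open>X 1, ..., X n\<close>: the index is shifted since the first draw is \<open>X (Suc 0)\<close>.\<close>

definition past :: "nat \<Rightarrow> 'a \<Rightarrow> 'k list" where
  "past n \<omega> = map (\<lambda>m. X (Suc m) \<omega>) [0..<n]"

text \<open>As there are finitely many histories of each length, adaptedness can be expressed as being constant on
  histories. For functions with values in any type this is stable under arbitrary compositions, and it gives
  measurability and integrability at once.\<close>

definition adapted :: "nat \<Rightarrow> ('a \<Rightarrow> 'c) \<Rightarrow> bool" where
  "adapted n f \<longleftrightarrow> (\<forall>\<omega>\<in>space M. \<forall>\<omega>'\<in>space M. past n \<omega> = past n \<omega>' \<longrightarrow> f \<omega> = f \<omega>')"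

lemma adaptedI:
  "(\<And>\<omega> \<omega>'. \<omega> \<in> space M \<Longrightarrow> \<omega>' \<in> space M \<Longrightarrow> past n \<omega> = past n \<omega>' \<Longrightarrow> f \<omega> = f \<omega>') \<Longrightarrow> adapted n f"
  unfolding adapted_def by blast

lemma adaptedD:
  "adapted n f \<Longrightarrow> \<omega> \<in> space M \<Longrightarrow> \<omega>' \<in> space M \<Longrightarrow> past n \<omega> = past n \<omega>' \<Longrightarrow> f \<omega> = f \<omega>'"
  unfolding adapted_def by blast

lemma past_Suc: "past (Suc n) \<omega> = past n \<omega> @ [X (Suc n) \<omega>]"
  by (simp add: past_def)

lemma length_past [simp]: "length (past n \<omega>) = n"
  by (simp add: past_def)

lemma take_past: "m \<le> n \<Longrightarrow> take m (past n \<omega>) = past m \<omega>"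
  by (simp add: past_def take_map)

lemma past_eq_mono: "m \<le> n \<Longrightarrow> past n \<omega> = past n \<omega>' \<Longrightarrow> past m \<omega> = past m \<omega>'"
  by (simp only: take_past[symmetric])

lemma past_SucD:
  assumes "past (Suc n) \<omega> = past (Suc n) \<omega>'"
  shows "past n \<omega> = past n \<omega>'" "X (Suc n) \<omega> = X (Suc n) \<omega>'"
  using assms unfolding past_Suc by (auto simp only: append1_eq_conv)

lemma adapted_mono: "adapted m f \<Longrightarrow> m \<le> n \<Longrightarrow> adapted n f"
  by (rule adaptedI) (erule adaptedD, assumption+, erule past_eq_mono, assumption)

lemma adapted_cong: "(\<And>\<omega>. \<omega> \<in> space M \<Longrightarrow> f \<omega> = g \<omega>) \<Longrightarrow> adapted n f \<longleftrightarrow> adapted n g"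
  unfolding adapted_def by (intro ball_cong refl imp_cong) (simp only:)

lemma adapted_const: "adapted n (\<lambda>_. z)"
  by (rule adaptedI) (rule refl)

lemma adapted_comp: "adapted n f \<Longrightarrow> adapted n (\<lambda>\<omega>. g (f \<omega>))"
  by (rule adaptedI, rule arg_cong[where f=g], erule adaptedD)

lemma adapted_comp2: "adapted n f \<Longrightarrow> adapted n g \<Longrightarrow> adapted n (\<lambda>\<omega>. h (f \<omega>) (g \<omega>))"
  by (rule adaptedI, rule arg_cong2[where f=h]) (erule adaptedD; assumption)+

lemma adapted_sum: "(\<And>i. i \<in> I \<Longrightarrow> adapted n (f i)) \<Longrightarrow> adapted n (\<lambda>\<omega>. \<Sum>i\<in>I. f i \<omega>)"
  by (rule adaptedI, rule sum.cong, rule refl) (blast intro: adaptedD)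

lemma adapted_draw: "adapted (Suc n) (X (Suc n))"
  by (rule adaptedI) (erule past_SucD(2))

lemma adapted_C: "adapted n (C n)"
proof (induction n)
  case 0
  show ?case by (rule adaptedI) (simp only: initial)
next
  case (Suc n)
  show ?case
  proof (rule adaptedI)
    fix \<omega> \<omega>' assume *: "\<omega> \<in> space M" "\<omega>' \<in> space M" "past (Suc n) \<omega> = past (Suc n) \<omega>'"
    show "C (Suc n) \<omega> = C (Suc n) \<omega>'"
      unfolding replacement[OF *(1)] replacement[OF *(2)] past_SucD(2)[OF *(3)]
      using adaptedD[OF Suc *(1,2) past_SucD(1)[OF *(3)]] by (simp only:)
  qed
qed

lemma adapted_factor:
  assumes f: "adapted n f"
  obtains g where "\<And>\<omega>. \<omega> \<in> space M \<Longrightarrow> f \<omega> = g (past n \<omega>)"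
proof
  fix \<omega> assume \<omega>: "\<omega> \<in> space M"
  define \<omega>' where "\<omega>' = (SOME \<omega>'. \<omega>' \<in> space M \<and> past n \<omega>' = past n \<omega>)"
  have "\<omega>' \<in> space M \<and> past n \<omega>' = past n \<omega>"
    unfolding \<omega>'_def by (rule someI[of _ \<omega>]) (simp add: \<omega>)
  then have "f \<omega> = f \<omega>'"
    using adaptedD[OF f \<omega>] by metis
  then show "f \<omega> = (\<lambda>h. f (SOME \<omega>'. \<omega>' \<in> space M \<and> past n \<omega>' = h)) (past n \<omega>)"
    unfolding \<omega>'_def .
qed

lemma space_draw_history [simp]: "space (draw_history M X n) = space M"
  unfolding draw_history_def by (rule space_measure_of) auto

lemma sets_draw_history:
  "sets (draw_history M X n) = sigma_sets (space M) {X m -` A \<inter> space M | m A. 1 \<le> m \<and> m \<le> n}"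
  unfolding draw_history_def by (rule sets_measure_of) auto

lemma subalgebra_draw_history: "subalgebra M (draw_history M X n)"
  unfolding subalgebra_def space_draw_history sets_draw_history
proof (intro conjI refl sets.sigma_sets_subset subsetI)
  fix B assume "B \<in> {X m -` A \<inter> space M | m A. 1 \<le> m \<and> m \<le> n}"
  then obtain m A where B: "B = X m -` A \<inter> space M" "1 \<le> m" by auto
  then obtain l where "m = Suc l" by (cases m) auto
  with B measurable_draw[of l] show "B \<in> sets M"
    by (auto intro!: measurable_sets)
qed

lemma past_in_draw_history: "{\<omega> \<in> space M. past n \<omega> = h} \<in> sets (draw_history M X n)"
proof (cases "length h = n")
  case True
  have X: "X (Suc m) -` {h ! m} \<inter> space M \<in> sets (draw_history M X n)" if "m < n" for m
    unfolding sets_draw_history using that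
    by (intro sigma_sets.Basic CollectI exI[of _ "Suc m"] exI[of _ "{h ! m}"]) simp
  have top: "space M \<in> sets (draw_history M X n)"
    using sets.top[of "draw_history M X n"] by simp
  have "{\<omega> \<in> space M. past n \<omega> = h} = space M \<inter> (\<Inter>m\<in>{..<n}. X (Suc m) -` {h ! m} \<inter> space M)"
    if "n > 0"
    using True that by (auto simp: past_def list_eq_iff_nth_eq)
  moreover have "{\<omega> \<in> space M. past n \<omega> = h} = space (draw_history M X n)" if "n = 0"
    using True that by (auto simp: past_def)
  moreover have "space M \<inter> (\<Inter>m\<in>{..<n}. X (Suc m) -` {h ! m} \<inter> space M) \<in> sets (draw_history M X n)"
    if "n > 0"
  proof (rule sets.Int)
    show "space M \<in> sets (draw_history M X n)" by (rule top)
    show "(\<Inter>m\<in>{..<n}. X (Suc m) -` {h ! m} \<inter> space M) \<in> sets (draw_history M X n)"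
      using that by (intro sets.finite_INT X) auto
  qed
  ultimately show ?thesis using top unfolding space_draw_history by (cases "n > 0") (simp, simp)
next
  case False
  then have "{\<omega> \<in> space M. past n \<omega> = h} = {}" by auto
  then show ?thesis by (simp only: sets.empty_sets)
qed

lemma past_sets: "{\<omega> \<in> space M. past n \<omega> = h} \<in> sets M"
  using past_in_draw_history subalgebra_draw_history unfolding subalgebra_def by blast

lemma finite_pasts: "finite {h :: 'k list. length h = n}"
  using finite_lists_length_eq[of "UNIV :: 'k set" n] by simp

text \<open>An adapted function is a finite combination of indicators of histories; this reduces statements
  about adapted functions to single histories.\<close>

lemma adapted_expansion:
  fixes f :: "'a \<Rightarrow> 'c::real_vector"
  assumes "adapted n f"
  obtains g where "\<And>\<omega>. \<omega> \<in> space M \<Longrightarrow>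
    f \<omega> = (\<Sum>h | length h = n. indicator {\<omega> \<in> space M. past n \<omega> = h} \<omega> *\<^sub>R g h)"
proof -
  obtain g where g: "\<And>\<omega>. \<omega> \<in> space M \<Longrightarrow> f \<omega> = g (past n \<omega>)"
    using adapted_factor[OF assms] by blast
  show thesis
  proof
    fix \<omega> assume \<omega>: "\<omega> \<in> space M"
    have "(\<Sum>h | length h = n. indicator {\<omega> \<in> space M. past n \<omega> = h} \<omega> *\<^sub>R g h) =
        (\<Sum>h | length h = n. if past n \<omega> = h then g h else 0)"
      using \<omega> by (intro sum.cong) auto
    also have "\<dots> = f \<omega>"
      using \<omega> g finite_pasts[of n] by (simp add: sum.delta')
    finally show "f \<omega> = (\<Sum>h | length h = n. indicator {\<omega> \<in> space M. past n \<omega> = h} \<omega> *\<^sub>R g h)" ..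
  qed
qed

lemma adapted_integrable:
  fixes f :: "'a \<Rightarrow> 'c::{banach, second_countable_topology}"
  assumes "adapted n f"
  shows "integrable M f"
proof -
  obtain g where g: "\<And>\<omega>. \<omega> \<in> space M \<Longrightarrow>
    f \<omega> = (\<Sum>h | length h = n. indicator {\<omega> \<in> space M. past n \<omega> = h} \<omega> *\<^sub>R g h)"
    using adapted_expansion[OF assms] by blast
  have "integrable M (\<lambda>\<omega>. \<Sum>h | length h = n. indicator {\<omega> \<in> space M. past n \<omega> = h} \<omega> *\<^sub>R g h)"
    using past_sets by (intro Bochner_Integration.integrable_sum Bochner_Integration.integrable_scaleR_left integrable_real_indicator)
      (auto simp: emeasure_eq_measure)
  then show ?thesis
    using g by (subst Bochner_Integration.integrable_cong[OF refl]) auto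
qed

lemma adapted_measurable:
  fixes f :: "'a \<Rightarrow> 'c::{banach, second_countable_topology}"
  shows "adapted n f \<Longrightarrow> f \<in> borel_measurable M"
  by (rule borel_measurable_integrable[OF adapted_integrable])

lemma row_stochastic: "0 \<le> R $ i $ j" "(\<Sum>j\<in>UNIV. R $ i $ j) = 1"
  using stochastic by (auto simp: stochastic_matrix_def probability_vector_def row_def)

lemma C_nonneg: "\<omega> \<in> space M \<Longrightarrow> 0 \<le> C n \<omega> $ i"
proof (induction n)
  case 0
  then show ?case using initial_probability by (simp add: initial probability_vector_def)
next
  case (Suc n)
  then show ?case by (simp add: replacement row_def row_stochastic)
qed

lemma C_total: "\<omega> \<in> space M \<Longrightarrow> (\<Sum>i\<in>UNIV. C n \<omega> $ i) = real n + 1"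
proof (induction n)
  case 0
  then show ?case using initial_probability by (simp add: initial probability_vector_def)
next
  case (Suc n)
  then show ?case by (simp add: replacement row_def row_stochastic sum.distrib)
qed

text \<open>The event that the history equals \<open>h\<close> belongs to the \<open>\<sigma>\<close>-algebra of the past, so
  integrating over it lets the conditional probability in the drawing rule replace the indicator of the draw.\<close>

lemma draw_indicator_expectation:
  "(\<integral>\<omega>. indicator {\<omega> \<in> space M. past n \<omega> = h} \<omega> * indicator {\<omega> \<in> space M. X (Suc n) \<omega> = i} \<omega> \<partial>M) =
   (\<integral>\<omega>. indicator {\<omega> \<in> space M. past n \<omega> = h} \<omega> * (C n \<omega> $ i / real (Suc n)) \<partial>M)"
proof -
  interpret F: finite_measure_subalgebra M "draw_history M X n"
    by unfold_locales (rule subalgebra_draw_history)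
  let ?A = "{\<omega> \<in> space M. past n \<omega> = h}" and ?B = "{\<omega> \<in> space M. X (Suc n) \<omega> = i}"
  have B: "?B \<in> sets M"
    using measurable_sets[OF measurable_draw[of n], of "{i}"] by (simp add: vimage_def Int_def conj_commute)
  have A: "indicator ?A \<in> borel_measurable (draw_history M X n)"
    using past_in_draw_history by simp
  have int: "integrable M (\<lambda>\<omega>. indicator ?A \<omega> * indicator ?B \<omega> :: real)"
    using past_sets[of n h] B
    by (simp add: indicator_inter_arith[symmetric] emeasure_eq_measure)
  have "(\<integral>\<omega>. indicator ?A \<omega> * indicator ?B \<omega> \<partial>M) =
      (\<integral>\<omega>. indicator ?A \<omega> * real_cond_exp M (draw_history M X n) (indicator ?B) \<omega> \<partial>M)"
    using F.real_cond_exp_intg(2)[OF int A] B by simp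
  also have "\<dots> = (\<integral>\<omega>. indicator ?A \<omega> * (C n \<omega> $ i / real (Suc n)) \<partial>M)"
    using draw[of n i] past_sets[of n h] adapted_measurable[OF adapted_comp[OF adapted_C[of n], of "\<lambda>x. x $ i"]]
    by (intro integral_cong_AE) auto
  finally show ?thesis .
qed

lemma draw_single:
  fixes H :: "'a \<Rightarrow> 'c::{banach, second_countable_topology}"
  assumes "adapted n H"
  shows "(\<integral>\<omega>. indicator {\<omega> \<in> space M. X (Suc n) \<omega> = i} \<omega> *\<^sub>R H \<omega> \<partial>M) =
    (\<integral>\<omega>. (C n \<omega> $ i / real (Suc n)) *\<^sub>R H \<omega> \<partial>M)"
proof -
  obtain g where g: "\<And>\<omega>. \<omega> \<in> space M \<Longrightarrow>
    H \<omega> = (\<Sum>h | length h = n. indicator {\<omega> \<in> space M. past n \<omega> = h} \<omega> *\<^sub>R g h)"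
    using adapted_expansion[OF assms] by blast
  have expand: "(\<integral>\<omega>. Y \<omega> *\<^sub>R H \<omega> \<partial>M) =
      (\<Sum>h | length h = n. (\<integral>\<omega>. indicator {\<omega> \<in> space M. past n \<omega> = h} \<omega> * Y \<omega> \<partial>M) *\<^sub>R g h)"
    if Y: "integrable M Y" for Y :: "'a \<Rightarrow> real"
  proof -
    have I: "integrable M (\<lambda>\<omega>. indicator {\<omega> \<in> space M. past n \<omega> = h} \<omega> * Y \<omega>)" for h
      using integrable_mult_indicator[OF past_sets Y] by simp
    have "(\<integral>\<omega>. Y \<omega> *\<^sub>R H \<omega> \<partial>M) =
        (\<integral>\<omega>. (\<Sum>h | length h = n. (indicator {\<omega> \<in> space M. past n \<omega> = h} \<omega> * Y \<omega>) *\<^sub>R g h) \<partial>M)"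
      by (intro Bochner_Integration.integral_cong refl)
        (auto simp: g scaleR_sum_right mult.commute)
    also have "\<dots> = (\<Sum>h | length h = n. \<integral>\<omega>. (indicator {\<omega> \<in> space M. past n \<omega> = h} \<omega> * Y \<omega>) *\<^sub>R g h \<partial>M)"
      using I by (intro Bochner_Integration.integral_sum Bochner_Integration.integrable_scaleR_left)
    finally show ?thesis
      using I by simp
  qed
  have B: "{\<omega> \<in> space M. X (Suc n) \<omega> = i} \<in> sets M"
    using measurable_sets[OF measurable_draw[of n], of "{i}"] by (simp add: vimage_def Int_def conj_commute)
  have "integrable M (indicator {\<omega> \<in> space M. X (Suc n) \<omega> = i} :: 'a \<Rightarrow> real)"
    using B by (simp add: emeasure_eq_measure)
  moreover have "integrable M (\<lambda>\<omega>. C n \<omega> $ i / real (Suc n))"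
    using adapted_integrable[OF adapted_comp[OF adapted_C[of n], of "\<lambda>x. x $ i / real (Suc n)"]] .
  ultimately show ?thesis
    by (simp only: expand draw_indicator_expectation)
qed

text \<open>The drawing rule in the only form that is used later: inside an expectation, a function of the past
  and of the next color may be averaged over the colors with the current proportions.\<close>

lemma draw_expectation:
  fixes G :: "'a \<Rightarrow> 'k \<Rightarrow> 'c::{banach, second_countable_topology}"
  assumes G: "\<And>i. adapted n (\<lambda>\<omega>. G \<omega> i)"
  shows "(\<integral>\<omega>. G \<omega> (X (Suc n) \<omega>) \<partial>M) =
    (\<integral>\<omega>. (\<Sum>i\<in>UNIV. (C n \<omega> $ i / (real n + 1)) *\<^sub>R G \<omega> i) \<partial>M)"
proof -
  have ad1: "adapted (Suc n) (\<lambda>\<omega>. indicator {\<omega> \<in> space M. X (Suc n) \<omega> = i} \<omega> *\<^sub>R G \<omega> i)" for i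
  proof -
    have "adapted (Suc n) (\<lambda>\<omega>. (if X (Suc n) \<omega> = i then 1 else 0 :: real) *\<^sub>R G \<omega> i)"
      using adapted_comp2[OF adapted_draw[of n] adapted_mono[OF G[of i], of "Suc n"],
          of "\<lambda>x g. (if x = i then 1 else 0 :: real) *\<^sub>R g"] by simp
    then show ?thesis
      by (rule adapted_cong[THEN iffD1, rotated]) (simp add: indicator_def)
  qed
  have ad2: "adapted n (\<lambda>\<omega>. (C n \<omega> $ i / (real n + 1)) *\<^sub>R G \<omega> i)" for i
    using adapted_comp2[OF adapted_C[of n] G[of i]] .
  have "(\<integral>\<omega>. G \<omega> (X (Suc n) \<omega>) \<partial>M) =
      (\<integral>\<omega>. (\<Sum>i\<in>UNIV. indicator {\<omega> \<in> space M. X (Suc n) \<omega> = i} \<omega> *\<^sub>R G \<omega> i) \<partial>M)"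
  proof (intro Bochner_Integration.integral_cong refl)
    fix \<omega> assume \<omega>: "\<omega> \<in> space M"
    have "(\<Sum>i\<in>UNIV. indicator {\<omega> \<in> space M. X (Suc n) \<omega> = i} \<omega> *\<^sub>R G \<omega> i) =
        (\<Sum>i\<in>UNIV. if X (Suc n) \<omega> = i then G \<omega> i else 0)"
      using \<omega> by (intro sum.cong) auto
    then show "G \<omega> (X (Suc n) \<omega>) = (\<Sum>i\<in>UNIV. indicator {\<omega> \<in> space M. X (Suc n) \<omega> = i} \<omega> *\<^sub>R G \<omega> i)"
      by simp
  qed
  also have "\<dots> = (\<Sum>i\<in>UNIV. \<integral>\<omega>. indicator {\<omega> \<in> space M. X (Suc n) \<omega> = i} \<omega> *\<^sub>R G \<omega> i \<partial>M)"
    by (rule Bochner_Integration.integral_sum) (rule adapted_integrable[OF ad1])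
  also have "\<dots> = (\<Sum>i\<in>UNIV. \<integral>\<omega>. (C n \<omega> $ i / (real n + 1)) *\<^sub>R G \<omega> i \<partial>M)"
    using draw_single[OF G] by (simp add: add.commute)
  also have "\<dots> = (\<integral>\<omega>. (\<Sum>i\<in>UNIV. (C n \<omega> $ i / (real n + 1)) *\<^sub>R G \<omega> i) \<partial>M)"
    by (rule Bochner_Integration.integral_sum[symmetric]) (rule adapted_integrable[OF ad2])
  finally show ?thesis .
qed

end

section \<open>Centred draws\<close>

context urn_model
begin

text \<open>The centred effect on \<open>C \<bullet> v\<close> of the draw at time \<open>n + 1\<close>.\<close>

definition noise :: "real^'k \<Rightarrow> nat \<Rightarrow> 'a \<Rightarrow> real" where
  "noise v n \<omega> = (R *v v) $ X (Suc n) \<omega> - C n \<omega> \<bullet> (R *v v) / (real n + 1)"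

text \<open>The conditional variance of \<open>noise v n\<close> given the first \<open>n\<close> draws, see \<open>noise_square\<close>.\<close>

definition noise_variance :: "real^'k \<Rightarrow> nat \<Rightarrow> 'a \<Rightarrow> real" where
  "noise_variance v n \<omega> =
     C n \<omega> \<bullet> (\<chi> i. ((R *v v) $ i)\<^sup>2) / (real n + 1) - (C n \<omega> \<bullet> (R *v v) / (real n + 1))\<^sup>2"

lemma C_step:
  assumes "\<omega> \<in> space M"
  shows "C (Suc n) \<omega> \<bullet> v = C n \<omega> \<bullet> v + C n \<omega> \<bullet> (R *v v) / (real n + 1) + noise v n \<omega>"
proof -
  have "row i R \<bullet> v = (R *v v) $ i" for i
    by (simp add: row_def inner_vec_def matrix_vector_mult_def)
  then show ?thesis
    using assms by (simp add: replacement noise_def inner_add_left)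
qed

lemma adapted_noise: "adapted (Suc n) (noise v n)"
  unfolding noise_def
  using adapted_comp2[OF adapted_draw[of n] adapted_mono[OF adapted_C[of n], of "Suc n"],
      of "\<lambda>x c. (R *v v) $ x - c \<bullet> (R *v v) / (real n + 1)"] by simp

lemma adapted_inner: "adapted n (\<lambda>\<omega>. C n \<omega> \<bullet> v)"
  using adapted_comp[OF adapted_C] .

lemma adapted_noise_variance: "adapted n (noise_variance v n)"
  unfolding noise_variance_def
  using adapted_comp[OF adapted_C[of n],
      where g="\<lambda>c. c \<bullet> (\<chi> i. ((R *v v) $ i)\<^sup>2) / (real n + 1) - (c \<bullet> (R *v v) / (real n + 1))\<^sup>2"] .

lemma draw_mean:
  "(\<Sum>i\<in>UNIV. C n \<omega> $ i / (real n + 1) * g $ i) = C n \<omega> \<bullet> g / (real n + 1)"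
  by (simp add: inner_vec_def sum_divide_distrib)

lemma noise_mean:
  fixes H :: "'a \<Rightarrow> 'c::{banach, second_countable_topology}"
  assumes H: "adapted n H"
  shows "(\<integral>\<omega>. noise v n \<omega> *\<^sub>R H \<omega> \<partial>M) = 0"
proof -
  let ?g = "R *v v" and ?m = "\<lambda>\<omega>. C n \<omega> \<bullet> (R *v v) / (real n + 1)"
  have "(\<integral>\<omega>. noise v n \<omega> *\<^sub>R H \<omega> \<partial>M) =
      (\<integral>\<omega>. (\<Sum>i\<in>UNIV. (C n \<omega> $ i / (real n + 1)) *\<^sub>R ((?g $ i - ?m \<omega>) *\<^sub>R H \<omega>)) \<partial>M)"
    unfolding noise_def
    by (rule draw_expectation[where G="\<lambda>\<omega> i. (?g $ i - ?m \<omega>) *\<^sub>R H \<omega>"])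
      (rule adapted_comp2[OF adapted_C H])
  also have "\<dots> = (\<integral>\<omega>. 0 \<partial>M)"
  proof (intro Bochner_Integration.integral_cong refl)
    fix \<omega> assume "\<omega> \<in> space M"
    then have total: "(\<Sum>i\<in>UNIV. C n \<omega> $ i / (real n + 1)) = 1"
      by (simp add: sum_divide_distrib[symmetric] C_total)
    have "(\<Sum>i\<in>UNIV. C n \<omega> $ i / (real n + 1) * (?g $ i - ?m \<omega>)) =
        (\<Sum>i\<in>UNIV. C n \<omega> $ i / (real n + 1) * ?g $ i) - (\<Sum>i\<in>UNIV. C n \<omega> $ i / (real n + 1)) * ?m \<omega>"
      unfolding sum_distrib_right right_diff_distrib sum_subtractf ..
    also have "\<dots> = 0" unfolding draw_mean total by simp
    finally show "(\<Sum>i\<in>UNIV. (C n \<omega> $ i / (real n + 1)) *\<^sub>R ((?g $ i - ?m \<omega>) *\<^sub>R H \<omega>)) = 0"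
      by (simp only: scaleR_scaleR scaleR_sum_left[symmetric]) simp
  qed
  finally show ?thesis by simp
qed

lemma noise_variance_eq:
  assumes \<omega>: "\<omega> \<in> space M"
  shows "(\<Sum>i\<in>UNIV. C n \<omega> $ i / (real n + 1) * ((R *v v) $ i - C n \<omega> \<bullet> (R *v v) / (real n + 1))\<^sup>2) =
    noise_variance v n \<omega>"
proof -
  let ?g = "R *v v" and ?m = "C n \<omega> \<bullet> (R *v v) / (real n + 1)"
  have total: "(\<Sum>i\<in>UNIV. C n \<omega> $ i / (real n + 1)) = 1"
    using \<omega> by (simp add: sum_divide_distrib[symmetric] C_total)
  have "(\<Sum>i\<in>UNIV. C n \<omega> $ i / (real n + 1) * (?g $ i - ?m)\<^sup>2) =
      (\<Sum>i\<in>UNIV. C n \<omega> $ i / (real n + 1) * (\<chi> i. (?g $ i)\<^sup>2) $ i)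
      - 2 * ?m * (\<Sum>i\<in>UNIV. C n \<omega> $ i / (real n + 1) * ?g $ i)
      + (\<Sum>i\<in>UNIV. C n \<omega> $ i / (real n + 1)) * ?m\<^sup>2"
    unfolding sum_distrib_right sum_distrib_left sum_subtractf[symmetric] sum.distrib[symmetric]
    by (rule sum.cong) (simp_all add: power2_eq_square algebra_simps)
  also have "\<dots> = noise_variance v n \<omega>"
    unfolding draw_mean total noise_variance_def by (simp add: power2_eq_square)
  finally show ?thesis .
qed

lemma noise_variance_nonneg: "\<omega> \<in> space M \<Longrightarrow> 0 \<le> noise_variance v n \<omega>"
  unfolding noise_variance_eq[symmetric] by (intro sum_nonneg mult_nonneg_nonneg) (auto simp: C_nonneg)

lemma noise_square:
  fixes H :: "'a \<Rightarrow> 'c::{banach, second_countable_topology}"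
  assumes H: "adapted n H"
  shows "(\<integral>\<omega>. (noise v n \<omega>)\<^sup>2 *\<^sub>R H \<omega> \<partial>M) = (\<integral>\<omega>. noise_variance v n \<omega> *\<^sub>R H \<omega> \<partial>M)"
proof -
  let ?g = "R *v v" and ?m = "\<lambda>\<omega>. C n \<omega> \<bullet> (R *v v) / (real n + 1)"
  have "(\<integral>\<omega>. (noise v n \<omega>)\<^sup>2 *\<^sub>R H \<omega> \<partial>M) =
      (\<integral>\<omega>. (\<Sum>i\<in>UNIV. (C n \<omega> $ i / (real n + 1)) *\<^sub>R ((?g $ i - ?m \<omega>)\<^sup>2 *\<^sub>R H \<omega>)) \<partial>M)"
    unfolding noise_def
    by (rule draw_expectation[where G="\<lambda>\<omega> i. (?g $ i - ?m \<omega>)\<^sup>2 *\<^sub>R H \<omega>"])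
      (rule adapted_comp2[OF adapted_C H])
  also have "\<dots> = (\<integral>\<omega>. noise_variance v n \<omega> *\<^sub>R H \<omega> \<partial>M)"
    by (intro Bochner_Integration.integral_cong refl)
      (simp only: scaleR_scaleR scaleR_sum_left[symmetric] noise_variance_eq)
  finally show ?thesis .
qed

lemma noise_bound:
  assumes K: "\<And>i. \<bar>(R *v v) $ i\<bar> \<le> K" and \<omega>: "\<omega> \<in> space M"
  shows "\<bar>noise v n \<omega>\<bar> \<le> 2 * K"
proof -
  have "\<bar>C n \<omega> \<bullet> (R *v v) / (real n + 1)\<bar> \<le> (\<Sum>i\<in>UNIV. C n \<omega> $ i / (real n + 1) * K)"
    unfolding draw_mean[symmetric] using K C_nonneg[OF \<omega>]
    by (intro order_trans[OF sum_abs] sum_mono) (auto simp: abs_mult intro!: divide_right_mono mult_left_mono)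
  also have "\<dots> = K"
    using C_total[OF \<omega>, of n] by (simp add: sum_distrib_right[symmetric] sum_divide_distrib[symmetric])
  finally show ?thesis
    unfolding noise_def using K[of "X (Suc n) \<omega>"] by linarith
qed


end

section \<open>Square summable martingales\<close>

context urn_model
begin

text \<open>Testing against all adapted functions states that the conditional means vanish, without
  conditional expectations.\<close>

definition martingale_difference :: "(nat \<Rightarrow> 'a \<Rightarrow> real) \<Rightarrow> bool" where
  "martingale_difference d \<longleftrightarrow> (\<forall>n. adapted (Suc n) (d n)) \<and>
     (\<forall>n H. adapted n H \<longrightarrow> (\<integral>\<omega>. H \<omega> * d n \<omega> \<partial>M) = (0::real))"

lemma adapted_martingale:
  assumes "martingale_difference d"
  shows "adapted n (\<lambda>\<omega>. \<Sum>m<n. d m \<omega>)"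
  using assms unfolding martingale_difference_def
  by (intro adapted_sum) (auto intro: adapted_mono)

lemma martingale_square:
  assumes d: "martingale_difference d" and "N \<le> n"
  shows "(\<integral>\<omega>. (\<Sum>m=N..<n. d m \<omega>)\<^sup>2 \<partial>M) = (\<Sum>m=N..<n. \<integral>\<omega>. (d m \<omega>)\<^sup>2 \<partial>M)"
  using \<open>N \<le> n\<close>
proof (induction n rule: dec_induct)
  case (step n)
  have ad: "adapted (Suc n) (d n)" using d by (simp add: martingale_difference_def)
  have ads: "adapted n (\<lambda>\<omega>. \<Sum>m=N..<n. d m \<omega>)"
    using d unfolding martingale_difference_def
    by (intro adapted_sum) (auto intro: adapted_mono)
  note ads' = adapted_mono[OF ads, of "Suc n"]
  have "(\<integral>\<omega>. (\<Sum>m=N..<Suc n. d m \<omega>)\<^sup>2 \<partial>M) =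
      (\<integral>\<omega>. (\<Sum>m=N..<n. d m \<omega>)\<^sup>2 + 2 * ((\<Sum>m=N..<n. d m \<omega>) * d n \<omega>) + (d n \<omega>)\<^sup>2 \<partial>M)"
    using step by (intro Bochner_Integration.integral_cong) (auto simp: power2_eq_square algebra_simps)
  also have "\<dots> = (\<integral>\<omega>. (\<Sum>m=N..<n. d m \<omega>)\<^sup>2 \<partial>M) + 2 * (\<integral>\<omega>. (\<Sum>m=N..<n. d m \<omega>) * d n \<omega> \<partial>M)
      + (\<integral>\<omega>. (d n \<omega>)\<^sup>2 \<partial>M)"
    using adapted_integrable[OF adapted_comp[OF ads', where g="\<lambda>x. x\<^sup>2"]]
      adapted_integrable[OF adapted_comp2[OF ads' ad, where h="(*)"]]
      adapted_integrable[OF adapted_comp[OF ad, where g="\<lambda>x. x\<^sup>2"]] by simp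
  also have "(\<integral>\<omega>. (\<Sum>m=N..<n. d m \<omega>) * d n \<omega> \<partial>M) = 0"
    using d ads by (simp add: martingale_difference_def)
  finally show ?case using step by simp
qed simp

text \<open>Kolmogorov's inequality. Switching the increments off once the partial sums have left
  the interval of radius \<open>\<epsilon>\<close> gives another martingale, with smaller variance. It stays outside that interval
  forever if the original one ever leaves it, so Chebyshev's inequality at a single late time suffices.\<close>

lemma martingale_maximal_inequality:
  assumes d: "martingale_difference d" and s: "summable (\<lambda>n. \<integral>\<omega>. (d n \<omega>)\<^sup>2 \<partial>M)" and \<epsilon>: "0 < \<epsilon>"
  shows "measure M {\<omega> \<in> space M. \<exists>n\<ge>N. \<epsilon> \<le> \<bar>\<Sum>m=N..<n. d m \<omega>\<bar>} \<le> (\<Sum>n. \<integral>\<omega>. (d (n + N) \<omega>)\<^sup>2 \<partial>M) / \<epsilon>\<^sup>2"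
proof -
  have ad: "adapted (Suc n) (d n)" for n using d by (simp add: martingale_difference_def)
  have [measurable]: "d n \<in> borel_measurable M" for n using adapted_measurable[OF ad] .
  define small where "small k \<omega> \<longleftrightarrow> (\<forall>j\<in>{N..k}. \<bar>\<Sum>m=N..<j. d m \<omega>\<bar> < \<epsilon>)" for k \<omega>
  have ad_sum: "adapted k (\<lambda>\<omega>. \<Sum>m=N..<j. d m \<omega>)" if "j \<le> k" for j k
    using that by (intro adapted_sum adapted_mono[OF ad]) auto
  have ad_small: "adapted k (small k)" for k
  proof (rule adaptedI)
    fix \<omega> \<omega>' assume *: "\<omega> \<in> space M" "\<omega>' \<in> space M" "past k \<omega> = past k \<omega>'"
    have "(\<Sum>m=N..<j. d m \<omega>) = (\<Sum>m=N..<j. d m \<omega>')" if "j \<in> {N..k}" for j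
      using that by (intro adaptedD[OF ad_sum *]) auto
    then show "small k \<omega> = small k \<omega>'"
      unfolding small_def by (intro ball_cong refl) simp
  qed
  \<comment> \<open>the increments stopped at the first exit from the interval of radius \<open>\<epsilon>\<close>\<close>
  define e where "e k \<omega> = (if small k \<omega> then d k \<omega> else 0)" for k \<omega>
  have e: "martingale_difference e"
    unfolding martingale_difference_def
  proof (intro conjI allI impI)
    show "adapted (Suc n) (e n)" for n
      unfolding e_def using adapted_comp2[OF adapted_mono[OF ad_small[of n], of "Suc n"] ad[of n],
          of "\<lambda>b x. if b then x else 0"] by simp
    fix n and H :: "'a \<Rightarrow> real" assume H: "adapted n H"
    have "(\<integral>\<omega>. H \<omega> * e n \<omega> \<partial>M) = (\<integral>\<omega>. (if small n \<omega> then H \<omega> else 0) * d n \<omega> \<partial>M)"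
      unfolding e_def by (intro Bochner_Integration.integral_cong) auto
    also have "\<dots> = 0"
      using d adapted_comp2[OF ad_small[of n] H, where h="\<lambda>b x. if b then x else 0"]
      unfolding martingale_difference_def by simp
    finally show "(\<integral>\<omega>. H \<omega> * e n \<omega> \<partial>M) = 0" .
  qed
  have ade: "adapted (Suc n) (e n)" for n using e by (simp add: martingale_difference_def)
  have stopped: "(small n \<omega> \<and> (\<Sum>m=N..<n. e m \<omega>) = (\<Sum>m=N..<n. d m \<omega>)) \<or>
      (\<not> small n \<omega> \<and> \<epsilon> \<le> \<bar>\<Sum>m=N..<n. e m \<omega>\<bar>)" if "N \<le> n" for n \<omega>
    using that
  proof (induction n rule: dec_induct)
    case base
    then show ?case using \<epsilon> by (simp add: small_def)
  next
    case (step n)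
    have small_Suc: "small (Suc n) \<omega> \<longleftrightarrow> small n \<omega> \<and> \<bar>\<Sum>m=N..<Suc n. d m \<omega>\<bar> < \<epsilon>"
      unfolding small_def using step(1) by (auto simp: atLeastAtMostSuc_conv)
    show ?case
    proof (cases "small n \<omega>")
      case True
      then have "(\<Sum>m=N..<Suc n. e m \<omega>) = (\<Sum>m=N..<Suc n. d m \<omega>)"
        using step by (simp add: e_def)
      then show ?thesis
        using True small_Suc by (auto simp only: not_less)
    next
      case False
      then show ?thesis using step small_Suc by (simp add: e_def)
    qed
  qed
  define A where "A n = {\<omega> \<in> space M. \<not> small n \<omega>}" for n
  have A_meas [measurable]: "A n \<in> sets M" for n
    unfolding A_def small_def by measurable
  let ?r = "\<Sum>n. \<integral>\<omega>. (d (n + N) \<omega>)\<^sup>2 \<partial>M"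
  have A_bound: "measure M (A n) \<le> ?r / \<epsilon>\<^sup>2" if "N \<le> n" for n
  proof -
    have int_d: "integrable M (\<lambda>\<omega>. (d m \<omega>)\<^sup>2)" for m
      using adapted_integrable[OF adapted_comp[OF ad, where g="\<lambda>x. x\<^sup>2"]] .
    have int_e: "integrable M (\<lambda>\<omega>. (e m \<omega>)\<^sup>2)" for m
      using adapted_integrable[OF adapted_comp[OF ade, where g="\<lambda>x. x\<^sup>2"]] .
    have int_s: "integrable M (\<lambda>\<omega>. (\<Sum>m=N..<n. e m \<omega>)\<^sup>2)"
      by (rule adapted_integrable[of n], rule adapted_comp, rule adapted_sum)
        (auto intro: adapted_mono[OF ade])
    have "\<epsilon>\<^sup>2 * measure M (A n) = (\<integral>\<omega>. \<epsilon>\<^sup>2 * indicator (A n) \<omega> \<partial>M)"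
      by simp
    also have "\<dots> \<le> (\<integral>\<omega>. (\<Sum>m=N..<n. e m \<omega>)\<^sup>2 \<partial>M)"
    proof (rule integral_mono[OF _ int_s])
      show "integrable M (\<lambda>\<omega>. \<epsilon>\<^sup>2 * indicator (A n) \<omega>)"
        by (simp add: emeasure_eq_measure)
      fix \<omega> assume "\<omega> \<in> space M"
      show "\<epsilon>\<^sup>2 * indicator (A n) \<omega> \<le> (\<Sum>m=N..<n. e m \<omega>)\<^sup>2"
      proof (cases "\<omega> \<in> A n")
        case True
        then have "\<epsilon> \<le> \<bar>\<Sum>m=N..<n. e m \<omega>\<bar>"
          using stopped[OF that, of \<omega>] by (simp add: A_def)
        then have "\<epsilon>\<^sup>2 \<le> \<bar>\<Sum>m=N..<n. e m \<omega>\<bar>\<^sup>2"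
          using \<epsilon> by (intro power_mono) auto
        then show ?thesis using True by simp
      qed simp
    qed
    also have "\<dots> = (\<Sum>m=N..<n. \<integral>\<omega>. (e m \<omega>)\<^sup>2 \<partial>M)"
      by (rule martingale_square[OF e that])
    also have "\<dots> \<le> (\<Sum>m=N..<n. \<integral>\<omega>. (d m \<omega>)\<^sup>2 \<partial>M)"
      by (intro sum_mono integral_mono int_d int_e) (simp add: e_def)
    also have "\<dots> = (\<Sum>m<n - N. \<integral>\<omega>. (d (m + N) \<omega>)\<^sup>2 \<partial>M)"
      using that sum.shift_bounds_nat_ivl[of "\<lambda>m. \<integral>\<omega>. (d m \<omega>)\<^sup>2 \<partial>M" 0 N "n - N"]
      by (simp add: lessThan_atLeast0)
    also have "\<dots> \<le> ?r"
      using summable_ignore_initial_segment[OF s, of N] by (intro sum_le_suminf) auto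
    finally show ?thesis using \<epsilon> by (simp add: field_simps)
  qed
  have "{\<omega> \<in> space M. \<exists>n\<ge>N. \<epsilon> \<le> \<bar>\<Sum>m=N..<n. d m \<omega>\<bar>} = (\<Union>n. A (N + n))"
  proof (intro set_eqI iffI)
    fix \<omega> assume "\<omega> \<in> {\<omega> \<in> space M. \<exists>n\<ge>N. \<epsilon> \<le> \<bar>\<Sum>m=N..<n. d m \<omega>\<bar>}"
    then obtain n where "\<omega> \<in> space M" "N \<le> n" "\<epsilon> \<le> \<bar>\<Sum>m=N..<n. d m \<omega>\<bar>" by blast
    then have "\<omega> \<in> A (N + (n - N))"
      by (auto simp: A_def small_def not_less)
    then show "\<omega> \<in> (\<Union>n. A (N + n))" by blast
  next
    fix \<omega> assume "\<omega> \<in> (\<Union>n. A (N + n))"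
    then show "\<omega> \<in> {\<omega> \<in> space M. \<exists>n\<ge>N. \<epsilon> \<le> \<bar>\<Sum>m=N..<n. d m \<omega>\<bar>}"
      by (auto simp: A_def small_def not_less)
  qed
  moreover have "(\<lambda>n. measure M (A (N + n))) \<longlonglongrightarrow> measure M (\<Union>n. A (N + n))"
    by (rule finite_Lim_measure_incseq) (auto simp: incseq_def A_def small_def)
  ultimately show ?thesis
    using A_bound by (intro LIMSEQ_le_const2[of "\<lambda>n. measure M (A (N + n))"]) auto
qed

text \<open>By the maximal inequality the oscillation after time \<open>N\<close> exceeds \<open>\<epsilon>\<close> with probability at most the
  tail of the variances over \<open>\<epsilon>\<^sup>2\<close>, so almost every path is a Cauchy sequence; orthogonality of the increments gives
  the Cauchy property in square mean.\<close>

theorem martingale_convergence: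
  assumes d: "martingale_difference d" and s: "summable (\<lambda>n. \<integral>\<omega>. (d n \<omega>)\<^sup>2 \<partial>M)"
  obtains T where "T \<in> borel_measurable M" "AE \<omega> in M. (\<lambda>n. \<Sum>m<n. d m \<omega>) \<longlonglongrightarrow> T \<omega>"
    "tendsto_L2 M (\<lambda>n \<omega>. \<Sum>m<n. d m \<omega>) T"
proof -
  have ad: "adapted (Suc n) (d n)" for n using d by (simp add: martingale_difference_def)
  have [measurable]: "d n \<in> borel_measurable M" for n using adapted_measurable[OF ad] .
  define r where "r N = (\<Sum>n. \<integral>\<omega>. (d (n + N) \<omega>)\<^sup>2 \<partial>M)" for N
  have r: "r \<longlonglongrightarrow> 0"
    unfolding r_def by (rule suminf_exist_split2[OF s])
  have split: "(\<Sum>m<n. d m \<omega>) - (\<Sum>m<N. d m \<omega>) = (\<Sum>m=N..<n. d m \<omega>)" if "N \<le> n" for n N \<omega>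
    using sum_diff_nat_ivl[of 0 N n "\<lambda>m. d m \<omega>"] that by (simp add: lessThan_atLeast0)
  have small: "AE \<omega> in M. \<exists>N. \<forall>n\<ge>N. \<bar>\<Sum>m=N..<n. d m \<omega>\<bar> < \<epsilon>" if \<epsilon>: "0 < \<epsilon>" for \<epsilon>
  proof -
    define B where "B = {\<omega> \<in> space M. \<forall>N. \<exists>n\<ge>N. \<epsilon> \<le> \<bar>\<Sum>m=N..<n. d m \<omega>\<bar>}"
    have B: "B \<in> sets M" unfolding B_def by measurable
    have "measure M B \<le> r N / \<epsilon>\<^sup>2" for N
    proof (rule order_trans[OF finite_measure_mono])
      show "B \<subseteq> {\<omega> \<in> space M. \<exists>n\<ge>N. \<epsilon> \<le> \<bar>\<Sum>m=N..<n. d m \<omega>\<bar>}"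
        by (auto simp: B_def)
      show "{\<omega> \<in> space M. \<exists>n\<ge>N. \<epsilon> \<le> \<bar>\<Sum>m=N..<n. d m \<omega>\<bar>} \<in> sets M"
        by measurable
    qed (unfold r_def, rule martingale_maximal_inequality[OF d s \<epsilon>])
    moreover have "(\<lambda>N. r N / \<epsilon>\<^sup>2) \<longlonglongrightarrow> 0 / \<epsilon>\<^sup>2"
      using \<epsilon> by (intro tendsto_intros r) auto
    ultimately have "measure M B \<le> 0"
      by (intro LIMSEQ_le_const[of "\<lambda>N. r N / \<epsilon>\<^sup>2"]) auto
    then have "emeasure M B = 0"
      by (simp add: emeasure_eq_measure measure_le_0_iff)
    with B show ?thesis
      by (intro AE_I[of _ _ B]) (auto simp: B_def not_less)
  qed
  have "AE \<omega> in M. \<forall>k. \<exists>N. \<forall>n\<ge>N. \<bar>\<Sum>m=N..<n. d m \<omega>\<bar> < 1 / real (Suc k)"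
    unfolding AE_all_countable by (intro allI small) simp
  then have conv: "AE \<omega> in M. convergent (\<lambda>n. \<Sum>m<n. d m \<omega>)"
  proof eventually_elim
    case (elim \<omega>)
    have "Cauchy (\<lambda>n. \<Sum>m<n. d m \<omega>)"
    proof (rule CauchyI)
      fix e :: real assume "0 < e"
      then obtain k where k: "1 / real (Suc k) < e / 2"
        using nat_approx_posE[of "e / 2"] by auto
      from elim obtain N where N: "\<And>n. n \<ge> N \<Longrightarrow> \<bar>\<Sum>m=N..<n. d m \<omega>\<bar> < 1 / real (Suc k)"
        by blast
      have "norm ((\<Sum>m<m. d m \<omega>) - (\<Sum>m<n. d m \<omega>)) < e" if "m \<ge> N" "n \<ge> N" for m n
        using N[OF that(1)] N[OF that(2)] k split[OF that(1), of \<omega>] split[OF that(2), of \<omega>]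
        unfolding real_norm_def by linarith
      then show "\<exists>N. \<forall>m\<ge>N. \<forall>n\<ge>N. norm ((\<Sum>m<m. d m \<omega>) - (\<Sum>m<n. d m \<omega>)) < e" by blast
    qed
    then show ?case by (rule Cauchy_convergent)
  qed
  define T where "T \<omega> = lim (\<lambda>n. \<Sum>m<n. d m \<omega>)" for \<omega>
  have T: "T \<in> borel_measurable M"
    unfolding T_def by measurable
  have lim: "AE \<omega> in M. (\<lambda>n. \<Sum>m<n. d m \<omega>) \<longlonglongrightarrow> T \<omega>"
    using conv by eventually_elim (simp add: T_def convergent_LIMSEQ_iff)
  have "tendsto_L2 M (\<lambda>n \<omega>. \<Sum>m<n. d m \<omega>) T"
  proof (rule tendsto_L2_limit[OF _ T _ lim _ r])
    show "integrable M (\<lambda>\<omega>. (\<Sum>m<n. d m \<omega>)\<^sup>2)" for n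
      using adapted_integrable[OF adapted_comp[OF adapted_martingale[OF d, of n], where g="\<lambda>x. x\<^sup>2"]] .
    fix n m :: nat assume "n \<le> m"
    have "(\<integral>\<omega>. ((\<Sum>k<m. d k \<omega>) - (\<Sum>k<n. d k \<omega>))\<^sup>2 \<partial>M) = (\<integral>\<omega>. (\<Sum>k=n..<m. d k \<omega>)\<^sup>2 \<partial>M)"
      by (simp only: split[OF \<open>n \<le> m\<close>])
    also have "\<dots> = (\<Sum>k=n..<m. \<integral>\<omega>. (d k \<omega>)\<^sup>2 \<partial>M)"
      by (rule martingale_square[OF d \<open>n \<le> m\<close>])
    also have "\<dots> = (\<Sum>k<m - n. \<integral>\<omega>. (d (k + n) \<omega>)\<^sup>2 \<partial>M)"
      using \<open>n \<le> m\<close> sum.shift_bounds_nat_ivl[of "\<lambda>m. \<integral>\<omega>. (d m \<omega>)\<^sup>2 \<partial>M" 0 n "m - n"]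
      by (simp add: lessThan_atLeast0)
    also have "\<dots> \<le> r n"
      unfolding r_def using summable_ignore_initial_segment[OF s, of n] by (intro sum_le_suminf) auto
    finally show "(\<integral>\<omega>. ((\<Sum>k<m. d k \<omega>) - (\<Sum>k<n. d k \<omega>))\<^sup>2 \<partial>M) \<le> r n" .
  qed measurable
  with T lim show thesis by (rule that)
qed

end

section \<open>Linear functionals along eigenvectors\<close>

lemma growth_bigtheta:
  assumes "\<mu> > -1"
  shows "growth \<mu> \<in> \<Theta>(\<lambda>n. real n powr \<mu>)"
proof (rule bigthetaI_tendsto[OF _ growth_asymptotics[OF assms]])
  show "inverse (Gamma (1 + \<mu>)) \<noteq> 0" using assms Gamma_real_pos[of "1 + \<mu>"] by (simp add: less_imp_neq[symmetric])
qed

text \<open>The terms have order \<open>n powr (s - 1 - 2 * \<mu>)\<close>.\<close>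

lemma summable_growth:
  assumes \<mu>: "\<mu> > -1" and s: "s > -1" and less: "s < 2 * \<mu>"
  shows "summable (\<lambda>n. growth s n / (real n + 1) / (growth \<mu> (Suc n))\<^sup>2)"
proof (rule summable_comparison_test_bigo)
  show "summable (\<lambda>n. norm (real n powr (s - 1 - 2 * \<mu>)))"
    using less by (simp add: summable_real_powr_iff)
  have g: "(\<lambda>n. growth \<mu> (Suc n)) \<in> \<Theta>(\<lambda>n. real (Suc n) powr \<mu>)"
    by (rule landau_theta.compose[OF growth_bigtheta[OF \<mu>]]) (rule filterlim_Suc)
  note g' = g[THEN bigtheta_sym[THEN iffD1]]
  have "(\<lambda>n. growth s n / (real n + 1) / (growth \<mu> (Suc n))\<^sup>2) \<in>
      \<Theta>(\<lambda>n. real n powr s / (real n + 1) / (real (Suc n) powr \<mu>)\<^sup>2)"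
    unfolding power2_eq_square by (intro landau_theta.divide landau_theta.mult g g' growth_bigtheta s bigtheta_refl)
      (use growth_pos[OF \<mu>] in \<open>auto simp: less_imp_neq[symmetric]\<close>)
  also have "(\<lambda>n. real n powr s / (real n + 1) / (real (Suc n) powr \<mu>)\<^sup>2) \<in>
      \<Theta>(\<lambda>n. real n powr (s - 1 - 2 * \<mu>))"
    by real_asymp
  finally show "(\<lambda>n. growth s n / (real n + 1) / (growth \<mu> (Suc n))\<^sup>2) \<in>
      O(\<lambda>n. real n powr (s - 1 - 2 * \<mu>))" by (rule bigthetaD1)
qed

lemma not_summable_shifted_harmonic:
  assumes "0 < (a::real)"
  shows "\<not> summable (\<lambda>n. a / (real n + b))"
proof
  assume "summable (\<lambda>n. a / (real n + b))"
  moreover have "eventually (\<lambda>n. real n + b > 0) sequentially" by real_asymp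
  then have "eventually (\<lambda>n. norm (a / (real n + b)) = a / (real n + b)) sequentially"
    by eventually_elim (use assms in simp)
  ultimately have "summable (\<lambda>n. norm (a / (real n + b)))"
    by (subst summable_cong)
  moreover have "(\<lambda>n. 1 / real n) \<in> O(\<lambda>n. a / (real n + b))"
    using assms by real_asymp
  ultimately have "summable (\<lambda>n. 1 / real n)"
    by (rule summable_comparison_test_bigo)
  then show False using not_summable_harmonic[where 'a=real] by (simp add: inverse_eq_divide)
qed

context urn_model
begin

lemma martingale_difference_noise: "martingale_difference (\<lambda>n \<omega>. w n * noise v n \<omega>)"
  unfolding martingale_difference_def
proof (intro conjI allI impI)
  show "adapted (Suc n) (\<lambda>\<omega>. w n * noise v n \<omega>)" for n
    using adapted_comp[OF adapted_noise, where g="\<lambda>x. w n * x"] .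
  fix n and H :: "'a \<Rightarrow> real" assume "adapted n H"
  then show "(\<integral>\<omega>. H \<omega> * (w n * noise v n \<omega>) \<partial>M) = 0"
    using noise_mean[of n H v] by (simp add: mult.left_commute[of _ "w n"]) (simp add: mult.commute)
qed

lemma eigenvector_expectation:
  assumes u: "R *v u = s *\<^sub>R u"
  shows "(\<integral>\<omega>. C n \<omega> \<bullet> u \<partial>M) = (c \<bullet> u) * growth s n"
proof (induction n)
  case 0
  have "(\<integral>\<omega>. C 0 \<omega> \<bullet> u \<partial>M) = (\<integral>\<omega>. c \<bullet> u \<partial>M)"
    by (intro Bochner_Integration.integral_cong) (simp_all add: initial)
  then show ?case by (simp add: prob_space)
next
  case (Suc n)
  have "(\<integral>\<omega>. C (Suc n) \<omega> \<bullet> u \<partial>M) = (\<integral>\<omega>. C n \<omega> \<bullet> u * (1 + s / (real n + 1)) + noise u n \<omega> \<partial>M)"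
    by (intro Bochner_Integration.integral_cong refl)
      (simp add: C_step[where v=u] u algebra_simps)
  also have "\<dots> = (\<integral>\<omega>. C n \<omega> \<bullet> u \<partial>M) * (1 + s / (real n + 1)) + (\<integral>\<omega>. noise u n \<omega> \<partial>M)"
    using adapted_integrable[OF adapted_inner[of n u]] adapted_integrable[OF adapted_noise[of n u]]
    by simp
  also have "(\<integral>\<omega>. noise u n \<omega> \<partial>M) = 0"
    using noise_mean[OF adapted_const[where z="1::real"], where v=u] by simp
  finally show ?case using Suc by (simp add: growth_Suc)
qed

text \<open>If \<open>u\<close> dominates the squares of the entries of \<open>R *v v\<close>, then so does \<open>C n \<bullet> u\<close> for the
  conditional variances, and its expectation is known exactly because \<open>u\<close> is an eigenvector.\<close>

lemma noise_variance_bound: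
  assumes u: "R *v u = s *\<^sub>R u" and K: "\<And>i. ((R *v v) $ i)\<^sup>2 \<le> K * u $ i"
  shows "(\<integral>\<omega>. (noise v n \<omega>)\<^sup>2 \<partial>M) \<le> K * (c \<bullet> u) * (growth s n / (real n + 1))"
proof -
  have "(\<integral>\<omega>. (noise v n \<omega>)\<^sup>2 \<partial>M) = (\<integral>\<omega>. noise_variance v n \<omega> \<partial>M)"
    using noise_square[OF adapted_const[where z="1::real"], where v=v] by simp
  also have "\<dots> \<le> (\<integral>\<omega>. K * (C n \<omega> \<bullet> u) / (real n + 1) \<partial>M)"
  proof (rule integral_mono)
    show "integrable M (noise_variance v n)"
      by (rule adapted_integrable[OF adapted_noise_variance])
    show "integrable M (\<lambda>\<omega>. K * (C n \<omega> \<bullet> u) / (real n + 1))"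
      using adapted_integrable[OF adapted_inner[of n u]] by simp
    fix \<omega> assume \<omega>: "\<omega> \<in> space M"
    have "C n \<omega> \<bullet> (\<chi> i. ((R *v v) $ i)\<^sup>2) \<le> (\<Sum>i\<in>UNIV. C n \<omega> $ i * (K * u $ i))"
      unfolding inner_vec_def using K C_nonneg[OF \<omega>] by (auto intro!: sum_mono mult_left_mono)
    also have "\<dots> = K * (C n \<omega> \<bullet> u)"
      by (simp add: inner_vec_def sum_distrib_left mult.left_commute)
    finally have "C n \<omega> \<bullet> (\<chi> i. ((R *v v) $ i)\<^sup>2) / (real n + 1) \<le> K * (C n \<omega> \<bullet> u) / (real n + 1)"
      by (rule divide_right_mono) simp
    then show "noise_variance v n \<omega> \<le> K * (C n \<omega> \<bullet> u) / (real n + 1)"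
      unfolding noise_variance_def using zero_le_power2[of "C n \<omega> \<bullet> (R *v v) / (real n + 1)"] by linarith
  qed
  also have "\<dots> = K * (c \<bullet> u) * (growth s n / (real n + 1))"
    using eigenvector_expectation[OF u, of n] by simp
  finally show ?thesis .
qed

lemma summable_noise:
  assumes u: "R *v u = s *\<^sub>R u" and K: "\<And>i. ((R *v v) $ i)\<^sup>2 \<le> K * u $ i"
    and s: "s > -1" and \<mu>: "\<mu> > -1" "s < 2 * \<mu>"
  shows "summable (\<lambda>n. \<integral>\<omega>. (1 / growth \<mu> (Suc n) * noise v n \<omega>)\<^sup>2 \<partial>M)"
proof (rule summable_comparison_test')
  show "summable (\<lambda>n. K * (c \<bullet> u) * (growth s n / (real n + 1) / (growth \<mu> (Suc n))\<^sup>2))"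
    by (intro summable_mult summable_growth s \<mu>)
  show "norm (\<integral>\<omega>. (1 / growth \<mu> (Suc n) * noise v n \<omega>)\<^sup>2 \<partial>M) \<le>
      K * (c \<bullet> u) * (growth s n / (real n + 1) / (growth \<mu> (Suc n))\<^sup>2)" if "n \<ge> 0" for n
  proof -
    have "(\<integral>\<omega>. (1 / growth \<mu> (Suc n) * noise v n \<omega>)\<^sup>2 \<partial>M) =
        (\<integral>\<omega>. (noise v n \<omega>)\<^sup>2 \<partial>M) / (growth \<mu> (Suc n))\<^sup>2"
      by (simp add: power_divide)
    also have "\<dots> \<le> K * (c \<bullet> u) * (growth s n / (real n + 1)) / (growth \<mu> (Suc n))\<^sup>2"
      by (intro divide_right_mono noise_variance_bound[OF u K]) simp
    finally show ?thesis by simp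
  qed
qed

lemma eigenvector_martingale:
  assumes v: "R *v v = \<mu> *\<^sub>R v" and \<mu>: "\<mu> > -1" and \<omega>: "\<omega> \<in> space M"
  shows "C n \<omega> \<bullet> v = growth \<mu> n * (c \<bullet> v + (\<Sum>m<n. 1 / growth \<mu> (Suc m) * noise v m \<omega>))"
proof (induction n)
  case 0
  then show ?case using \<omega> by (simp add: initial)
next
  case (Suc n)
  have "C (Suc n) \<omega> \<bullet> v = C n \<omega> \<bullet> v * (1 + \<mu> / (real n + 1)) + noise v n \<omega>"
    by (simp add: C_step[OF \<omega>] v algebra_simps)
  also have "C n \<omega> \<bullet> v * (1 + \<mu> / (real n + 1)) =
      growth \<mu> (Suc n) * (c \<bullet> v + (\<Sum>m<n. 1 / growth \<mu> (Suc m) * noise v m \<omega>))"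
    unfolding Suc by (simp add: growth_Suc)
  finally show ?case
    using growth_pos[OF \<mu>, of "Suc n"] by (simp add: distrib_left)
qed

theorem eigenvector_convergence:
  assumes v: "R *v v = \<mu> *\<^sub>R v" and u: "R *v u = s *\<^sub>R u"
    and K: "\<And>i. (v $ i)\<^sup>2 \<le> K * u $ i"
    and s: "s > -1" and \<mu>: "\<mu> > -1" "s < 2 * \<mu>"
  obtains T where "T \<in> borel_measurable M"
    "AE \<omega> in M. (\<lambda>n. C n \<omega> \<bullet> v / growth \<mu> n) \<longlonglongrightarrow> T \<omega>"
    "tendsto_L2 M (\<lambda>n \<omega>. C n \<omega> \<bullet> v / growth \<mu> n) T"
proof -
  let ?d = "\<lambda>n \<omega>. 1 / growth \<mu> (Suc n) * noise v n \<omega>"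
  have "((R *v v) $ i)\<^sup>2 \<le> (\<mu>\<^sup>2 * K) * u $ i" for i
    using mult_left_mono[OF K[of i], of "\<mu>\<^sup>2"] by (simp add: v power_mult_distrib)
  from summable_noise[OF u this s \<mu>] obtain T where T [measurable]: "T \<in> borel_measurable M"
    and lim: "AE \<omega> in M. (\<lambda>n. \<Sum>m<n. ?d m \<omega>) \<longlonglongrightarrow> T \<omega>"
    and L2: "tendsto_L2 M (\<lambda>n \<omega>. \<Sum>m<n. ?d m \<omega>) T"
    by (rule martingale_convergence[OF martingale_difference_noise])
  have eq: "C n \<omega> \<bullet> v / growth \<mu> n = c \<bullet> v + (\<Sum>m<n. ?d m \<omega>)" if "\<omega> \<in> space M" for n \<omega>
    using growth_pos[OF \<mu>(1), of n] by (subst eigenvector_martingale[OF v \<mu>(1) that]) simp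
  show thesis
  proof
    show "(\<lambda>\<omega>. c \<bullet> v + T \<omega>) \<in> borel_measurable M" by measurable
    show "AE \<omega> in M. (\<lambda>n. C n \<omega> \<bullet> v / growth \<mu> n) \<longlonglongrightarrow> c \<bullet> v + T \<omega>"
      using lim AE_space
    proof eventually_elim
      case (elim \<omega>)
      then show ?case
        unfolding eq[OF elim(2)] by (intro tendsto_intros)
    qed
    show "tendsto_L2 M (\<lambda>n \<omega>. C n \<omega> \<bullet> v / growth \<mu> n) (\<lambda>\<omega>. c \<bullet> v + T \<omega>)"
      by (rule tendsto_L2_cong[OF tendsto_L2_add_const[OF L2]]) (simp_all only: eq)
  qed
qed

lemma tendsto_L2_renormalize:
  assumes L2: "tendsto_L2 M (\<lambda>n \<omega>. C n \<omega> \<bullet> v / growth \<mu> n) T" and \<mu>: "\<mu> > -1"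
    and N: "(\<lambda>n. growth \<mu> n / N n) \<longlonglongrightarrow> l"
  shows "tendsto_L2 M (\<lambda>n \<omega>. C n \<omega> \<bullet> v / N n) (\<lambda>\<omega>. l * T \<omega>)"
  by (rule tendsto_L2_cong[OF tendsto_L2_mult[OF L2 N]])
    (use growth_pos[OF \<mu>] in \<open>auto simp: less_imp_neq[symmetric]\<close>)

text \<open>Normalized by \<open>growth s\<close> instead of \<open>growth \<mu>\<close>, the functional is contracted at each step by a factor
  \<open>1 - \<theta> n\<close>, where \<open>\<theta> n\<close> is of order \<open>1 / n\<close>, up to a martingale increment of summable variance. The paths
  and the second moments then satisfy the recursion of \<open>contraction_tendsto_zero\<close>.\<close>

lemma subordinate_eigenvector:
  assumes v: "R *v v = \<mu> *\<^sub>R v" and u: "R *v u = s *\<^sub>R u"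
    and K: "\<And>i. (v $ i)\<^sup>2 \<le> K * u $ i"
    and \<mu>: "\<mu> > -1" and s: "s > 0" "\<mu> < s"
  shows "AE \<omega> in M. (\<lambda>n. C n \<omega> \<bullet> v / growth s n) \<longlonglongrightarrow> 0"
    and "(\<lambda>n. \<integral>\<omega>. (C n \<omega> \<bullet> v / growth s n)\<^sup>2 \<partial>M) \<longlonglongrightarrow> 0"
proof -
  define \<theta> where "\<theta> n = (s - \<mu>) / (real n + (1 + s))" for n
  define \<eta> where "\<eta> n \<omega> = 1 / growth s (Suc n) * noise v n \<omega>" for n \<omega>
  define y where "y n \<omega> = C n \<omega> \<bullet> v / growth s n" for n \<omega>
  have \<theta>: "0 \<le> \<theta> n" "\<theta> n \<le> 1" for n
    using s \<mu> by (simp_all add: \<theta>_def field_simps)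
  have \<theta>_sum: "\<not> summable \<theta>"
    unfolding \<theta>_def using s by (intro not_summable_shifted_harmonic) simp
  have pos: "growth s n > 0" for n using s by (intro growth_pos) simp
  have "((R *v v) $ i)\<^sup>2 \<le> (\<mu>\<^sup>2 * K) * u $ i" for i
    using mult_left_mono[OF K[of i], of "\<mu>\<^sup>2"] by (simp add: v power_mult_distrib)
  then have \<eta>_sum: "summable (\<lambda>n. \<integral>\<omega>. (\<eta> n \<omega>)\<^sup>2 \<partial>M)"
    unfolding \<eta>_def using s by (intro summable_noise[OF u]) auto
  have \<eta>: "martingale_difference \<eta>"
    using martingale_difference_noise[of "\<lambda>n. 1 / growth s (Suc n)" v] unfolding \<eta>_def .
  have step: "y (Suc n) \<omega> = (1 - \<theta> n) * y n \<omega> + \<eta> n \<omega>" if "\<omega> \<in> space M" for n \<omega>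
  proof -
    have "1 - \<theta> n = (1 + \<mu> / (real n + 1)) / (1 + s / (real n + 1))"
      using s by (simp add: \<theta>_def divide_simps) (simp add: algebra_simps)
    then have "(1 - \<theta> n) * y n \<omega> = C n \<omega> \<bullet> v * (1 + \<mu> / (real n + 1)) / growth s (Suc n)"
      by (simp add: y_def growth_Suc mult.commute)
    then show ?thesis
      by (simp add: y_def \<eta>_def C_step[OF that] v add_divide_distrib algebra_simps)
  qed
  from \<eta> \<eta>_sum obtain T where "AE \<omega> in M. (\<lambda>n. \<Sum>m<n. \<eta> m \<omega>) \<longlonglongrightarrow> T \<omega>"
    by (rule martingale_convergence)
  then show "AE \<omega> in M. (\<lambda>n. C n \<omega> \<bullet> v / growth s n) \<longlonglongrightarrow> 0"
    using AE_space
  proof eventually_elim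
    case (elim \<omega>)
    then have "summable (\<lambda>n. \<eta> n \<omega>)" by (auto simp: summable_def sums_def)
    then have "(\<lambda>n. y n \<omega>) \<longlonglongrightarrow> 0"
      using step[OF elim(2)] \<theta> \<theta>_sum by (intro contraction_tendsto_zero)
    then show ?case unfolding y_def .
  qed
  have ad_y: "adapted n (y n)" for n
    unfolding y_def using adapted_comp[OF adapted_inner, where g="\<lambda>x. x / growth s n"] .
  have ad_\<eta>: "adapted (Suc n) (\<eta> n)" for n using \<eta> by (simp add: martingale_difference_def)
  have "(\<lambda>n. \<integral>\<omega>. (y n \<omega>)\<^sup>2 \<partial>M) \<longlonglongrightarrow> 0"
  proof (rule contraction_tendsto_zero[OF _ _ _ _ \<eta>_sum])
    fix n
    note ad_y' = adapted_mono[OF ad_y[of n], of "Suc n"]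
    have "(\<integral>\<omega>. (y (Suc n) \<omega>)\<^sup>2 \<partial>M) =
        (\<integral>\<omega>. (1 - \<theta> n)\<^sup>2 * (y n \<omega>)\<^sup>2 + 2 * (1 - \<theta> n) * (y n \<omega> * \<eta> n \<omega>) + (\<eta> n \<omega>)\<^sup>2 \<partial>M)"
      by (intro Bochner_Integration.integral_cong refl)
        (simp add: step power2_eq_square algebra_simps)
    also have "\<dots> = (1 - \<theta> n)\<^sup>2 * (\<integral>\<omega>. (y n \<omega>)\<^sup>2 \<partial>M)
        + 2 * (1 - \<theta> n) * (\<integral>\<omega>. y n \<omega> * \<eta> n \<omega> \<partial>M) + (\<integral>\<omega>. (\<eta> n \<omega>)\<^sup>2 \<partial>M)"
      using adapted_integrable[OF adapted_comp[OF ad_y', where g="\<lambda>x. x\<^sup>2"]]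
        adapted_integrable[OF adapted_comp2[OF ad_y' ad_\<eta>, where h="(*)"]]
        adapted_integrable[OF adapted_comp[OF ad_\<eta>, where g="\<lambda>x. x\<^sup>2"]] by simp
    also have "(\<integral>\<omega>. y n \<omega> * \<eta> n \<omega> \<partial>M) = 0"
      using \<eta> ad_y[of n] by (simp add: martingale_difference_def)
    also have "(1 - \<theta> n)\<^sup>2 = 1 - (1 - (1 - \<theta> n)\<^sup>2)" by simp
    finally show "(\<integral>\<omega>. (y (Suc n) \<omega>)\<^sup>2 \<partial>M) =
        (1 - (1 - (1 - \<theta> n)\<^sup>2)) * (\<integral>\<omega>. (y n \<omega>)\<^sup>2 \<partial>M) + (\<integral>\<omega>. (\<eta> n \<omega>)\<^sup>2 \<partial>M)" by simp
    have "(1 - \<theta> n)\<^sup>2 \<le> 1 - \<theta> n"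
      using \<theta>[of n] mult_left_mono[of "1 - \<theta> n" 1 "1 - \<theta> n"] by (simp add: power2_eq_square)
    then show "0 \<le> 1 - (1 - \<theta> n)\<^sup>2" using \<theta>(1)[of n] by linarith
    show "1 - (1 - \<theta> n)\<^sup>2 \<le> 1" by simp
  next
    show "\<not> summable (\<lambda>n. 1 - (1 - \<theta> n)\<^sup>2)"
    proof
      assume "summable (\<lambda>n. 1 - (1 - \<theta> n)\<^sup>2)"
      moreover have "norm (\<theta> n) \<le> 1 - (1 - \<theta> n)\<^sup>2" for n
        using \<theta>[of n] mult_left_mono[of "1 - \<theta> n" 1 "1 - \<theta> n"] by (simp add: power2_eq_square)
      ultimately show False using \<theta>_sum summable_comparison_test' by blast
    qed
  qed
  then show "(\<lambda>n. \<integral>\<omega>. (C n \<omega> \<bullet> v / growth s n)\<^sup>2 \<partial>M) \<longlonglongrightarrow> 0"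
    unfolding y_def .
qed

text \<open>Divided by the total \<open>n + 1\<close>, the functional is contracted by \<open>1 - (1 - \<beta>) / (n + 2)\<close>, while the draws
  have bounded effect and hence contribute a convergent series with variances of order \<open>1 / n\<^sup>2\<close>.\<close>

lemma perturbed_eigenvector:
  assumes v: "R *v v = \<beta> *\<^sub>R v + g" and \<beta>: "-1 \<le> \<beta>" "\<beta> < 1"
    and g: "AE \<omega> in M. summable (\<lambda>n. C n \<omega> \<bullet> g / ((real n + 1) * (real n + 2)))"
  shows "AE \<omega> in M. (\<lambda>n. C n \<omega> \<bullet> v / (real n + 1)) \<longlonglongrightarrow> 0"
proof -
  define K where "K = (\<Sum>i\<in>UNIV. \<bar>(R *v v) $ i\<bar>)"
  have K: "\<bar>(R *v v) $ i\<bar> \<le> K" for i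
    unfolding K_def by (rule member_le_sum) auto
  let ?\<eta> = "\<lambda>n \<omega>. 1 / (real n + 2) * noise v n \<omega>"
  have "summable (\<lambda>n. \<integral>\<omega>. (?\<eta> n \<omega>)\<^sup>2 \<partial>M)"
  proof (rule summable_comparison_test')
    show "summable (\<lambda>n. (2 * K)\<^sup>2 * (1 / (real n + 2)\<^sup>2))"
    proof (rule summable_mult)
      have "summable (\<lambda>n. inverse ((real (n + 2))\<^sup>2))"
        using summable_ignore_initial_segment[OF inverse_power_summable[of 2, where 'a=real], of 2] by simp
      then show "summable (\<lambda>n. 1 / (real n + 2)\<^sup>2)" by (simp add: inverse_eq_divide add.commute)
    qed
    show "norm (\<integral>\<omega>. (?\<eta> n \<omega>)\<^sup>2 \<partial>M) \<le> (2 * K)\<^sup>2 * (1 / (real n + 2)\<^sup>2)" if "n \<ge> 0" for n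
    proof -
      have "(\<integral>\<omega>. (?\<eta> n \<omega>)\<^sup>2 \<partial>M) \<le> (\<integral>\<omega>. (2 * K)\<^sup>2 * (1 / (real n + 2)\<^sup>2) \<partial>M)"
      proof (rule integral_mono)
        show "integrable M (\<lambda>\<omega>. (?\<eta> n \<omega>)\<^sup>2)"
          using adapted_integrable[OF adapted_comp[OF adapted_noise, where g="\<lambda>x. (1 / (real n + 2) * x)\<^sup>2"]] .
        fix \<omega> assume "\<omega> \<in> space M"
        then have "\<bar>noise v n \<omega>\<bar>\<^sup>2 \<le> (2 * K)\<^sup>2"
          by (intro power_mono noise_bound[OF K]) auto
        then show "(?\<eta> n \<omega>)\<^sup>2 \<le> (2 * K)\<^sup>2 * (1 / (real n + 2)\<^sup>2)"
          by (simp add: power_divide divide_right_mono)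
      qed simp
      then show ?thesis by (simp add: prob_space)
    qed
  qed
  from martingale_difference_noise this obtain T where "AE \<omega> in M. (\<lambda>n. \<Sum>m<n. ?\<eta> m \<omega>) \<longlonglongrightarrow> T \<omega>"
    by (rule martingale_convergence)
  then show ?thesis
    using g AE_space
  proof eventually_elim
    case (elim \<omega>)
    then have "summable (\<lambda>n. ?\<eta> n \<omega>)" by (auto simp: summable_def sums_def)
    from summable_add[OF this elim(2)] show ?case
    proof (rule contraction_tendsto_zero[rotated -1])
      let ?\<theta> = "\<lambda>n. (1 - \<beta>) / (real n + 2)"
      show "C (Suc n) \<omega> \<bullet> v / (real (Suc n) + 1) = (1 - ?\<theta> n) * (C n \<omega> \<bullet> v / (real n + 1)) +
          (?\<eta> n \<omega> + C n \<omega> \<bullet> g / ((real n + 1) * (real n + 2)))" for n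
      proof -
        have 1: "(1 - ?\<theta> n) * (C n \<omega> \<bullet> v / (real n + 1)) =
            (C n \<omega> \<bullet> v + \<beta> * (C n \<omega> \<bullet> v) / (real n + 1)) / (real n + 2)"
          by (simp add: divide_simps) (simp add: algebra_simps)
        have "C (Suc n) \<omega> \<bullet> v = C n \<omega> \<bullet> v + \<beta> * (C n \<omega> \<bullet> v) / (real n + 1)
            + C n \<omega> \<bullet> g / (real n + 1) + noise v n \<omega>"
          by (simp add: C_step[OF elim(3)] v inner_add_right add_divide_distrib)
        then show ?thesis
          unfolding 1 by (simp add: add_divide_distrib algebra_simps)
      qed
      show "0 \<le> ?\<theta> n" "?\<theta> n \<le> 1" for n using \<beta> by (simp_all add: field_simps)
      show "\<not> summable ?\<theta>" using \<beta> by (intro not_summable_shifted_harmonic) simp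
    qed
  qed
qed

end

section \<open>Positivity of the leading limit\<close>

lemma Gamma_plus1_real:
  assumes "0 < (x::real)"
  shows "Gamma (x + 1) = x * Gamma x"
  using assms nonpos_Ints_nonpos[of x] by (intro Gamma_plus1) auto

text \<open>Log-convexity of the Gamma function between \<open>x - \<theta>\<close> and \<open>x - \<theta> + 1\<close>.\<close>

lemma Gamma_ratio_lower_bound:
  fixes x \<theta> :: real
  assumes "0 < \<theta>" "\<theta> < 1" "\<theta> < x"
  shows "x powr (- \<theta>) \<le> Gamma (x - \<theta>) / Gamma x"
proof -
  let ?y = "x - \<theta>"
  have y: "?y > 0" using assms by simp
  have "(ln \<circ> Gamma) ((1 - \<theta>) *\<^sub>R ?y + \<theta> *\<^sub>R (?y + 1)) \<le>
      (1 - \<theta>) * (ln \<circ> Gamma) ?y + \<theta> * (ln \<circ> Gamma) (?y + 1)"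
    using assms by (intro convex_onD[OF log_convex_Gamma_real]) auto
  moreover have "(1 - \<theta>) *\<^sub>R ?y + \<theta> *\<^sub>R (?y + 1) = x" by (simp add: algebra_simps)
  moreover have "Gamma (?y + 1) = ?y * Gamma ?y"
    using y by (rule Gamma_plus1_real)
  ultimately have "ln (Gamma x) \<le> (1 - \<theta>) * ln (Gamma ?y) + \<theta> * ln (?y * Gamma ?y)"
    by (simp only: o_def)
  also have "ln (?y * Gamma ?y) = ln ?y + ln (Gamma ?y)"
    using y by (intro ln_mult_pos) auto
  also have "(1 - \<theta>) * ln (Gamma ?y) + \<theta> * (ln ?y + ln (Gamma ?y)) = ln (Gamma ?y) + \<theta> * ln ?y"
    by (simp add: algebra_simps)
  also have "\<dots> \<le> ln (Gamma ?y) + \<theta> * ln x"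
    using assms y by (intro add_left_mono mult_left_mono) auto
  finally have "exp (ln (Gamma x)) \<le> exp (ln (Gamma ?y) + \<theta> * ln x)" by simp
  then have "Gamma x \<le> Gamma ?y * x powr \<theta>"
    using assms y by (simp add: exp_add powr_def)
  then show ?thesis
    using assms by (simp add: powr_minus field_simps)
qed

context urn_model
begin

lemma nonneg_eigenvector_mono:
  assumes u: "R *v u = s *\<^sub>R u" and s: "0 \<le> s" and nonneg: "\<And>i. 0 \<le> u $ i" and \<omega>: "\<omega> \<in> space M"
  shows "c \<bullet> u \<le> C n \<omega> \<bullet> u"
proof (induction n)
  case 0
  then show ?case using \<omega> by (simp add: initial)
next
  case (Suc n)
  have "row i R \<bullet> u = s * u $ i" for i
    using arg_cong[OF u, of "\<lambda>v. v $ i"] by (simp add: row_def inner_vec_def matrix_vector_mult_def)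
  then have "0 \<le> row i R \<bullet> u" for i using s nonneg[of i] by simp
  then show ?case using Suc \<omega> by (simp add: replacement inner_add_left add_increasing2)
qed

text \<open>The function \<open>f x = Gamma (x / s - \<theta>) / Gamma (x / s)\<close> solves \<open>f (x + s) = f x * (1 - \<theta> * s / x)\<close>.
  A draw from the colors marked by \<open>u\<close> moves \<open>x = C n \<bullet> u\<close> to \<open>x + s\<close> with probability \<open>x / (n + 1)\<close>, so
  the factor \<open>x\<close> cancels and the mean of \<open>f\<close> changes by the deterministic factor \<open>1 - \<theta> * s / (n + 1)\<close>. The
  condition on \<open>\<theta>\<close> keeps the arguments of the Gamma function positive.\<close>

lemma Gamma_ratio_expectation:
  assumes u: "R *v u = s *\<^sub>R u" and s: "0 < s"
    and u01: "\<And>i. u $ i = 0 \<or> u $ i = 1" and \<theta>: "0 < \<theta>" "\<theta> < c \<bullet> u / s"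
  shows "(\<integral>\<omega>. Gamma (C n \<omega> \<bullet> u / s - \<theta>) / Gamma (C n \<omega> \<bullet> u / s) \<partial>M) =
    Gamma (c \<bullet> u / s - \<theta>) / Gamma (c \<bullet> u / s) * growth (- (\<theta> * s)) n"
proof -
  define f where "f x = Gamma (x / s - \<theta>) / Gamma (x / s)" for x
  have f_step: "f (x + s) = f x * (1 - \<theta> * s / x)" if "\<theta> < x / s" for x
  proof -
    have x: "0 < x / s" "0 < x / s - \<theta>" using that \<theta> by auto
    then have x': "0 < x" using s by (simp add: zero_less_divide_iff)
    have "Gamma (x / s + 1) = (x / s) * Gamma (x / s)"
      "Gamma (x / s - \<theta> + 1) = (x / s - \<theta>) * Gamma (x / s - \<theta>)"
      using x by (simp_all only: Gamma_plus1_real)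
    moreover have "(x + s) / s = x / s + 1" "(x + s) / s - \<theta> = x / s - \<theta> + 1"
      using s by (simp_all add: add_divide_distrib)
    ultimately have "f (x + s) = ((x / s - \<theta>) * Gamma (x / s - \<theta>)) / ((x / s) * Gamma (x / s))"
      unfolding f_def by (simp only:)
    also have "\<dots> = f x * ((x / s - \<theta>) / (x / s))" by (simp add: f_def mult_ac)
    also have "(x / s - \<theta>) / (x / s) = 1 - \<theta> * s / x" using s x' by (simp add: field_simps)
    finally show ?thesis .
  qed
  have nonneg: "0 \<le> u $ i" for i using u01[of i] by auto
  have mono: "c \<bullet> u \<le> C n \<omega> \<bullet> u" if "\<omega> \<in> space M" for n \<omega>
    using s by (intro nonneg_eigenvector_mono[OF u _ nonneg that]) simp
  have "(\<integral>\<omega>. f (C n \<omega> \<bullet> u) \<partial>M) = f (c \<bullet> u) * growth (- (\<theta> * s)) n" for n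
  proof (induction n)
    case 0
    have "(\<integral>\<omega>. f (C 0 \<omega> \<bullet> u) \<partial>M) = (\<integral>\<omega>. f (c \<bullet> u) \<partial>M)"
      by (intro Bochner_Integration.integral_cong) (simp_all add: initial)
    then show ?case by (simp add: prob_space)
  next
    case (Suc n)
    have "row i R \<bullet> u = s * u $ i" for i
      using arg_cong[OF u, of "\<lambda>v. v $ i"] by (simp add: row_def inner_vec_def matrix_vector_mult_def)
    then have "(\<integral>\<omega>. f (C (Suc n) \<omega> \<bullet> u) \<partial>M) = (\<integral>\<omega>. f (C n \<omega> \<bullet> u + s * u $ X (Suc n) \<omega>) \<partial>M)"
      by (intro Bochner_Integration.integral_cong refl) (simp add: replacement inner_add_left)
    also have "\<dots> = (\<integral>\<omega>. (\<Sum>i\<in>UNIV. (C n \<omega> $ i / (real n + 1)) *\<^sub>R f (C n \<omega> \<bullet> u + s * u $ i)) \<partial>M)"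
      by (rule draw_expectation[where G="\<lambda>\<omega> i. f (C n \<omega> \<bullet> u + s * u $ i)"])
        (rule adapted_comp[OF adapted_C])
    also have "\<dots> = (\<integral>\<omega>. f (C n \<omega> \<bullet> u) * (1 + - (\<theta> * s) / (real n + 1)) \<partial>M)"
    proof (intro Bochner_Integration.integral_cong refl)
      fix \<omega> assume \<omega>: "\<omega> \<in> space M"
      let ?S = "C n \<omega> \<bullet> u"
      have S: "\<theta> < ?S / s" "?S > 0"
      proof -
        have "c \<bullet> u / s \<le> ?S / s" using mono[OF \<omega>] s by (simp add: divide_right_mono)
        then show "\<theta> < ?S / s" using \<theta> by simp
        with \<theta>(1) have "0 < ?S / s" by (rule less_trans)
        then show "?S > 0" using s by (simp add: zero_less_divide_iff)
      qed
      have f_eq: "f (?S + s * u $ i) = f ?S - u $ i * (f ?S * (\<theta> * s / ?S))" for i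
      proof (cases "u $ i = 0")
        case False
        then have "u $ i = 1" using u01[of i] by simp
        then show ?thesis using f_step[OF S(1)] by (simp only: mult_1_right mult_1_left right_diff_distrib)
      qed simp
      have "(\<Sum>i\<in>UNIV. (C n \<omega> $ i / (real n + 1)) *\<^sub>R f (?S + s * u $ i)) =
          (\<Sum>i\<in>UNIV. C n \<omega> $ i / (real n + 1) * f ?S - C n \<omega> $ i / (real n + 1) * u $ i * (f ?S * (\<theta> * s / ?S)))"
        unfolding f_eq real_scaleR_def by (simp only: right_diff_distrib mult.assoc)
      also have "\<dots> = (\<Sum>i\<in>UNIV. C n \<omega> $ i / (real n + 1)) * f ?S - ?S / (real n + 1) * (f ?S * (\<theta> * s / ?S))"
        unfolding sum_subtractf sum_distrib_right[symmetric] draw_mean ..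
      also have "(\<Sum>i\<in>UNIV. C n \<omega> $ i / (real n + 1)) = 1"
        using \<omega> by (simp add: sum_divide_distrib[symmetric] C_total)
      also have "1 * f ?S - ?S / (real n + 1) * (f ?S * (\<theta> * s / ?S)) = f ?S * (1 + - (\<theta> * s) / (real n + 1))"
      proof -
        have "?S / (real n + 1) * (f ?S * (\<theta> * s / ?S)) = f ?S * (\<theta> * s / (real n + 1))"
          using S(2) by simp
        then show ?thesis by (simp add: right_diff_distrib)
      qed
      finally show "(\<Sum>i\<in>UNIV. (C n \<omega> $ i / (real n + 1)) *\<^sub>R f (?S + s * u $ i)) =
          f ?S * (1 + - (\<theta> * s) / (real n + 1))" .
    qed
    also have "\<dots> = f (c \<bullet> u) * growth (- (\<theta> * s)) (Suc n)"
      using Suc by (simp add: growth_Suc)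
    finally show ?case .
  qed
  then show ?thesis unfolding f_def .
qed

text \<open>The Gamma ratio dominates \<open>(C n \<bullet> u / s) powr - \<theta>\<close> and its mean decays like \<open>n powr - (\<theta> * s)\<close>, so
  the moments of order \<open>- \<theta>\<close> of the normalized sequence are bounded. By Markov's inequality the limit is at most
  \<open>0\<close> with probability \<open>O(\<epsilon> powr \<theta>)\<close> for every \<open>\<epsilon>\<close>; a continuous cutoff carries this bound to the limit.\<close>

theorem eigenvector_limit_positive:
  assumes u: "R *v u = s *\<^sub>R u" and s: "0 < s" "s \<le> 1"
    and u01: "\<And>i. u $ i = 0 \<or> u $ i = 1" and pos: "c \<bullet> u > 0"
    and U: "U \<in> borel_measurable M" and lim: "AE \<omega> in M. (\<lambda>n. C n \<omega> \<bullet> u / real n powr s) \<longlonglongrightarrow> U \<omega>"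
  shows "AE \<omega> in M. 0 < U \<omega>"
proof -
  note U [measurable]
  \<comment> \<open>the first bound keeps \<open>\<theta>\<close> in the range of the convexity estimate, the second keeps the Gamma ratio defined at time \<open>0\<close>\<close>
  define \<theta> where "\<theta> = min (1 / 2) (c \<bullet> u / (2 * s))"
  have \<theta>: "0 < \<theta>" "\<theta> < 1" "\<theta> < c \<bullet> u / s"
    using pos s by (auto simp: \<theta>_def min_def field_simps)
  have \<theta>s: "- (\<theta> * s) > -1"
    using \<theta> s mult_less_le_imp_less[of \<theta> 1 s 1] by simp
  have nonneg: "0 \<le> u $ i" for i using u01[of i] by auto
  have mono: "c \<bullet> u \<le> C n \<omega> \<bullet> u" if "\<omega> \<in> space M" for n \<omega>
    using s by (intro nonneg_eigenvector_mono[OF u _ nonneg that]) simp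
  define Y where "Y n \<omega> = C n \<omega> \<bullet> u / real n powr s" for n \<omega>
  have ad_Y: "adapted n (Y n)" for n
    unfolding Y_def using adapted_comp[OF adapted_inner, where g="\<lambda>x. x / real n powr s"] .
  have [measurable]: "Y n \<in> borel_measurable M" for n
    using adapted_measurable[OF ad_Y] .
  define B where "B = Gamma (c \<bullet> u / s - \<theta>) / Gamma (c \<bullet> u / s)"
  have Y_moment: "(\<integral>\<omega>. Y n \<omega> powr (- \<theta>) \<partial>M) \<le>
      s powr (- \<theta>) * B * (growth (- (\<theta> * s)) n / real n powr (- (\<theta> * s)))" if "n > 0" for n
  proof -
    have "(\<integral>\<omega>. Y n \<omega> powr (- \<theta>) \<partial>M) \<le>
        (\<integral>\<omega>. s powr (- \<theta>) / real n powr (- (\<theta> * s)) *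
           (Gamma (C n \<omega> \<bullet> u / s - \<theta>) / Gamma (C n \<omega> \<bullet> u / s)) \<partial>M)"
    proof (rule integral_mono)
      show "integrable M (\<lambda>\<omega>. Y n \<omega> powr (- \<theta>))"
        using adapted_integrable[OF adapted_comp[OF ad_Y, where g="\<lambda>x. x powr (- \<theta>)"]] .
      show "integrable M (\<lambda>\<omega>. s powr (- \<theta>) / real n powr (- (\<theta> * s)) *
           (Gamma (C n \<omega> \<bullet> u / s - \<theta>) / Gamma (C n \<omega> \<bullet> u / s)))"
        using adapted_integrable[OF adapted_comp[OF adapted_C,
          where g="\<lambda>x. s powr (- \<theta>) / real n powr (- (\<theta> * s)) * (Gamma (x \<bullet> u / s - \<theta>) / Gamma (x \<bullet> u / s))"]] .
      fix \<omega> assume \<omega>: "\<omega> \<in> space M"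
      have S: "C n \<omega> \<bullet> u > 0" using mono[OF \<omega>, of n] pos by linarith
      have "c \<bullet> u / s \<le> C n \<omega> \<bullet> u / s" using mono[OF \<omega>] s by (simp add: divide_right_mono)
      then have "\<theta> < C n \<omega> \<bullet> u / s" using \<theta> by simp
      note Gamma_ratio_lower_bound[OF \<theta>(1,2) this]
      moreover have "Y n \<omega> powr (- \<theta>) =
          s powr (- \<theta>) / real n powr (- (\<theta> * s)) * (C n \<omega> \<bullet> u / s) powr (- \<theta>)"
        using S s that by (simp add: Y_def powr_divide powr_powr mult.commute)
      ultimately show "Y n \<omega> powr (- \<theta>) \<le> s powr (- \<theta>) / real n powr (- (\<theta> * s)) *
           (Gamma (C n \<omega> \<bullet> u / s - \<theta>) / Gamma (C n \<omega> \<bullet> u / s))"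
        by (simp only:) (intro mult_left_mono, auto)
    qed
    also have "\<dots> = s powr (- \<theta>) / real n powr (- (\<theta> * s)) * (B * growth (- (\<theta> * s)) n)"
      unfolding B_def Gamma_ratio_expectation[OF u s(1) u01 \<theta>(1,3), symmetric]
      by (rule integral_mult_right_zero)
    finally show ?thesis by (simp add: mult_ac)
  qed
  define L where "L = s powr (- \<theta>) * B * inverse (Gamma (1 - \<theta> * s))"
  have L: "(\<lambda>n. s powr (- \<theta>) * B * (growth (- (\<theta> * s)) n / real n powr (- (\<theta> * s)))) \<longlonglongrightarrow> L"
    unfolding L_def using growth_asymptotics[OF \<theta>s] by (intro tendsto_intros) simp
  have tail: "measure M {\<omega> \<in> space M. U \<omega> \<le> 0} \<le> \<epsilon> powr \<theta> * L" if \<epsilon>: "0 < \<epsilon>" for \<epsilon>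
  proof -
    \<comment> \<open>a continuous function with value \<open>1\<close> at \<open>0\<close>, at most \<open>1\<close>, and vanishing beyond \<open>\<epsilon>\<close>\<close>
    define h where "h x = max 0 (1 - \<bar>x\<bar> / \<epsilon>)" for x :: real
    have h: "0 \<le> h x" "h x \<le> 1" for x using \<epsilon> by (auto simp: h_def)
    have [measurable]: "h \<in> borel_measurable borel" unfolding h_def by measurable
    have h_cont: "isCont h x" for x unfolding h_def using \<epsilon> by (intro continuous_intros) auto
    have conv: "(\<lambda>n. \<integral>\<omega>. h (Y n \<omega>) \<partial>M) \<longlonglongrightarrow> (\<integral>\<omega>. h (U \<omega>) \<partial>M)"
    proof (rule integral_dominated_convergence[where w="\<lambda>_. 1"])
      show "AE \<omega> in M. (\<lambda>n. h (Y n \<omega>)) \<longlonglongrightarrow> h (U \<omega>)"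
        using lim by eventually_elim (auto simp: Y_def intro: isCont_tendsto_compose[OF h_cont])
    qed (use h in auto)
    have "(\<integral>\<omega>. h (Y n \<omega>) \<partial>M) \<le> \<epsilon> powr \<theta> *
        (s powr (- \<theta>) * B * (growth (- (\<theta> * s)) n / real n powr (- (\<theta> * s))))" if "n > 0" for n
    proof -
      have "(\<integral>\<omega>. h (Y n \<omega>) \<partial>M) \<le> (\<integral>\<omega>. \<epsilon> powr \<theta> * Y n \<omega> powr (- \<theta>) \<partial>M)"
      proof (rule integral_mono)
        show "integrable M (\<lambda>\<omega>. h (Y n \<omega>))"
          using adapted_integrable[OF adapted_comp[OF ad_Y, where g=h]] .
        show "integrable M (\<lambda>\<omega>. \<epsilon> powr \<theta> * Y n \<omega> powr (- \<theta>))"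
          using adapted_integrable[OF adapted_comp[OF ad_Y, where g="\<lambda>x. \<epsilon> powr \<theta> * x powr (- \<theta>)"]] .
        fix \<omega> assume \<omega>: "\<omega> \<in> space M"
        have Y: "Y n \<omega> > 0" using mono[OF \<omega>, of n] pos that by (simp add: Y_def)
        have eq: "\<epsilon> powr \<theta> * Y n \<omega> powr (- \<theta>) = (\<epsilon> / Y n \<omega>) powr \<theta>"
          using Y \<epsilon> by (simp add: powr_divide powr_minus_divide)
        show "h (Y n \<omega>) \<le> \<epsilon> powr \<theta> * Y n \<omega> powr (- \<theta>)"
        proof (cases "Y n \<omega> \<ge> \<epsilon>")
          case True
          then have "h (Y n \<omega>) = 0" using \<epsilon> Y by (simp add: h_def)
          then show ?thesis unfolding eq by simp
        next
          case False
          then have "1 \<le> (\<epsilon> / Y n \<omega>) powr \<theta>"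
            using Y \<theta> by (intro ge_one_powr_ge_zero) auto
          then show ?thesis unfolding eq using h(2)[of "Y n \<omega>"] by linarith
        qed
      qed
      also have "\<dots> = \<epsilon> powr \<theta> * (\<integral>\<omega>. Y n \<omega> powr (- \<theta>) \<partial>M)" by simp
      also have "\<dots> \<le> \<epsilon> powr \<theta> * (s powr (- \<theta>) * B * (growth (- (\<theta> * s)) n / real n powr (- (\<theta> * s))))"
        by (intro mult_left_mono Y_moment that) simp
      finally show ?thesis .
    qed
    then have "(\<integral>\<omega>. h (U \<omega>) \<partial>M) \<le> \<epsilon> powr \<theta> * L"
      by (intro tendsto_le[OF _ tendsto_mult[OF tendsto_const L] conv])
        (auto simp: eventually_sequentially intro!: exI[of _ 1])
    moreover have "measure M {\<omega> \<in> space M. U \<omega> \<le> 0} \<le> (\<integral>\<omega>. h (U \<omega>) \<partial>M)"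
    proof -
      have nonneg: "AE \<omega> in M. 0 \<le> U \<omega>"
        using lim AE_space
      proof eventually_elim
        case (elim \<omega>)
        have "0 \<le> C n \<omega> \<bullet> u / real n powr s" for n
          using mono[OF elim(2), of n] pos by simp
        with elim(1) show ?case by (intro LIMSEQ_le_const[OF elim(1)]) auto
      qed
      have "measure M {\<omega> \<in> space M. U \<omega> \<le> 0} = (\<integral>\<omega>. indicator {\<omega> \<in> space M. U \<omega> \<le> 0} \<omega> \<partial>M)"
        by simp
      also have "\<dots> \<le> (\<integral>\<omega>. h (U \<omega>) \<partial>M)"
      proof (rule integral_mono_AE)
        show "integrable M (\<lambda>\<omega>. h (U \<omega>))"
          by (rule integrable_const_bound[where B=1]) (use h in auto)
        show "AE \<omega> in M. indicator {\<omega> \<in> space M. U \<omega> \<le> 0} \<omega> \<le> h (U \<omega>)"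
          using nonneg by eventually_elim (use h in \<open>auto simp: indicator_def h_def\<close>)
      qed (simp add: emeasure_eq_measure)
      finally show ?thesis .
    qed
    ultimately show ?thesis by linarith
  qed
  have "((\<lambda>\<epsilon>. \<epsilon> powr \<theta> * L) \<longlongrightarrow> 0 * L) (at_right 0)"
    using \<theta> by (intro tendsto_mult tendsto_const) real_asymp
  then have "measure M {\<omega> \<in> space M. U \<omega> \<le> 0} \<le> 0"
    by (intro tendsto_lowerbound[where F="at_right (0::real)" and f="\<lambda>\<epsilon>. \<epsilon> powr \<theta> * L"])
      (auto simp: eventually_at_right_less intro: eventually_mono[OF eventually_at_right_less] tail)
  then have "emeasure M {\<omega> \<in> space M. U \<omega> \<le> 0} = 0"
    by (simp add: emeasure_eq_measure measure_le_0_iff)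
  then show ?thesis
    by (intro AE_I[of _ _ "{\<omega> \<in> space M. U \<omega> \<le> 0}"]) auto
qed

end

section \<open>Martingales with a random limiting variance\<close>

lemma iexp_diff_le: "cmod (iexp x - iexp y) \<le> \<bar>x - y\<bar>"
proof -
  have "iexp x - iexp y = iexp y * (iexp (x - y) - 1)"
    by (simp add: right_diff_distrib exp_add[symmetric] of_real_diff[symmetric] del: of_real_diff)
      (simp add: algebra_simps)
  then have "cmod (iexp x - iexp y) = cmod (iexp (x - y) - 1)"
    by (simp add: norm_mult)
  also have "\<dots> \<le> \<bar>x - y\<bar>"
    using iexp_approx1[of "x - y" 0] by simp
  finally show ?thesis .
qed

lemma iexp_second_order: "cmod (iexp x - (1 + \<i> * x - x\<^sup>2 / 2)) \<le> \<bar>x\<bar> ^ 3 / 6"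
proof -
  have "(\<Sum>k\<le>2. f k) = f 0 + f 1 + f 2" for f :: "nat \<Rightarrow> complex"
    by (simp add: numeral_2_eq_2)
  then have "(\<Sum>k\<le>2. (\<i> * x) ^ k / fact k) = 1 + \<i> * x - x\<^sup>2 / 2"
    by (simp add: power_mult_distrib)
  then show ?thesis
    using iexp_approx1[of x 2] by (simp add: fact_numeral numeral_3_eq_3[symmetric])
qed

lemma exp_minus_second_order:
  assumes "0 \<le> (x::real)"
  shows "\<bar>exp (- x) - (1 - x)\<bar> \<le> x\<^sup>2 / 2"
proof -
  have "exp (- x) \<le> 1 - x + x\<^sup>2 / 2"
  proof -
    define f where "f x = 1 - x + x\<^sup>2 / 2 - exp (- x)" for x :: real
    have "f 0 \<le> f x"
    proof (rule DERIV_nonneg_imp_nondecreasing[OF assms])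
      fix y :: real assume "0 \<le> y" "y \<le> x"
      have "DERIV f y :> - 1 + y + exp (- y)"
        unfolding f_def by (auto intro!: derivative_eq_intros)
      moreover have "0 \<le> - 1 + y + exp (- y)" using exp_ge_add_one_self[of "- y"] by simp
      ultimately show "\<exists>z. DERIV f y :> z \<and> 0 \<le> z" by blast
    qed
    then show ?thesis by (simp add: f_def)
  qed
  then show ?thesis using exp_ge_add_one_self[of "- x"] by (simp add: abs_if)
qed

lemma exp_minus_diff_le:
  assumes "0 \<le> (x::real)" "0 \<le> y"
  shows "\<bar>exp (- x) - exp (- y)\<bar> \<le> \<bar>x - y\<bar>"
proof -
  have *: "\<bar>exp (- a) - exp (- b)\<bar> \<le> \<bar>a - b\<bar>" if "0 \<le> a" "a \<le> b" for a b :: real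
  proof -
    have "exp (- a) - exp (- b) = exp (- a) * (1 - exp (- (b - a)))"
      by (simp add: algebra_simps exp_add[symmetric])
    also have "\<dots> \<le> 1 * (b - a)"
    proof (rule mult_mono)
      show "1 - exp (- (b - a)) \<le> b - a" using exp_ge_add_one_self[of "- (b - a)"] by linarith
    qed (use that in auto)
    finally show ?thesis using that by simp
  qed
  show ?thesis
    using *[of x y] *[of y x] assms by (cases "x \<le> y") (auto simp: abs_minus_commute)
qed

lemma tendsto_of_approximation:
  fixes A :: "nat \<Rightarrow> 'c::metric_space"
  assumes e: "\<And>k n. k \<le> n \<Longrightarrow> dist (A n) a \<le> e k n"
    and lim: "\<And>k. e k \<longlonglongrightarrow> L k" and L: "L \<longlonglongrightarrow> (0::real)"
  shows "A \<longlonglongrightarrow> a"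
proof (rule metric_LIMSEQ_I)
  fix r :: real assume r: "0 < r"
  then have "\<forall>\<^sub>F k in sequentially. L k < r"
    using order_tendstoD(2)[OF L, of r] by simp
  then obtain k where "L k < r" by (auto simp: eventually_sequentially)
  then have "\<forall>\<^sub>F n in sequentially. e k n < r"
    by (rule order_tendstoD(2)[OF lim])
  then obtain N where N: "\<And>n. n \<ge> N \<Longrightarrow> e k n < r" by (auto simp: eventually_sequentially)
  show "\<exists>no. \<forall>n\<ge>no. dist (A n) a < r"
  proof (intro exI[of _ "max k N"] allI impI)
    fix n assume "max k N \<le> n"
    then show "dist (A n) a < r" using e[of k n] N[of n] by simp
  qed
qed

context urn_model
begin

text \<open>One Lindeberg replacement: an increment \<open>d\<close> is exchanged for a centred Gaussian of variance
  \<open>w * r\<close>. Expanding both factors to second order, the first order term vanishes, the second order terms differ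
  by the error in the conditional variance, and the remainders are cubic in \<open>d\<close> and quadratic in \<open>w * r\<close>.\<close>

lemma characteristic_step:
  fixes G :: "'a \<Rightarrow> complex" and d \<rho> r :: "'a \<Rightarrow> real"
  assumes G: "adapted n G" "\<And>\<omega>. \<omega> \<in> space M \<Longrightarrow> cmod (G \<omega>) \<le> 1"
    and d: "adapted (Suc n) d" "(\<integral>\<omega>. d \<omega> *\<^sub>R G \<omega> \<partial>M) = 0"
    and d2: "\<And>H :: 'a \<Rightarrow> complex. adapted n H \<Longrightarrow>
        (\<integral>\<omega>. (d \<omega>)\<^sup>2 *\<^sub>R H \<omega> \<partial>M) = (\<integral>\<omega>. (w * \<rho> \<omega>) *\<^sub>R H \<omega> \<partial>M)"
    and \<delta>: "\<And>\<omega>. \<omega> \<in> space M \<Longrightarrow> \<bar>d \<omega>\<bar> \<le> \<delta>"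
    and \<rho>: "adapted n \<rho>" and r: "adapted n r" "\<And>\<omega>. \<omega> \<in> space M \<Longrightarrow> 0 \<le> r \<omega>"
    and w: "0 \<le> w"
  shows "cmod ((\<integral>\<omega>. G \<omega> * iexp (u * d \<omega>) \<partial>M) - (\<integral>\<omega>. G \<omega> * exp (- (u\<^sup>2 / 2 * r \<omega> * w)) \<partial>M)) \<le>
    \<bar>u\<bar> ^ 3 / 6 * (\<delta> * (w * (\<integral>\<omega>. \<rho> \<omega> \<partial>M))) + u\<^sup>2 / 2 * (w * (\<integral>\<omega>. \<bar>\<rho> \<omega> - r \<omega>\<bar> \<partial>M))
      + u ^ 4 / 8 * (w\<^sup>2 * (\<integral>\<omega>. (r \<omega>)\<^sup>2 \<partial>M))"
proof -
  note Suc = adapted_mono[OF _ le_SucI[OF order_refl]]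
  have P: "adapted (Suc n) (\<lambda>\<omega>. (d \<omega>, G \<omega>, \<rho> \<omega>, r \<omega>))"
    by (rule adapted_comp2[OF d(1) adapted_comp2[OF Suc[OF G(1)] adapted_comp2[OF Suc[OF \<rho>] Suc[OF r(1)]]]])
  have I: "integrable M (\<lambda>\<omega>. F (d \<omega>) (G \<omega>) (\<rho> \<omega>) (r \<omega>))" for F :: "real \<Rightarrow> complex \<Rightarrow> real \<Rightarrow> real \<Rightarrow> complex"
    using adapted_integrable[OF adapted_comp[OF P, where g="\<lambda>(a, b, c, d). F a b c d"]] by simp
  have IR: "integrable M (\<lambda>\<omega>. F (d \<omega>) (G \<omega>) (\<rho> \<omega>) (r \<omega>))" for F :: "real \<Rightarrow> complex \<Rightarrow> real \<Rightarrow> real \<Rightarrow> real"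
    using adapted_integrable[OF adapted_comp[OF P, where g="\<lambda>(a, b, c, d). F a b c d"]] by simp
  define e1 where "e1 \<omega> = G \<omega> * (iexp (u * d \<omega>) - (1 + \<i> * (u * d \<omega>) - (u * d \<omega>)\<^sup>2 / 2))" for \<omega>
  define x where "x \<omega> = u\<^sup>2 / 2 * r \<omega> * w" for \<omega>
  define e2 where "e2 \<omega> = G \<omega> * of_real (exp (- x \<omega>) - (1 - x \<omega>))" for \<omega>
  define e3 where "e3 \<omega> = G \<omega> * of_real (\<rho> \<omega> - r \<omega>)" for \<omega>
  have int: "integrable M e1" "integrable M e2" "integrable M e3" "integrable M G"
      "integrable M (\<lambda>\<omega>. d \<omega> *\<^sub>R G \<omega>)" "integrable M (\<lambda>\<omega>. (d \<omega>)\<^sup>2 *\<^sub>R G \<omega>)"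
      "integrable M (\<lambda>\<omega>. (w * \<rho> \<omega>) *\<^sub>R G \<omega>)" "integrable M (\<lambda>\<omega>. x \<omega> *\<^sub>R G \<omega>)"
    unfolding e1_def e2_def e3_def x_def by (rule I IR)+
  have x_nonneg: "0 \<le> x \<omega>" if "\<omega> \<in> space M" for \<omega>
    unfolding x_def using r(2)[OF that] w by simp
  have "(\<integral>\<omega>. G \<omega> * iexp (u * d \<omega>) \<partial>M) =
      (\<integral>\<omega>. e1 \<omega> + (G \<omega> + (\<i> * u) * (d \<omega> *\<^sub>R G \<omega>)) - (u\<^sup>2 / 2) *\<^sub>R ((d \<omega>)\<^sup>2 *\<^sub>R G \<omega>) \<partial>M)"
    by (intro Bochner_Integration.integral_cong refl)
      (simp add: e1_def scaleR_conv_of_real power_mult_distrib algebra_simps)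
  also have "\<dots> = (\<integral>\<omega>. e1 \<omega> \<partial>M) + (\<integral>\<omega>. G \<omega> \<partial>M) - (u\<^sup>2 / 2) *\<^sub>R (\<integral>\<omega>. (w * \<rho> \<omega>) *\<^sub>R G \<omega> \<partial>M)"
    by (simp only: Bochner_Integration.integral_add Bochner_Integration.integral_diff
        integral_mult_right_zero Bochner_Integration.integral_scaleR_right
        Bochner_Integration.integrable_add Bochner_Integration.integrable_diff
        integrable_mult_right Bochner_Integration.integrable_scaleR_right int d(2) d2[OF G(1)]) simp
  finally have A: "(\<integral>\<omega>. G \<omega> * iexp (u * d \<omega>) \<partial>M) =
      (\<integral>\<omega>. e1 \<omega> \<partial>M) + (\<integral>\<omega>. G \<omega> \<partial>M) - (u\<^sup>2 / 2) *\<^sub>R (\<integral>\<omega>. (w * \<rho> \<omega>) *\<^sub>R G \<omega> \<partial>M)" .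
  have "(\<integral>\<omega>. G \<omega> * exp (- (u\<^sup>2 / 2 * r \<omega> * w)) \<partial>M) = (\<integral>\<omega>. e2 \<omega> + G \<omega> - x \<omega> *\<^sub>R G \<omega> \<partial>M)"
    by (intro Bochner_Integration.integral_cong refl)
      (simp add: e2_def x_def scaleR_conv_of_real algebra_simps exp_of_real)
  also have "\<dots> = (\<integral>\<omega>. e2 \<omega> \<partial>M) + (\<integral>\<omega>. G \<omega> \<partial>M) - (\<integral>\<omega>. x \<omega> *\<^sub>R G \<omega> \<partial>M)"
    using int by simp
  finally have B: "(\<integral>\<omega>. G \<omega> * exp (- (u\<^sup>2 / 2 * r \<omega> * w)) \<partial>M) =
      (\<integral>\<omega>. e2 \<omega> \<partial>M) + (\<integral>\<omega>. G \<omega> \<partial>M) - (\<integral>\<omega>. x \<omega> *\<^sub>R G \<omega> \<partial>M)" .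
  have "(u\<^sup>2 / 2) *\<^sub>R (\<integral>\<omega>. (w * \<rho> \<omega>) *\<^sub>R G \<omega> \<partial>M) - (\<integral>\<omega>. x \<omega> *\<^sub>R G \<omega> \<partial>M) =
      (\<integral>\<omega>. (u\<^sup>2 / 2) *\<^sub>R ((w * \<rho> \<omega>) *\<^sub>R G \<omega>) - x \<omega> *\<^sub>R G \<omega> \<partial>M)"
    by (simp only: Bochner_Integration.integral_diff Bochner_Integration.integral_scaleR_right
        Bochner_Integration.integrable_scaleR_right int)
  also have "\<dots> = (\<integral>\<omega>. (u\<^sup>2 / 2 * w) *\<^sub>R e3 \<omega> \<partial>M)"
    by (intro Bochner_Integration.integral_cong refl)
      (simp add: e3_def x_def scaleR_conv_of_real algebra_simps)
  also have "\<dots> = (u\<^sup>2 / 2 * w) *\<^sub>R (\<integral>\<omega>. e3 \<omega> \<partial>M)" using int by simp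
  finally have "(\<integral>\<omega>. G \<omega> * iexp (u * d \<omega>) \<partial>M) - (\<integral>\<omega>. G \<omega> * exp (- (u\<^sup>2 / 2 * r \<omega> * w)) \<partial>M) =
      (\<integral>\<omega>. e1 \<omega> \<partial>M) - (\<integral>\<omega>. e2 \<omega> \<partial>M) - (u\<^sup>2 / 2 * w) *\<^sub>R (\<integral>\<omega>. e3 \<omega> \<partial>M)"
    unfolding A B by (simp add: algebra_simps)
  then have "cmod ((\<integral>\<omega>. G \<omega> * iexp (u * d \<omega>) \<partial>M) - (\<integral>\<omega>. G \<omega> * exp (- (u\<^sup>2 / 2 * r \<omega> * w)) \<partial>M)) \<le>
      cmod (\<integral>\<omega>. e1 \<omega> \<partial>M) + cmod (\<integral>\<omega>. e2 \<omega> \<partial>M) + cmod ((u\<^sup>2 / 2 * w) *\<^sub>R (\<integral>\<omega>. e3 \<omega> \<partial>M))"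
    by (simp only:) (intro order_trans[OF norm_triangle_ineq4] add_mono order_refl)
  also have "cmod (\<integral>\<omega>. e1 \<omega> \<partial>M) \<le> (\<integral>\<omega>. \<bar>u\<bar> ^ 3 / 6 * (\<delta> * (d \<omega>)\<^sup>2) \<partial>M)"
  proof (intro order_trans[OF integral_norm_bound] integral_mono)
    show "integrable M (\<lambda>\<omega>. \<bar>u\<bar> ^ 3 / 6 * (\<delta> * (d \<omega>)\<^sup>2))" by (rule IR)
    fix \<omega> assume \<omega>: "\<omega> \<in> space M"
    have "cmod (e1 \<omega>) \<le> 1 * (\<bar>u * d \<omega>\<bar> ^ 3 / 6)"
      unfolding e1_def norm_mult using iexp_second_order[of "u * d \<omega>"]
      by (intro mult_mono G \<omega>) auto
    also have "\<dots> = \<bar>u\<bar> ^ 3 / 6 * (\<bar>d \<omega>\<bar> * (d \<omega>)\<^sup>2)"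
    proof -
      have "\<bar>d \<omega>\<bar> ^ 3 = \<bar>d \<omega>\<bar> * (d \<omega>)\<^sup>2"
        by (simp add: power3_eq_cube power2_eq_square)
      then show ?thesis by (simp add: abs_mult power_mult_distrib)
    qed
    also have "\<dots> \<le> \<bar>u\<bar> ^ 3 / 6 * (\<delta> * (d \<omega>)\<^sup>2)"
      using \<delta>[OF \<omega>] by (intro mult_left_mono mult_right_mono) auto
    finally show "cmod (e1 \<omega>) \<le> \<bar>u\<bar> ^ 3 / 6 * (\<delta> * (d \<omega>)\<^sup>2)" .
  qed (use int in simp)
  also have "(\<integral>\<omega>. \<bar>u\<bar> ^ 3 / 6 * (\<delta> * (d \<omega>)\<^sup>2) \<partial>M) = \<bar>u\<bar> ^ 3 / 6 * (\<delta> * (w * (\<integral>\<omega>. \<rho> \<omega> \<partial>M)))"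
  proof -
    have "of_real (\<integral>\<omega>. (d \<omega>)\<^sup>2 \<partial>M) = (\<integral>\<omega>. (d \<omega>)\<^sup>2 *\<^sub>R (1::complex) \<partial>M)"
      by (simp only: scaleR_conv_of_real mult_1_right integral_complex_of_real)
    also have "\<dots> = (\<integral>\<omega>. (w * \<rho> \<omega>) *\<^sub>R (1::complex) \<partial>M)"
      by (rule d2[OF adapted_const])
    also have "\<dots> = of_real (\<integral>\<omega>. w * \<rho> \<omega> \<partial>M)"
      by (simp only: scaleR_conv_of_real mult_1_right integral_complex_of_real)
    finally have "(\<integral>\<omega>. (d \<omega>)\<^sup>2 \<partial>M) = w * (\<integral>\<omega>. \<rho> \<omega> \<partial>M)" by (simp only: of_real_eq_iff) simp
    then show ?thesis by simp
  qed
  also have "cmod (\<integral>\<omega>. e2 \<omega> \<partial>M) \<le> (\<integral>\<omega>. u ^ 4 / 8 * (w\<^sup>2 * (r \<omega>)\<^sup>2) \<partial>M)"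
  proof (intro order_trans[OF integral_norm_bound] integral_mono)
    show "integrable M (\<lambda>\<omega>. u ^ 4 / 8 * (w\<^sup>2 * (r \<omega>)\<^sup>2))" by (rule IR)
    fix \<omega> assume \<omega>: "\<omega> \<in> space M"
    have "cmod (e2 \<omega>) \<le> 1 * ((x \<omega>)\<^sup>2 / 2)"
      unfolding e2_def norm_mult norm_of_real using exp_minus_second_order[OF x_nonneg[OF \<omega>]]
      by (intro mult_mono G \<omega>) auto
    also have "\<dots> = u ^ 4 / 8 * (w\<^sup>2 * (r \<omega>)\<^sup>2)"
      by (simp add: x_def power_mult_distrib power_divide power2_eq_square power4_eq_xxxx)
    finally show "cmod (e2 \<omega>) \<le> u ^ 4 / 8 * (w\<^sup>2 * (r \<omega>)\<^sup>2)" .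
  qed (use int in simp)
  also have "(\<integral>\<omega>. u ^ 4 / 8 * (w\<^sup>2 * (r \<omega>)\<^sup>2) \<partial>M) = u ^ 4 / 8 * (w\<^sup>2 * (\<integral>\<omega>. (r \<omega>)\<^sup>2 \<partial>M))" by simp
  also have "cmod ((u\<^sup>2 / 2 * w) *\<^sub>R (\<integral>\<omega>. e3 \<omega> \<partial>M)) \<le> u\<^sup>2 / 2 * (w * (\<integral>\<omega>. \<bar>\<rho> \<omega> - r \<omega>\<bar> \<partial>M))"
  proof -
    have "cmod (\<integral>\<omega>. e3 \<omega> \<partial>M) \<le> (\<integral>\<omega>. \<bar>\<rho> \<omega> - r \<omega>\<bar> \<partial>M)"
    proof (intro order_trans[OF integral_norm_bound] integral_mono)
      show "integrable M (\<lambda>\<omega>. \<bar>\<rho> \<omega> - r \<omega>\<bar>)" by (rule IR)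
      fix \<omega> assume \<omega>: "\<omega> \<in> space M"
      have "cmod (e3 \<omega>) \<le> 1 * \<bar>\<rho> \<omega> - r \<omega>\<bar>"
        unfolding e3_def norm_mult by (intro mult_mono G \<omega>) auto
      then show "cmod (e3 \<omega>) \<le> \<bar>\<rho> \<omega> - r \<omega>\<bar>" by simp
    qed (use int in simp)
    then show ?thesis using w
      by (simp add: mult.assoc mult_left_mono)
  qed
  finally show ?thesis by simp
qed

text \<open>The random limit \<open>\<tau>\<close> of the normalized conditional variances is approximated by its value \<open>\<rho> k\<close> at
  time \<open>k\<close>. From time \<open>k\<close> on, \<open>\<rho> k\<close> is adapted, so the increments can be replaced by Gaussian ones of variance
  \<open>w j * \<rho> k\<close> one at a time. As \<open>n\<close> tends to infinity with \<open>k\<close> fixed, the total error is bounded by a multiple of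
  the mean distance of \<open>\<rho> k\<close> from \<open>\<tau>\<close>, which is arbitrarily small for large \<open>k\<close>. The argument \<open>t\<close> may vary with
  \<open>n\<close>, which absorbs a change of the normalization.\<close>

theorem martingale_characteristic_limit:
  fixes d \<rho> :: "nat \<Rightarrow> 'a \<Rightarrow> real" and w \<delta> t :: "nat \<Rightarrow> real"
  assumes ad_d: "\<And>n. adapted (Suc n) (d n)"
    and mean: "\<And>n (H :: 'a \<Rightarrow> complex). adapted n H \<Longrightarrow> (\<integral>\<omega>. d n \<omega> *\<^sub>R H \<omega> \<partial>M) = 0"
    and var: "\<And>n (H :: 'a \<Rightarrow> complex). adapted n H \<Longrightarrow>
        (\<integral>\<omega>. (d n \<omega>)\<^sup>2 *\<^sub>R H \<omega> \<partial>M) = (\<integral>\<omega>. (w n * \<rho> n \<omega>) *\<^sub>R H \<omega> \<partial>M)"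
    and bound: "\<And>n \<omega>. \<omega> \<in> space M \<Longrightarrow> \<bar>d n \<omega>\<bar> \<le> \<delta> n"
    and \<rho>: "\<And>n. adapted n (\<rho> n)" "\<And>n \<omega>. \<omega> \<in> space M \<Longrightarrow> 0 \<le> \<rho> n \<omega>"
    and \<tau>: "integrable M \<tau>" "AE \<omega> in M. 0 \<le> \<tau> \<omega>" "(\<lambda>n. \<integral>\<omega>. \<bar>\<rho> n \<omega> - \<tau> \<omega>\<bar> \<partial>M) \<longlonglongrightarrow> 0"
    and w: "\<And>n. 0 \<le> w n" and W: "filterlim (\<lambda>n. \<Sum>m<n. w m) at_top sequentially"
    and \<delta>: "(\<lambda>n. \<delta> n / sqrt (1 + (\<Sum>m<n. w m))) \<longlonglongrightarrow> 0"
    and w_small: "(\<lambda>n. w n / (1 + (\<Sum>m<n. w m))) \<longlonglongrightarrow> 0"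
    and t: "t \<longlonglongrightarrow> t'"
  shows "(\<lambda>n. \<integral>\<omega>. iexp (t n / sqrt (\<Sum>m<n. w m) * (a + (\<Sum>m<n. d m \<omega>))) \<partial>M)
    \<longlonglongrightarrow> of_real (\<integral>\<omega>. exp (- (t'\<^sup>2 / 2 * \<tau> \<omega>)) \<partial>M)"
proof -
  define B where "B n = (\<Sum>m<n. w m)" for n
  define u where "u n = t n / sqrt (B n)" for n
  have [measurable]: "\<tau> \<in> borel_measurable M" using \<tau>(1) by simp
  have [measurable]: "\<rho> n \<in> borel_measurable M" for n using adapted_measurable[OF \<rho>(1)] .
  have [measurable]: "d n \<in> borel_measurable M" for n using adapted_measurable[OF ad_d] .
  have int_\<rho>: "integrable M (\<rho> n)" for n by (rule adapted_integrable[OF \<rho>(1)])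
  have B_mono: "B m \<le> B n" if "m \<le> n" for m n
    unfolding B_def using that w by (intro sum_mono2) auto
  have B_nonneg: "0 \<le> B n" for n unfolding B_def using w by (intro sum_nonneg) auto
  have B_top: "filterlim B at_top sequentially" using W unfolding B_def .
  have B_big: "\<forall>\<^sub>F n in sequentially. 1 \<le> B n"
    using B_top by (simp add: filterlim_at_top)
  have \<rho>_mean_nonneg: "0 \<le> (\<integral>\<omega>. \<rho> n \<omega> \<partial>M)" for n
    by (rule integral_nonneg_AE) (use \<rho>(2) in auto)
  have \<rho>_mean: "(\<lambda>n. \<integral>\<omega>. \<rho> n \<omega> \<partial>M) \<longlonglongrightarrow> (\<integral>\<omega>. \<tau> \<omega> \<partial>M)"
  proof (rule Lim_transform2[OF tendsto_const], rule tendsto_rabs_zero_cancel,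
      rule tendsto_sandwich[OF _ _ tendsto_const \<tau>(3)])
    show "\<forall>\<^sub>F n in sequentially. \<bar>(\<integral>\<omega>. \<tau> \<omega> \<partial>M) - (\<integral>\<omega>. \<rho> n \<omega> \<partial>M)\<bar> \<le> (\<integral>\<omega>. \<bar>\<rho> n \<omega> - \<tau> \<omega>\<bar> \<partial>M)"
    proof (intro always_eventually allI)
      fix n
      have "\<bar>(\<integral>\<omega>. \<tau> \<omega> \<partial>M) - (\<integral>\<omega>. \<rho> n \<omega> \<partial>M)\<bar> = \<bar>\<integral>\<omega>. \<rho> n \<omega> - \<tau> \<omega> \<partial>M\<bar>"
        using \<tau>(1) int_\<rho> by (simp add: abs_minus_commute)
      also have "\<dots> \<le> (\<integral>\<omega>. \<bar>\<rho> n \<omega> - \<tau> \<omega>\<bar> \<partial>M)" by (rule integral_abs_bound)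
      finally show "\<bar>(\<integral>\<omega>. \<tau> \<omega> \<partial>M) - (\<integral>\<omega>. \<rho> n \<omega> \<partial>M)\<bar> \<le> (\<integral>\<omega>. \<bar>\<rho> n \<omega> - \<tau> \<omega>\<bar> \<partial>M)" .
    qed
  qed simp
  define R1 where "R1 n = \<bar>u n\<bar> ^ 3 / 6 * (\<Sum>j<n. \<delta> j * (w j * (\<integral>\<omega>. \<rho> j \<omega> \<partial>M)))" for n
  define R2 where "R2 k n = (u n)\<^sup>2 / 2 * (\<Sum>j<n. w j * (\<integral>\<omega>. \<bar>\<rho> j \<omega> - \<rho> k \<omega>\<bar> \<partial>M))" for k n
  define R3 where "R3 k n = (u n) ^ 4 / 8 * ((\<Sum>j<n. (w j)\<^sup>2) * (\<integral>\<omega>. (\<rho> k \<omega>)\<^sup>2 \<partial>M))" for k n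
  define K where "K k = (\<integral>\<omega>. \<bar>a + (\<Sum>m<k. d m \<omega>)\<bar> \<partial>M)" for k
  define e where "e k n = R1 n + R2 k n + R3 k n + \<bar>u n\<bar> * K k
      + (\<bar>(u n)\<^sup>2 * (B n - B k) - t'\<^sup>2\<bar> / 2 * (\<integral>\<omega>. \<rho> k \<omega> \<partial>M)
      + t'\<^sup>2 / 2 * (\<integral>\<omega>. \<bar>\<rho> k \<omega> - \<tau> \<omega>\<bar> \<partial>M))" for k n
  have \<delta>_nonneg: "0 \<le> \<delta> n" for n
  proof -
    obtain \<omega> where "\<omega> \<in> space M" using not_empty by blast
    from bound[OF this, of n] show ?thesis by linarith
  qed
  have "dist (\<integral>\<omega>. iexp (u n * (a + (\<Sum>m<n. d m \<omega>))) \<partial>M) (of_real (\<integral>\<omega>. exp (- (t'\<^sup>2 / 2 * \<tau> \<omega>)) \<partial>M)) \<le> e k n"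
    if kn: "k \<le> n" for k n
  proof -
    define S where "S j \<omega> = (\<Sum>m=k..<j. d m \<omega>)" for j \<omega>
    \<comment> \<open>\<open>Z j\<close> keeps the increments from \<open>k\<close> to \<open>j\<close> and replaces those from \<open>j\<close> to \<open>n\<close> by Gaussian ones\<close>
    define Z where "Z j \<omega> = iexp (u n * S j \<omega>) * of_real (exp (- ((u n)\<^sup>2 / 2 * \<rho> k \<omega> * (B n - B j))))" for j \<omega>
    have ad_S: "adapted j (S j)" for j
      unfolding S_def by (rule adapted_sum) (auto intro: adapted_mono[OF ad_d])
    have ad_sum: "adapted j (\<lambda>\<omega>. \<Sum>m<j. d m \<omega>)" for j
      by (rule adapted_sum) (auto intro: adapted_mono[OF ad_d])
    have step: "cmod ((\<integral>\<omega>. Z (Suc j) \<omega> \<partial>M) - (\<integral>\<omega>. Z j \<omega> \<partial>M)) \<le>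
        \<bar>u n\<bar> ^ 3 / 6 * (\<delta> j * (w j * (\<integral>\<omega>. \<rho> j \<omega> \<partial>M)))
        + (u n)\<^sup>2 / 2 * (w j * (\<integral>\<omega>. \<bar>\<rho> j \<omega> - \<rho> k \<omega>\<bar> \<partial>M))
        + (u n) ^ 4 / 8 * ((w j)\<^sup>2 * (\<integral>\<omega>. (\<rho> k \<omega>)\<^sup>2 \<partial>M))"
      if j: "j \<in> {k..<n}" for j
    proof -
      \<comment> \<open>the factor common to \<open>Z j\<close> and \<open>Z (Suc j)\<close>\<close>
      define G where "G \<omega> = iexp (u n * S j \<omega>) * of_real (exp (- ((u n)\<^sup>2 / 2 * \<rho> k \<omega> * (B n - B (Suc j)))))" for \<omega>
      have \<rho>k: "adapted j (\<rho> k)" using j by (intro adapted_mono[OF \<rho>(1)]) auto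
      have G: "adapted j G"
        unfolding G_def by (rule adapted_comp2[OF ad_S \<rho>k])
      have G1: "cmod (G \<omega>) \<le> 1" if "\<omega> \<in> space M" for \<omega>
        unfolding G_def using \<rho>(2)[OF that, of k] B_mono[of "Suc j" n] j
        by (simp add: norm_mult)
      have "Z (Suc j) \<omega> = G \<omega> * iexp (u n * d j \<omega>)" for \<omega>
        unfolding Z_def G_def S_def using j
        by (simp add: distrib_left exp_add mult_ac)
      moreover have "Z j \<omega> = G \<omega> * exp (- ((u n)\<^sup>2 / 2 * \<rho> k \<omega> * w j))" for \<omega>
      proof -
        have "(u n)\<^sup>2 / 2 * \<rho> k \<omega> * (B n - B j) =
            (u n)\<^sup>2 / 2 * \<rho> k \<omega> * (B n - B (Suc j)) + (u n)\<^sup>2 / 2 * \<rho> k \<omega> * w j"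
          unfolding distrib_left[symmetric] by (simp add: B_def)
        then show ?thesis
          unfolding Z_def G_def by (simp only: minus_add_distrib exp_add of_real_mult mult.assoc)
      qed
      ultimately show ?thesis
        using characteristic_step[OF G G1 ad_d mean[OF G] var bound \<rho>(1) \<rho>k \<rho>(2) w, of "u n"]
        by (simp only:)
    qed
    have "(\<integral>\<omega>. Z n \<omega> \<partial>M) - (\<integral>\<omega>. Z k \<omega> \<partial>M) = (\<Sum>j=k..<n. (\<integral>\<omega>. Z (Suc j) \<omega> \<partial>M) - (\<integral>\<omega>. Z j \<omega> \<partial>M))"
      using sum_Suc_diff'[OF kn, of "\<lambda>j. \<integral>\<omega>. Z j \<omega> \<partial>M"] by simp
    then have "cmod ((\<integral>\<omega>. Z n \<omega> \<partial>M) - (\<integral>\<omega>. Z k \<omega> \<partial>M)) \<le>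
        (\<Sum>j=k..<n. \<bar>u n\<bar> ^ 3 / 6 * (\<delta> j * (w j * (\<integral>\<omega>. \<rho> j \<omega> \<partial>M)))
        + (u n)\<^sup>2 / 2 * (w j * (\<integral>\<omega>. \<bar>\<rho> j \<omega> - \<rho> k \<omega>\<bar> \<partial>M))
        + (u n) ^ 4 / 8 * ((w j)\<^sup>2 * (\<integral>\<omega>. (\<rho> k \<omega>)\<^sup>2 \<partial>M)))"
      by (simp only:) (rule sum_norm_le[OF step])
    also have "\<dots> \<le> (\<Sum>j<n. \<bar>u n\<bar> ^ 3 / 6 * (\<delta> j * (w j * (\<integral>\<omega>. \<rho> j \<omega> \<partial>M)))
        + (u n)\<^sup>2 / 2 * (w j * (\<integral>\<omega>. \<bar>\<rho> j \<omega> - \<rho> k \<omega>\<bar> \<partial>M))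
        + (u n) ^ 4 / 8 * ((w j)\<^sup>2 * (\<integral>\<omega>. (\<rho> k \<omega>)\<^sup>2 \<partial>M)))"
      using w \<delta>_nonneg \<rho>_mean_nonneg
      by (intro sum_mono2) (auto intro!: add_nonneg_nonneg mult_nonneg_nonneg)
    also have "\<dots> = R1 n + R2 k n + R3 k n"
      unfolding R1_def R2_def R3_def
      by (simp only: sum.distrib sum_distrib_left[symmetric] sum_distrib_right[symmetric])
    finally have part1: "cmod ((\<integral>\<omega>. Z n \<omega> \<partial>M) - (\<integral>\<omega>. Z k \<omega> \<partial>M)) \<le> R1 n + R2 k n + R3 k n" .
    have part2: "cmod ((\<integral>\<omega>. iexp (u n * (a + (\<Sum>m<n. d m \<omega>))) \<partial>M) - (\<integral>\<omega>. Z n \<omega> \<partial>M)) \<le> \<bar>u n\<bar> * K k"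
    proof -
      have int1: "integrable M (\<lambda>\<omega>. iexp (u n * (a + (\<Sum>m<n. d m \<omega>))))"
        by (rule adapted_integrable[OF adapted_comp[OF ad_sum]])
      have int2: "integrable M (Z n)"
        unfolding Z_def by (rule adapted_integrable[OF adapted_comp2[OF ad_S adapted_mono[OF \<rho>(1) kn]]])
      have int3: "integrable M (\<lambda>\<omega>. \<bar>u n\<bar> * \<bar>a + (\<Sum>m<k. d m \<omega>)\<bar>)"
        by (rule adapted_integrable[OF adapted_comp[OF ad_sum]])
      have "(\<integral>\<omega>. iexp (u n * (a + (\<Sum>m<n. d m \<omega>))) \<partial>M) - (\<integral>\<omega>. Z n \<omega> \<partial>M) =
          (\<integral>\<omega>. iexp (u n * (a + (\<Sum>m<n. d m \<omega>))) - Z n \<omega> \<partial>M)"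
        by (rule Bochner_Integration.integral_diff[symmetric, OF int1 int2])
      also have "cmod \<dots> \<le> (\<integral>\<omega>. \<bar>u n\<bar> * \<bar>a + (\<Sum>m<k. d m \<omega>)\<bar> \<partial>M)"
      proof (intro order_trans[OF integral_norm_bound] integral_mono int3)
        show "integrable M (\<lambda>\<omega>. cmod (iexp (u n * (a + (\<Sum>m<n. d m \<omega>))) - Z n \<omega>))"
          using int1 int2 by (intro integrable_norm Bochner_Integration.integrable_diff)
        fix \<omega>
        have "S n \<omega> = (\<Sum>m<n. d m \<omega>) - (\<Sum>m<k. d m \<omega>)"
          unfolding S_def using kn sum_diff_nat_ivl[of 0 k n "\<lambda>m. d m \<omega>"] by (simp add: lessThan_atLeast0)
        then have "a + (\<Sum>m<n. d m \<omega>) - S n \<omega> = a + (\<Sum>m<k. d m \<omega>)" by simp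
        then have "u n * (a + (\<Sum>m<n. d m \<omega>)) - u n * S n \<omega> = u n * (a + (\<Sum>m<k. d m \<omega>))"
          by (simp only: right_diff_distrib[symmetric])
        moreover have "Z n \<omega> = iexp (u n * S n \<omega>)" by (simp add: Z_def)
        ultimately show "cmod (iexp (u n * (a + (\<Sum>m<n. d m \<omega>))) - Z n \<omega>) \<le> \<bar>u n\<bar> * \<bar>a + (\<Sum>m<k. d m \<omega>)\<bar>"
          using iexp_diff_le[of "u n * (a + (\<Sum>m<n. d m \<omega>))" "u n * S n \<omega>"] by (simp only: abs_mult)
      qed
      finally show ?thesis by (simp add: K_def)
    qed
    have part3: "cmod ((\<integral>\<omega>. Z k \<omega> \<partial>M) - of_real (\<integral>\<omega>. exp (- (t'\<^sup>2 / 2 * \<tau> \<omega>)) \<partial>M)) \<le>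
        \<bar>(u n)\<^sup>2 * (B n - B k) - t'\<^sup>2\<bar> / 2 * (\<integral>\<omega>. \<rho> k \<omega> \<partial>M)
        + t'\<^sup>2 / 2 * (\<integral>\<omega>. \<bar>\<rho> k \<omega> - \<tau> \<omega>\<bar> \<partial>M)"
    proof -
      let ?c = "(u n)\<^sup>2 * (B n - B k)"
      have c: "0 \<le> ?c" using B_mono[OF kn] by simp
      have "Z k \<omega> = of_real (exp (- (?c / 2 * \<rho> k \<omega>)))" for \<omega>
        by (simp add: Z_def S_def mult_ac)
      then have "(\<integral>\<omega>. Z k \<omega> \<partial>M) = of_real (\<integral>\<omega>. exp (- (?c / 2 * \<rho> k \<omega>)) \<partial>M)"
        by (simp only: integral_complex_of_real)
      then have "cmod ((\<integral>\<omega>. Z k \<omega> \<partial>M) - of_real (\<integral>\<omega>. exp (- (t'\<^sup>2 / 2 * \<tau> \<omega>)) \<partial>M)) =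
          \<bar>(\<integral>\<omega>. exp (- (?c / 2 * \<rho> k \<omega>)) \<partial>M) - (\<integral>\<omega>. exp (- (t'\<^sup>2 / 2 * \<tau> \<omega>)) \<partial>M)\<bar>"
        by (simp only: of_real_diff[symmetric] norm_of_real)
      also have "\<dots> = \<bar>\<integral>\<omega>. exp (- (?c / 2 * \<rho> k \<omega>)) - exp (- (t'\<^sup>2 / 2 * \<tau> \<omega>)) \<partial>M\<bar>"
      proof (rule arg_cong[where f=abs], rule Bochner_Integration.integral_diff[symmetric])
        show "integrable M (\<lambda>\<omega>. exp (- (?c / 2 * \<rho> k \<omega>)))"
          by (rule adapted_integrable[OF adapted_comp[OF \<rho>(1)]])
        show "integrable M (\<lambda>\<omega>. exp (- (t'\<^sup>2 / 2 * \<tau> \<omega>)))"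
        proof (rule integrable_const_bound[where B=1])
          show "AE \<omega> in M. norm (exp (- (t'\<^sup>2 / 2 * \<tau> \<omega>))) \<le> 1"
            using \<tau>(2) by eventually_elim simp
        qed measurable
      qed
      also have "\<dots> \<le> (\<integral>\<omega>. \<bar>exp (- (?c / 2 * \<rho> k \<omega>)) - exp (- (t'\<^sup>2 / 2 * \<tau> \<omega>))\<bar> \<partial>M)"
        by (rule integral_abs_bound)
      also have "\<dots> \<le> (\<integral>\<omega>. \<bar>?c - t'\<^sup>2\<bar> / 2 * \<rho> k \<omega> + t'\<^sup>2 / 2 * \<bar>\<rho> k \<omega> - \<tau> \<omega>\<bar> \<partial>M)"
      proof (rule integral_mono_AE')
        show "integrable M (\<lambda>\<omega>. \<bar>?c - t'\<^sup>2\<bar> / 2 * \<rho> k \<omega> + t'\<^sup>2 / 2 * \<bar>\<rho> k \<omega> - \<tau> \<omega>\<bar>)"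
          using int_\<rho> \<tau>(1) by simp
        show "AE \<omega> in M. \<bar>exp (- (?c / 2 * \<rho> k \<omega>)) - exp (- (t'\<^sup>2 / 2 * \<tau> \<omega>))\<bar> \<le>
            \<bar>?c - t'\<^sup>2\<bar> / 2 * \<rho> k \<omega> + t'\<^sup>2 / 2 * \<bar>\<rho> k \<omega> - \<tau> \<omega>\<bar>"
          using \<tau>(2) AE_space
        proof eventually_elim
          case (elim \<omega>)
          have "\<bar>exp (- (?c / 2 * \<rho> k \<omega>)) - exp (- (t'\<^sup>2 / 2 * \<tau> \<omega>))\<bar> \<le> \<bar>?c / 2 * \<rho> k \<omega> - t'\<^sup>2 / 2 * \<tau> \<omega>\<bar>"
            using c \<rho>(2)[OF elim(2), of k] elim(1) by (intro exp_minus_diff_le) auto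
          also have "?c / 2 * \<rho> k \<omega> - t'\<^sup>2 / 2 * \<tau> \<omega> = (?c - t'\<^sup>2) / 2 * \<rho> k \<omega> + t'\<^sup>2 / 2 * (\<rho> k \<omega> - \<tau> \<omega>)"
            by (simp add: field_simps)
          also have "\<bar>\<dots>\<bar> \<le> \<bar>(?c - t'\<^sup>2) / 2 * \<rho> k \<omega>\<bar> + \<bar>t'\<^sup>2 / 2 * (\<rho> k \<omega> - \<tau> \<omega>)\<bar>"
            by (rule abs_triangle_ineq)
          also have "\<dots> = \<bar>?c - t'\<^sup>2\<bar> / 2 * \<rho> k \<omega> + t'\<^sup>2 / 2 * \<bar>\<rho> k \<omega> - \<tau> \<omega>\<bar>"
            using \<rho>(2)[OF elim(2), of k] by (simp add: abs_mult)
          finally show ?case .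
        qed
      qed (use \<rho>(2) in \<open>auto intro!: AE_I2 add_nonneg_nonneg mult_nonneg_nonneg\<close>)
      also have "\<dots> = \<bar>?c - t'\<^sup>2\<bar> / 2 * (\<integral>\<omega>. \<rho> k \<omega> \<partial>M) + t'\<^sup>2 / 2 * (\<integral>\<omega>. \<bar>\<rho> k \<omega> - \<tau> \<omega>\<bar> \<partial>M)"
        using int_\<rho> \<tau>(1) by simp
      finally show ?thesis .
    qed
    show ?thesis
      unfolding dist_norm e_def using part1 part2 part3
      by (smt (verit) norm_triangle_sub norm_minus_commute norm_triangle_ineq4 dist_norm dist_triangle)
  qed
  moreover have "e k \<longlonglongrightarrow> t'\<^sup>2 * (\<integral>\<omega>. \<bar>\<rho> k \<omega> - \<tau> \<omega>\<bar> \<partial>M)" for k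
  proof -
    have inv_sqrt: "(\<lambda>n. 1 / sqrt (B n)) \<longlonglongrightarrow> 0"
      by (intro real_tendsto_divide_at_top[OF tendsto_const] filterlim_compose[OF sqrt_at_top B_top])
    have u0: "(\<lambda>n. u n) \<longlonglongrightarrow> 0"
      unfolding u_def using tendsto_mult[OF t inv_sqrt] by simp
    have u2: "(u n)\<^sup>2 = (t n)\<^sup>2 / B n" for n
      using B_nonneg[of n] by (simp add: u_def power_divide)
    have weighted: "(\<lambda>n. (\<Sum>j<n. w j * x j) / B n) \<longlonglongrightarrow> l" if "x \<longlonglongrightarrow> l" for x l
      using weighted_average_tendsto[OF w W that] unfolding B_def .
    have R1: "R1 \<longlonglongrightarrow> 0"
    proof -
      \<comment> \<open>The summand \<open>1\<close> under the root avoids a division by a vanishing weight sum; it costs a factor \<open>sqrt 2\<close>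
  once the weight sum is at least \<open>1\<close>.\<close>
      define x where "x j = \<delta> j / sqrt (1 + B j) * (\<integral>\<omega>. \<rho> j \<omega> \<partial>M)" for j
      have "x \<longlonglongrightarrow> 0 * (\<integral>\<omega>. \<tau> \<omega> \<partial>M)"
        unfolding x_def using \<delta> unfolding B_def by (intro tendsto_mult \<rho>_mean)
      then have "x \<longlonglongrightarrow> 0" by simp
      note lim = tendsto_mult[OF tendsto_mult[OF tendsto_power[OF tendsto_rabs[OF t], of 3]
          tendsto_const[of "sqrt 2 / 6"]] weighted[OF this]]
      have "\<forall>\<^sub>F n in sequentially. norm (R1 n) \<le> \<bar>t n\<bar> ^ 3 * (sqrt 2 / 6) * ((\<Sum>j<n. w j * x j) / B n)"
        using B_big
      proof eventually_elim
        case (elim n)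
        have le: "\<delta> j * (w j * (\<integral>\<omega>. \<rho> j \<omega> \<partial>M)) \<le> sqrt 2 * sqrt (B n) * (w j * x j)" if "j < n" for j
        proof -
          have "1 + B j \<le> 2 * B n" using elim B_mono[of j n] that by simp
          then have "sqrt (1 + B j) \<le> sqrt 2 * sqrt (B n)"
            by (simp add: real_sqrt_mult[symmetric])
          then have "sqrt (1 + B j) * (w j * x j) \<le> sqrt 2 * sqrt (B n) * (w j * x j)"
            unfolding x_def using w \<delta>_nonneg \<rho>_mean_nonneg B_nonneg
            by (intro mult_right_mono mult_nonneg_nonneg divide_nonneg_nonneg) auto
          moreover have "sqrt (1 + B j) \<noteq> 0" using B_nonneg[of j] by simp
          ultimately show ?thesis by (simp add: x_def mult_ac)
        qed
        have "R1 n \<le> \<bar>u n\<bar> ^ 3 / 6 * (sqrt 2 * sqrt (B n) * (\<Sum>j<n. w j * x j))"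
          unfolding R1_def sum_distrib_left[of _ "\<lambda>j. w j * x j"]
          using le by (intro mult_left_mono sum_mono) auto
        also have "\<dots> = \<bar>t n\<bar> ^ 3 * (sqrt 2 / 6) * ((\<Sum>j<n. w j * x j) / B n)"
        proof -
          have "sqrt (B n) ^ 3 = B n * sqrt (B n)"
            using elim by (simp add: power3_eq_cube)
          then have "\<bar>u n\<bar> ^ 3 = \<bar>t n\<bar> ^ 3 / (B n * sqrt (B n))"
            using elim by (simp add: u_def power_divide)
          then show ?thesis using elim by simp
        qed
        finally have "R1 n \<le> \<bar>t n\<bar> ^ 3 * (sqrt 2 / 6) * ((\<Sum>j<n. w j * x j) / B n)" .
        moreover have "0 \<le> R1 n"
          unfolding R1_def using w \<delta>_nonneg \<rho>_mean_nonneg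
          by (intro mult_nonneg_nonneg sum_nonneg) auto
        ultimately show ?case by simp
      qed
      from Lim_null_comparison[OF this] lim show ?thesis by simp
    qed
    have R2: "R2 k \<longlonglongrightarrow> t'\<^sup>2 / 2 * (\<integral>\<omega>. \<bar>\<rho> k \<omega> - \<tau> \<omega>\<bar> \<partial>M)"
    proof -
      have "(\<lambda>j. \<integral>\<omega>. \<bar>\<rho> j \<omega> - \<rho> k \<omega>\<bar> \<partial>M) \<longlonglongrightarrow> (\<integral>\<omega>. \<bar>\<rho> k \<omega> - \<tau> \<omega>\<bar> \<partial>M)"
      proof (rule Lim_transform2[OF tendsto_const], rule tendsto_rabs_zero_cancel,
          rule tendsto_sandwich[OF _ _ tendsto_const \<tau>(3)])
        show "\<forall>\<^sub>F j in sequentially. \<bar>(\<integral>\<omega>. \<bar>\<rho> k \<omega> - \<tau> \<omega>\<bar> \<partial>M) - (\<integral>\<omega>. \<bar>\<rho> j \<omega> - \<rho> k \<omega>\<bar> \<partial>M)\<bar> \<le>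
            (\<integral>\<omega>. \<bar>\<rho> j \<omega> - \<tau> \<omega>\<bar> \<partial>M)"
        proof (intro always_eventually allI)
          fix j
          have "\<bar>(\<integral>\<omega>. \<bar>\<rho> k \<omega> - \<tau> \<omega>\<bar> \<partial>M) - (\<integral>\<omega>. \<bar>\<rho> j \<omega> - \<rho> k \<omega>\<bar> \<partial>M)\<bar> =
              \<bar>\<integral>\<omega>. \<bar>\<rho> k \<omega> - \<tau> \<omega>\<bar> - \<bar>\<rho> j \<omega> - \<rho> k \<omega>\<bar> \<partial>M\<bar>"
            using int_\<rho> \<tau>(1) by simp
          also have "\<dots> \<le> (\<integral>\<omega>. \<bar>\<bar>\<rho> k \<omega> - \<tau> \<omega>\<bar> - \<bar>\<rho> j \<omega> - \<rho> k \<omega>\<bar>\<bar> \<partial>M)"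
            by (rule integral_abs_bound)
          also have "\<dots> \<le> (\<integral>\<omega>. \<bar>\<rho> j \<omega> - \<tau> \<omega>\<bar> \<partial>M)"
            using int_\<rho> \<tau>(1) by (intro integral_mono) auto
          finally show "\<bar>(\<integral>\<omega>. \<bar>\<rho> k \<omega> - \<tau> \<omega>\<bar> \<partial>M) - (\<integral>\<omega>. \<bar>\<rho> j \<omega> - \<rho> k \<omega>\<bar> \<partial>M)\<bar> \<le>
            (\<integral>\<omega>. \<bar>\<rho> j \<omega> - \<tau> \<omega>\<bar> \<partial>M)" .
        qed
      qed simp
      from tendsto_mult[OF tendsto_divide[OF tendsto_power[OF t, of 2] tendsto_const[of 2]] weighted[OF this]]
      show ?thesis unfolding R2_def u2 by (simp add: mult_ac)
    qed
    have R3: "R3 k \<longlonglongrightarrow> 0"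
    proof -
      define x where "x j = w j / (1 + B j)" for j
      have "x \<longlonglongrightarrow> 0" using w_small unfolding x_def B_def .
      note lim = tendsto_mult[OF tendsto_mult[OF tendsto_power[OF t, of 4]
          tendsto_const[of "1 / 4 * (\<integral>\<omega>. (\<rho> k \<omega>)\<^sup>2 \<partial>M)"]] weighted[OF this]]
      have "\<forall>\<^sub>F n in sequentially. norm (R3 k n) \<le>
          t n ^ 4 * (1 / 4 * (\<integral>\<omega>. (\<rho> k \<omega>)\<^sup>2 \<partial>M)) * ((\<Sum>j<n. w j * x j) / B n)"
        using B_big
      proof eventually_elim
        case (elim n)
        have le: "(w j)\<^sup>2 \<le> 2 * B n * (w j * x j)" if "j < n" for j
        proof -
          have "1 + B j \<le> 2 * B n" using elim B_mono[of j n] that by simp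
          then have "(1 + B j) * (w j * x j) \<le> 2 * B n * (w j * x j)"
            unfolding x_def using w B_nonneg
            by (intro mult_right_mono mult_nonneg_nonneg divide_nonneg_nonneg) auto
          moreover have "1 + B j \<noteq> 0" using B_nonneg[of j] by simp
          ultimately show ?thesis by (simp add: x_def power2_eq_square mult_ac)
        qed
        have "R3 k n \<le> u n ^ 4 / 8 * (2 * B n * (\<Sum>j<n. w j * x j) * (\<integral>\<omega>. (\<rho> k \<omega>)\<^sup>2 \<partial>M))"
          unfolding R3_def sum_distrib_left[of _ "\<lambda>j. w j * x j"]
          using le by (intro mult_left_mono mult_right_mono sum_mono) auto
        also have "\<dots> = t n ^ 4 * (1 / 4 * (\<integral>\<omega>. (\<rho> k \<omega>)\<^sup>2 \<partial>M)) * ((\<Sum>j<n. w j * x j) / B n)"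
        proof -
          have "u n ^ 4 = ((u n)\<^sup>2)\<^sup>2" by simp
          also have "\<dots> = t n ^ 4 / (B n * B n)"
            unfolding u2 by (simp add: power_divide power2_eq_square power4_eq_xxxx)
          finally show ?thesis using elim by simp
        qed
        finally have "R3 k n \<le> t n ^ 4 * (1 / 4 * (\<integral>\<omega>. (\<rho> k \<omega>)\<^sup>2 \<partial>M)) * ((\<Sum>j<n. w j * x j) / B n)" .
        moreover have "0 \<le> R3 k n"
          unfolding R3_def by (intro mult_nonneg_nonneg sum_nonneg) auto
        ultimately show ?case by simp
      qed
      from Lim_null_comparison[OF this] lim show ?thesis by simp
    qed
    have "(\<lambda>n. (u n)\<^sup>2 * (B n - B k)) \<longlonglongrightarrow> t'\<^sup>2"
    proof -
      have "(\<lambda>n. (t n)\<^sup>2 * (1 - B k / B n)) \<longlonglongrightarrow> t'\<^sup>2 * (1 - 0)"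
        by (intro tendsto_intros t real_tendsto_divide_at_top[OF tendsto_const B_top])
      moreover have "\<forall>\<^sub>F n in sequentially. (t n)\<^sup>2 * (1 - B k / B n) = (u n)\<^sup>2 * (B n - B k)"
        using B_big by eventually_elim (simp add: u2 field_simps)
      ultimately show ?thesis by (auto elim: Lim_transform_eventually)
    qed
    then have "(\<lambda>n. e k n) \<longlonglongrightarrow> 0 + t'\<^sup>2 / 2 * (\<integral>\<omega>. \<bar>\<rho> k \<omega> - \<tau> \<omega>\<bar> \<partial>M) + 0 + \<bar>0\<bar> * K k
        + (\<bar>t'\<^sup>2 - t'\<^sup>2\<bar> / 2 * (\<integral>\<omega>. \<rho> k \<omega> \<partial>M) + t'\<^sup>2 / 2 * (\<integral>\<omega>. \<bar>\<rho> k \<omega> - \<tau> \<omega>\<bar> \<partial>M))"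
      unfolding e_def by (intro tendsto_intros R1 R2 R3 u0) auto
    then show ?thesis by simp
  qed
  moreover have "(\<lambda>k. t'\<^sup>2 * (\<integral>\<omega>. \<bar>\<rho> k \<omega> - \<tau> \<omega>\<bar> \<partial>M)) \<longlonglongrightarrow> 0"
    using tendsto_mult[OF tendsto_const[of "t'\<^sup>2"] \<tau>(3)] by simp
  ultimately have "(\<lambda>n. \<integral>\<omega>. iexp (u n * (a + (\<Sum>m<n. d m \<omega>))) \<partial>M)
      \<longlonglongrightarrow> of_real (\<integral>\<omega>. exp (- (t'\<^sup>2 / 2 * \<tau> \<omega>)) \<partial>M)"
    by (rule tendsto_of_approximation)
  then show ?thesis unfolding u_def B_def .
qed

end

text \<open>Given the variance \<open>T\<close>, the mixture is Gaussian, so Fubini's theorem yields the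
  characteristic function of the mixture; Levy's continuity theorem does the rest.\<close>

lemma (in prob_space) converges_in_law_to_normal_mixture:
  assumes X: "\<And>n. X n \<in> borel_measurable M" and T: "T \<in> borel_measurable M" "AE \<omega> in M. 0 \<le> T \<omega>"
    and char: "\<And>t. (\<lambda>n. \<integral>\<omega>. iexp (t * X n \<omega>) \<partial>M) \<longlonglongrightarrow> of_real (\<integral>\<omega>. exp (- (t\<^sup>2 / 2 * T \<omega>)) \<partial>M)"
  shows "converges_in_law_to M X (normal_mixture M T)"
proof -
  note [measurable] = X T(1)
  interpret N: real_distribution std_normal_distribution by (rule real_dist_normal_dist)
  interpret P: pair_prob_space M std_normal_distribution ..
  have [measurable]: "(\<lambda>(\<omega>, z). sqrt (T \<omega>) * z) \<in> borel_measurable (M \<Otimes>\<^sub>M std_normal_distribution)"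
    by measurable
  have mixture: "real_distribution (normal_mixture M T)"
    unfolding normal_mixture_def by (rule P.real_distribution_distr) measurable
  have char_mixture: "Characteristic_Functions.char (normal_mixture M T) t = of_real (\<integral>\<omega>. exp (- (t\<^sup>2 / 2 * T \<omega>)) \<partial>M)" for t
  proof -
    have "Characteristic_Functions.char (normal_mixture M T) t =
        (\<integral>p. iexp (t * (sqrt (T (fst p)) * snd p)) \<partial>(M \<Otimes>\<^sub>M std_normal_distribution))"
      unfolding normal_mixture_def char_def
      by (subst integral_distr) (auto simp: case_prod_beta)
    also have "\<dots> = (\<integral>\<omega>. \<integral>z. iexp (t * (sqrt (T \<omega>) * z)) \<partial>std_normal_distribution \<partial>M)"
    proof (subst P.integral_fst'[symmetric])
      show "integrable (M \<Otimes>\<^sub>M std_normal_distribution) (\<lambda>p. iexp (t * (sqrt (T (fst p)) * snd p)))"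
        by (rule P.integrable_const_bound[where B=1]) auto
    qed simp
    also have "\<dots> = (\<integral>\<omega>. of_real (exp (- (t\<^sup>2 / 2 * T \<omega>))) \<partial>M)"
    proof (rule integral_cong_AE)
      show "AE \<omega> in M. (\<integral>z. iexp (t * (sqrt (T \<omega>) * z)) \<partial>std_normal_distribution) =
          of_real (exp (- (t\<^sup>2 / 2 * T \<omega>)))"
        using T(2)
      proof eventually_elim
        case (elim \<omega>)
        have "(\<integral>z. iexp (t * (sqrt (T \<omega>) * z)) \<partial>std_normal_distribution) =
            Characteristic_Functions.char std_normal_distribution (t * sqrt (T \<omega>))"
          unfolding char_def by (simp add: mult.assoc)
        also have "\<dots> = of_real (exp (- (t\<^sup>2 / 2 * T \<omega>)))"
          using elim by (simp add: char_std_normal_distribution power_mult_distrib)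
        finally show ?case .
      qed
    qed measurable
    finally show ?thesis by (simp only: integral_complex_of_real)
  qed
  have "weak_conv_m (\<lambda>n. distr M borel (X n)) (normal_mixture M T)"
  proof (rule levy_continuity[OF _ mixture])
    show "real_distribution (distr M borel (X n))" for n using X by simp
    show "(\<lambda>n. Characteristic_Functions.char (distr M borel (X n)) t) \<longlonglongrightarrow> Characteristic_Functions.char (normal_mixture M T) t" for t
      unfolding char_mixture unfolding char_def using char[of t] by (simp add: integral_distr)
  qed
  then show ?thesis
    unfolding converges_in_law_to_def using X by simp
qed

section \<open>Block triangular replacement\<close>

lemma first_block_append_vec [simp]: "first_block (append_vec u v) = u"
  by (simp add: first_block_def append_vec_def vec_eq_iff)

lemma sum_UNIV_sum_type:
  "(\<Sum>k\<in>UNIV. g k) = (\<Sum>i\<in>UNIV. g (Inl i)) + (\<Sum>j\<in>UNIV. g (Inr j))"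
  for g :: "'m::finite + 'n::finite \<Rightarrow> 'z::comm_monoid_add"
  by (simp add: UNIV_Plus_UNIV[symmetric] sum.Plus del: UNIV_Plus_UNIV)

lemma inner_append_vec:
  fixes x :: "real^('m::finite + 'n::finite)"
  shows "x \<bullet> append_vec u v = first_block x \<bullet> u + (\<Sum>j\<in>UNIV. x $ Inr j * v $ j)"
  by (simp add: inner_vec_def sum_UNIV_sum_type append_vec_def first_block_def)

lemma block_matrix_mult_append_vec:
  fixes A :: "real^'m::finite^'m" and D :: "real^'n::finite^'n"
  shows "block_matrix A B C D *v append_vec u v = append_vec (A *v u + B *v v) (C *v u + D *v v)"
  unfolding vec_eq_iff
proof
  fix k :: "'m + 'n"
  show "(block_matrix A B C D *v append_vec u v) $ k = append_vec (A *v u + B *v v) (C *v u + D *v v) $ k"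
    by (cases k) (simp_all add: block_matrix_def matrix_vector_mult_def append_vec_def sum_UNIV_sum_type)
qed

text \<open>With the lower left block \<open>0\<close>, colors of the second block do not change the first, and their total
  probability is the complement of that of the first block. So the transition of the first block refers to
  neither \<open>B\<close> nor \<open>D\<close>.\<close>

lemma first_block_step:
  fixes A :: "real^'m::finite^'m" and B :: "real^'n::finite^'m" and D :: "real^'n^'n"
    and f :: "real^'m \<Rightarrow> complex"
  assumes urn: "urn_model M (block_matrix A B 0 D) c X C"
  shows "(\<integral>\<omega>. f (first_block (C (Suc n) \<omega>)) \<partial>M) =
    (\<integral>\<omega>. (\<Sum>i\<in>UNIV. (first_block (C n \<omega>) $ i / (real n + 1)) *\<^sub>R f (first_block (C n \<omega>) + A $ i))
      + (1 - (\<Sum>i\<in>UNIV. first_block (C n \<omega>) $ i / (real n + 1))) *\<^sub>R f (first_block (C n \<omega>)) \<partial>M)"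
proof -
  interpret urn_model M "block_matrix A B 0 D" c X C by (rule urn)
  let ?R = "block_matrix A B 0 D"
  have inl: "first_block (x + row (Inl i) ?R) = first_block x + A $ i" for x i
    by (simp add: vec_eq_iff first_block_def row_def block_matrix_def append_vec_def)
  have inr: "first_block (x + row (Inr j) ?R) = first_block x" for x j
    by (simp add: vec_eq_iff first_block_def row_def block_matrix_def append_vec_def)
  have "(\<integral>\<omega>. f (first_block (C (Suc n) \<omega>)) \<partial>M) =
      (\<integral>\<omega>. f (first_block (C n \<omega> + row (X (Suc n) \<omega>) ?R)) \<partial>M)"
    by (intro Bochner_Integration.integral_cong refl) (simp add: replacement)
  also have "\<dots> = (\<integral>\<omega>. (\<Sum>i\<in>UNIV. (C n \<omega> $ i / (real n + 1)) *\<^sub>R f (first_block (C n \<omega> + row i ?R))) \<partial>M)"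
    by (rule draw_expectation[where G="\<lambda>\<omega> i. f (first_block (C n \<omega> + row i ?R))"])
      (rule adapted_comp[OF adapted_C])
  also have "\<dots> = (\<integral>\<omega>. (\<Sum>i\<in>UNIV. (first_block (C n \<omega>) $ i / (real n + 1)) *\<^sub>R f (first_block (C n \<omega>) + A $ i))
      + (1 - (\<Sum>i\<in>UNIV. first_block (C n \<omega>) $ i / (real n + 1))) *\<^sub>R f (first_block (C n \<omega>)) \<partial>M)"
  proof (intro Bochner_Integration.integral_cong refl)
    fix \<omega> assume \<omega>: "\<omega> \<in> space M"
    have "(\<Sum>k\<in>UNIV. C n \<omega> $ k / (real n + 1)) = 1"
      using \<omega> by (simp add: sum_divide_distrib[symmetric] C_total)
    then have "(\<Sum>j\<in>UNIV. C n \<omega> $ Inr j / (real n + 1)) =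
        1 - (\<Sum>i\<in>UNIV. first_block (C n \<omega>) $ i / (real n + 1))"
      unfolding sum_UNIV_sum_type by (simp add: first_block_def)
    then show "(\<Sum>i\<in>UNIV. (C n \<omega> $ i / (real n + 1)) *\<^sub>R f (first_block (C n \<omega> + row i ?R))) =
        (\<Sum>i\<in>UNIV. (first_block (C n \<omega>) $ i / (real n + 1)) *\<^sub>R f (first_block (C n \<omega>) + A $ i))
        + (1 - (\<Sum>i\<in>UNIV. first_block (C n \<omega>) $ i / (real n + 1))) *\<^sub>R f (first_block (C n \<omega>))"
      unfolding sum_UNIV_sum_type inl inr scaleR_sum_left[symmetric] by (simp add: first_block_def)
  qed
  finally show ?thesis .
qed

lemma first_block_law:
  fixes A :: "real^'m::finite^'m" and B :: "real^'n::finite^'m" and D :: "real^'n^'n"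
    and B' :: "real^'l::finite^'m" and D' :: "real^'l^'l" and f :: "real^'m \<Rightarrow> complex"
  assumes urn: "urn_model M (block_matrix A B 0 D) c X C"
    and urn': "urn_model M' (block_matrix A B' 0 D') c' X' C'"
    and init: "first_block c = first_block c'"
  shows "(\<integral>\<omega>. f (first_block (C n \<omega>)) \<partial>M) = (\<integral>\<omega>. f (first_block (C' n \<omega>)) \<partial>M')"
proof (induction n arbitrary: f)
  case 0
  interpret U: urn_model M "block_matrix A B 0 D" c X C by (rule urn)
  interpret U': urn_model M' "block_matrix A B' 0 D'" c' X' C' by (rule urn')
  have "(\<integral>\<omega>. f (first_block (C 0 \<omega>)) \<partial>M) = (\<integral>\<omega>. f (first_block c) \<partial>M)"
    by (intro Bochner_Integration.integral_cong refl) (simp add: U.initial)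
  moreover have "(\<integral>\<omega>. f (first_block (C' 0 \<omega>)) \<partial>M') = (\<integral>\<omega>. f (first_block c') \<partial>M')"
    by (intro Bochner_Integration.integral_cong refl) (simp add: U'.initial)
  ultimately show ?case using init by (simp add: U.prob_space U'.prob_space)
next
  case (Suc n)
  show ?case
    unfolding first_block_step[OF urn] first_block_step[OF urn']
    by (rule Suc[of "\<lambda>x. (\<Sum>i\<in>UNIV. (x $ i / (real n + 1)) *\<^sub>R f (x + A $ i))
      + (1 - (\<Sum>i\<in>UNIV. x $ i / (real n + 1))) *\<^sub>R f x"])
qed

text \<open>Equality of the characteristic functions passes to the almost sure limits.\<close>

lemma limit_distribution_eq:
  assumes M: "prob_space M" and M': "prob_space M'"
    and X: "\<And>n. X n \<in> borel_measurable M" "Y \<in> borel_measurable M" "AE \<omega> in M. (\<lambda>n. X n \<omega>) \<longlonglongrightarrow> Y \<omega>"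
    and X': "\<And>n. X' n \<in> borel_measurable M'" "Y' \<in> borel_measurable M'" "AE \<omega> in M'. (\<lambda>n. X' n \<omega>) \<longlonglongrightarrow> Y' \<omega>"
    and eq: "\<And>n t. (\<integral>\<omega>. iexp (t * X n \<omega>) \<partial>M) = (\<integral>\<omega>. iexp (t * X' n \<omega>) \<partial>M')"
  shows "distr M borel Y = distr M' borel Y'"
proof -
  interpret M: prob_space M by (rule M)
  interpret M': prob_space M' by (rule M')
  note [measurable] = X(1,2) X'(1,2)
  have lim: "(\<lambda>n. \<integral>\<omega>. iexp (t * X n \<omega>) \<partial>M) \<longlonglongrightarrow> (\<integral>\<omega>. iexp (t * Y \<omega>) \<partial>M)" for t
  proof (rule integral_dominated_convergence[where w="\<lambda>_. 1"])
    show "AE \<omega> in M. (\<lambda>n. iexp (t * X n \<omega>)) \<longlonglongrightarrow> iexp (t * Y \<omega>)"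
      using X(3) by eventually_elim (intro tendsto_intros)
  qed auto
  have lim': "(\<lambda>n. \<integral>\<omega>. iexp (t * X' n \<omega>) \<partial>M') \<longlonglongrightarrow> (\<integral>\<omega>. iexp (t * Y' \<omega>) \<partial>M')" for t
  proof (rule integral_dominated_convergence[where w="\<lambda>_. 1"])
    show "AE \<omega> in M'. (\<lambda>n. iexp (t * X' n \<omega>)) \<longlonglongrightarrow> iexp (t * Y' \<omega>)"
      using X'(3) by eventually_elim (intro tendsto_intros)
  qed auto
  show ?thesis
  proof (rule Levy_uniqueness)
    show "real_distribution (distr M borel Y)" by (rule M.real_distribution_distr) measurable
    show "real_distribution (distr M' borel Y')" by (rule M'.real_distribution_distr) measurable
    show "char (distr M borel Y) = char (distr M' borel Y')"
    proof
      fix t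
      have "(\<integral>\<omega>. iexp (t * Y \<omega>) \<partial>M) = (\<integral>\<omega>. iexp (t * Y' \<omega>) \<partial>M')"
        using lim[of t] lim'[of t] unfolding eq by (rule LIMSEQ_unique)
      then show "char (distr M borel Y) t = char (distr M' borel Y') t"
        unfolding char_def by (simp add: integral_distr)
    qed
  qed
qed

lemma stochastic_matrix_mult_1:
  assumes "stochastic_matrix A"
  shows "A *v 1 = 1"
  using assms by (simp add: vec_eq_iff matrix_vector_mult_def stochastic_matrix_def probability_vector_def row_def)

lemma scaleR_matrix_vector_mult: "(a *\<^sub>R A) *v x = a *\<^sub>R (A *v x)" for A :: "real^'n^'m"
  by (simp add: vec_eq_iff matrix_vector_mult_def sum_distrib_left mult.assoc)

text \<open>Both \<open>\<xi>\<close> and \<open>g - (p \<bullet> g) *\<^sub>R 1\<close> are orthogonal to \<open>p\<close>, and in the plane the vectors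
  orthogonal to \<open>p\<close> form a line.\<close>

lemma stationary_decomposition:
  fixes A :: "real^2^2"
  assumes A: "stationary_distribution A p" and \<xi>: "right_eigenvector A l \<xi>" and l: "l \<noteq> 1"
  obtains \<gamma> where "g = (p \<bullet> g) *\<^sub>R 1 + \<gamma> *\<^sub>R \<xi>"
proof -
  have p: "p $ 1 + p $ 2 = 1" "p v* A = p"
    using A by (simp_all add: stationary_distribution_def probability_vector_def sum_2)
  have \<xi>': "A *v \<xi> = l *\<^sub>R \<xi>" "\<xi> \<noteq> 0"
    using \<xi> by (simp_all add: right_eigenvector_def)
  have "p \<bullet> \<xi> = (p v* A) \<bullet> \<xi>" using p by simp
  also have "\<dots> = p \<bullet> (A *v \<xi>)" by (rule dot_lmul_matrix)
  also have "\<dots> = l * (p \<bullet> \<xi>)" using \<xi>' by simp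
  finally have "(1 - l) * (p \<bullet> \<xi>) = 0" by (simp add: algebra_simps)
  then have orth: "p $ 1 * \<xi> $ 1 + p $ 2 * \<xi> $ 2 = 0" using l by (simp add: inner_vec_def sum_2)
  define h where "h = g - (p \<bullet> g) *\<^sub>R 1"
  have "p $ 1 * h $ 1 + p $ 2 * h $ 2 = p \<bullet> g - (p $ 1 + p $ 2) * (p \<bullet> g)"
    by (simp add: h_def inner_vec_def sum_2 algebra_simps)
  then have h: "p $ 1 * h $ 1 + p $ 2 * h $ 2 = 0" using p by simp
  have "p $ 1 * (h $ 1 * \<xi> $ 2 - h $ 2 * \<xi> $ 1) = 0" "p $ 2 * (h $ 1 * \<xi> $ 2 - h $ 2 * \<xi> $ 1) = 0"
    using orth h by algebra+
  then have "(p $ 1 + p $ 2) * (h $ 1 * \<xi> $ 2 - h $ 2 * \<xi> $ 1) = 0"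
    by (simp only: distrib_right)
  then have det: "h $ 1 * \<xi> $ 2 = h $ 2 * \<xi> $ 1" using p by simp
  have "\<exists>\<gamma>. h = \<gamma> *\<^sub>R \<xi>"
  proof (cases "\<xi> $ 1 = 0")
    case True
    then have "\<xi> $ 2 \<noteq> 0" using \<xi>' by (auto simp: vec_eq_iff forall_2)
    then have "h = (h $ 2 / \<xi> $ 2) *\<^sub>R \<xi>"
      using det True by (simp add: vec_eq_iff forall_2)
    then show ?thesis ..
  next
    case False
    then have "h = (h $ 1 / \<xi> $ 1) *\<^sub>R \<xi>"
      using det by (simp add: vec_eq_iff forall_2 field_simps)
    then show ?thesis ..
  qed
  then obtain \<gamma> where "h = \<gamma> *\<^sub>R \<xi>" ..
  then have "g = (p \<bullet> g) *\<^sub>R 1 + \<gamma> *\<^sub>R \<xi>" by (simp add: h_def algebra_simps)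
  then show thesis by (rule that)
qed

section \<open>A two color block feeding a closed block\<close>

text \<open>The second block is left general, so that the four color urn and the three color urn are both
  instances.\<close>

locale reducible_urn = urn_model M "block_matrix (s *\<^sub>R Q) E 0 P" c X C
  for M :: "'a measure" and s :: real and Q :: "real^2^2" and E :: "real^'n::finite^2"
    and P :: "real^'n^'n" and c X C +
  fixes lam :: real and \<pi>Q \<xi> :: "real^2"
  assumes s: "0 < s" "s < 1"
    and Q: "stochastic_matrix Q" "stationary_distribution Q \<pi>Q"
    and \<xi>: "right_eigenvector Q lam \<xi>" and lam: "\<bar>lam\<bar> < 1"
    and pos: "0 < first_block c \<bullet> 1"
begin

abbreviation u :: "real^(2 + 'n)" where "u \<equiv> append_vec 1 0"
abbreviation v :: "real^(2 + 'n)" where "v \<equiv> append_vec \<xi> 0"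
abbreviation R :: "real^(2 + 'n)^(2 + 'n)" where "R \<equiv> block_matrix (s *\<^sub>R Q) E 0 P"

lemma first_block_mult: "R *v append_vec x 0 = append_vec (s *\<^sub>R (Q *v x)) 0"
  by (simp add: block_matrix_mult_append_vec scaleR_matrix_vector_mult)

lemma u_eigen: "R *v u = s *\<^sub>R u"
  unfolding first_block_mult stochastic_matrix_mult_1[OF Q(1)]
  by (simp add: vec_eq_iff append_vec_def split: sum.split)

lemma v_eigen: "R *v v = (s * lam) *\<^sub>R v"
  using \<xi> unfolding first_block_mult right_eigenvector_def
  by (simp add: vec_eq_iff append_vec_def split: sum.split)

lemma u_01: "u $ i = 0 \<or> u $ i = 1"
  by (cases i) (simp_all add: append_vec_def)

lemma v_bound: "(v $ i)\<^sup>2 \<le> (\<xi> \<bullet> \<xi>) * u $ i"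
  by (cases i) (auto simp: append_vec_def inner_vec_def power2_eq_square intro!: member_le_sum)

lemma u_bound: "(u $ i)\<^sup>2 \<le> 1 * u $ i"
  using u_01[of i] by auto

lemma inner_first_block: "x \<bullet> append_vec y 0 = first_block x \<bullet> y" for x :: "real^(2 + 'n)"
  by (simp add: inner_append_vec)

lemma second_eigenvalue: "s * lam > -1" "s * lam < s"
proof -
  have "\<bar>s * lam\<bar> < s" using s lam mult_strict_left_mono[of "\<bar>lam\<bar>" 1 s] by (simp add: abs_mult)
  then show "s * lam > -1" "s * lam < s" using s by linarith+
qed

text \<open>The choice of normalization makes \<open>U\<close> the limit of \<open>C n \<bullet> u / n powr s\<close>.\<close>

definition U :: "'a \<Rightarrow> real" where
  "U = (SOME U. U \<in> borel_measurable M \<and>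
     (AE \<omega> in M. (\<lambda>n. C n \<omega> \<bullet> u / growth s n) \<longlonglongrightarrow> Gamma (1 + s) * U \<omega>) \<and>
     tendsto_L2 M (\<lambda>n \<omega>. C n \<omega> \<bullet> u / growth s n) (\<lambda>\<omega>. Gamma (1 + s) * U \<omega>))"

lemma U: "U \<in> borel_measurable M"
    "AE \<omega> in M. (\<lambda>n. C n \<omega> \<bullet> u / growth s n) \<longlonglongrightarrow> Gamma (1 + s) * U \<omega>"
    "tendsto_L2 M (\<lambda>n \<omega>. C n \<omega> \<bullet> u / growth s n) (\<lambda>\<omega>. Gamma (1 + s) * U \<omega>)"
proof -
  obtain T where T: "T \<in> borel_measurable M"
      "AE \<omega> in M. (\<lambda>n. C n \<omega> \<bullet> u / growth s n) \<longlonglongrightarrow> T \<omega>"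
      "tendsto_L2 M (\<lambda>n \<omega>. C n \<omega> \<bullet> u / growth s n) T"
    using s by (rule_tac eigenvector_convergence[OF u_eigen u_eigen u_bound]) auto
  have "Gamma (1 + s) \<noteq> 0" using s Gamma_real_pos[of "1 + s"] by (simp add: less_imp_neq[symmetric])
  then have eq: "(\<lambda>\<omega>. Gamma (1 + s) * (T \<omega> / Gamma (1 + s))) = T" by simp
  have "\<exists>U. U \<in> borel_measurable M \<and>
     (AE \<omega> in M. (\<lambda>n. C n \<omega> \<bullet> u / growth s n) \<longlonglongrightarrow> Gamma (1 + s) * U \<omega>) \<and>
     tendsto_L2 M (\<lambda>n \<omega>. C n \<omega> \<bullet> u / growth s n) (\<lambda>\<omega>. Gamma (1 + s) * U \<omega>)"
    using T eq by (intro exI[of _ "\<lambda>\<omega>. T \<omega> / Gamma (1 + s)"]) (auto simp: fun_eq_iff)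
  from someI_ex[OF this]
  show "U \<in> borel_measurable M"
    "AE \<omega> in M. (\<lambda>n. C n \<omega> \<bullet> u / growth s n) \<longlonglongrightarrow> Gamma (1 + s) * U \<omega>"
    "tendsto_L2 M (\<lambda>n \<omega>. C n \<omega> \<bullet> u / growth s n) (\<lambda>\<omega>. Gamma (1 + s) * U \<omega>)"
    unfolding U_def by blast+
qed

lemma U_renormalized:
  assumes N: "(\<lambda>n. real n powr s / N n) \<longlonglongrightarrow> 1"
  shows "AE \<omega> in M. (\<lambda>n. C n \<omega> \<bullet> u / N n) \<longlonglongrightarrow> U \<omega>"
    and "tendsto_L2 M (\<lambda>n \<omega>. C n \<omega> \<bullet> u / N n) U"
proof -
  have s1: "s > -1" using s by simp
  have G: "Gamma (1 + s) \<noteq> 0" using s Gamma_real_pos[of "1 + s"] by (simp add: less_imp_neq[symmetric])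
  show "AE \<omega> in M. (\<lambda>n. C n \<omega> \<bullet> u / N n) \<longlonglongrightarrow> U \<omega>"
    using U(2)
  proof eventually_elim
    case (elim \<omega>)
    from tendsto_mult[OF growth_ratio[OF s1 N] elim] show ?case
      using growth_pos[OF s1] G by (simp add: less_imp_neq[symmetric] mult.assoc[symmetric])
  qed
  show "tendsto_L2 M (\<lambda>n \<omega>. C n \<omega> \<bullet> u / N n) U"
    using tendsto_L2_renormalize[OF U(3) s1 growth_ratio[OF s1 N]] G by (simp add: mult.assoc[symmetric])
qed

lemma U_limit: "AE \<omega> in M. (\<lambda>n. C n \<omega> \<bullet> u / real n powr s) \<longlonglongrightarrow> U \<omega>"
  by (rule U_renormalized(1)) real_asymp

lemma U_pos: "AE \<omega> in M. 0 < U \<omega>"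
  using pos s by (intro eigenvector_limit_positive[OF u_eigen _ _ u_01 _ U(1) U_limit])
    (auto simp: inner_first_block)

lemma V_exists:
  assumes "lam > 1 / 2"
  obtains V where "V \<in> borel_measurable M"
    "AE \<omega> in M. (\<lambda>n. C n \<omega> \<bullet> v / real n powr (s * lam)) \<longlonglongrightarrow> V \<omega>"
    "tendsto_L2 M (\<lambda>n \<omega>. C n \<omega> \<bullet> v / real n powr (s * lam)) V"
proof -
  have "s < 2 * (s * lam)" using s mult_strict_left_mono[of "1/2" lam s] assms by simp
  then obtain T where T [measurable]: "T \<in> borel_measurable M"
      and lim: "AE \<omega> in M. (\<lambda>n. C n \<omega> \<bullet> v / growth (s * lam) n) \<longlonglongrightarrow> T \<omega>"
      and L2: "tendsto_L2 M (\<lambda>n \<omega>. C n \<omega> \<bullet> v / growth (s * lam) n) T"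
    using s second_eigenvalue by (rule_tac eigenvector_convergence[OF v_eigen u_eigen v_bound]) auto
  let ?l = "inverse (Gamma (1 + s * lam))"
  show thesis
  proof
    show "(\<lambda>\<omega>. ?l * T \<omega>) \<in> borel_measurable M" by measurable
    show "AE \<omega> in M. (\<lambda>n. C n \<omega> \<bullet> v / real n powr (s * lam)) \<longlonglongrightarrow> ?l * T \<omega>"
      using lim
    proof eventually_elim
      case (elim \<omega>)
      from tendsto_mult[OF growth_asymptotics[OF second_eigenvalue(1)] elim] show ?case
        using growth_pos[OF second_eigenvalue(1)] by (simp add: less_imp_neq[symmetric])
    qed
    show "tendsto_L2 M (\<lambda>n \<omega>. C n \<omega> \<bullet> v / real n powr (s * lam)) (\<lambda>\<omega>. ?l * T \<omega>)"
      by (rule tendsto_L2_renormalize[OF L2 second_eigenvalue(1) growth_asymptotics[OF second_eigenvalue(1)]])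
  qed
qed

lemma v_negligible: "AE \<omega> in M. (\<lambda>n. C n \<omega> \<bullet> v / real n powr s) \<longlonglongrightarrow> 0"
proof -
  have s1: "s > -1" using s by simp
  from subordinate_eigenvector(1)[OF v_eigen u_eigen v_bound second_eigenvalue(1) s(1) second_eigenvalue(2)]
  show ?thesis
  proof eventually_elim
    case (elim \<omega>)
    from tendsto_mult[OF growth_asymptotics[OF s1] elim] show ?case
      using growth_pos[OF s1] by (simp add: less_imp_neq[symmetric])
  qed
qed

lemma v_negligible_L2: "tendsto_L2 M (\<lambda>n \<omega>. C n \<omega> \<bullet> v / (real n + 1) powr s) (\<lambda>_. 0)"
proof -
  have s1: "s > -1" using s by simp
  have "tendsto_L2 M (\<lambda>n \<omega>. C n \<omega> \<bullet> v / growth s n) (\<lambda>_. 0)"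
    using subordinate_eigenvector(2)[OF v_eigen u_eigen v_bound second_eigenvalue(1) s(1) second_eigenvalue(2)]
    unfolding tendsto_L2_def
    by (auto intro: adapted_measurable[OF adapted_comp[OF adapted_C]] adapted_integrable[OF adapted_comp[OF adapted_C]])
  moreover have "(\<lambda>n. real n powr s / (real n + 1) powr s) \<longlonglongrightarrow> 1" by real_asymp
  ultimately show ?thesis
    using tendsto_L2_renormalize[OF _ s1 growth_ratio[OF s1]] by fastforce
qed

lemma first_block_limit: "AE \<omega> in M. \<forall>g. (\<lambda>n. first_block (C n \<omega>) \<bullet> g / real n powr s) \<longlonglongrightarrow> U \<omega> * (\<pi>Q \<bullet> g)"
  using U_limit v_negligible
proof eventually_elim
  case (elim \<omega>)
  show ?case
  proof
    fix g
    have "lam \<noteq> 1" using lam by auto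
    from stationary_decomposition[OF Q(2) \<xi> this]
    obtain \<gamma> where g: "g = (\<pi>Q \<bullet> g) *\<^sub>R 1 + \<gamma> *\<^sub>R \<xi>" .
    have "first_block (C n \<omega>) \<bullet> g / real n powr s =
        (\<pi>Q \<bullet> g) * (C n \<omega> \<bullet> u / real n powr s) + \<gamma> * (C n \<omega> \<bullet> v / real n powr s)" for n
      by (subst g) (simp add: inner_first_block inner_add_right add_divide_distrib)
    moreover have "(\<lambda>n. (\<pi>Q \<bullet> g) * (C n \<omega> \<bullet> u / real n powr s) + \<gamma> * (C n \<omega> \<bullet> v / real n powr s))
        \<longlonglongrightarrow> (\<pi>Q \<bullet> g) * U \<omega> + \<gamma> * 0"
      by (intro tendsto_intros elim)
    ultimately show "(\<lambda>n. first_block (C n \<omega>) \<bullet> g / real n powr s) \<longlonglongrightarrow> U \<omega> * (\<pi>Q \<bullet> g)"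
      by (simp add: mult.commute)
  qed
qed

text \<open>The conditional variance of the draw, divided by the order \<open>n powr (s - 1)\<close> of the probability to
  draw from the first block.\<close>

definition rescaled_variance :: "nat \<Rightarrow> 'a \<Rightarrow> real" where
  "rescaled_variance n \<omega> = noise_variance v n \<omega> * (real n + 1) powr (1 - s)"

definition limit_variance :: "'a \<Rightarrow> real" where
  "limit_variance \<omega> = (s * lam)\<^sup>2 * (U \<omega> * (\<pi>Q \<bullet> (\<chi> i. (\<xi> $ i)\<^sup>2)))"

text \<open>The squares of the entries of \<open>\<xi>\<close> decompose into \<open>1\<close> and \<open>\<xi>\<close>, so the conditional variance is
  a combination of \<open>C n \<bullet> u\<close>, which gives the limit, and of the negligible \<open>C n \<bullet> v\<close> and its square.\<close>

lemma rescaled_variance_limit: "(\<lambda>n. \<integral>\<omega>. \<bar>rescaled_variance n \<omega> - limit_variance \<omega>\<bar> \<partial>M) \<longlonglongrightarrow> 0"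
proof -
  let ?sq = "\<chi> i. (\<xi> $ i)\<^sup>2"
  let ?S = "\<lambda>n \<omega>. C n \<omega> \<bullet> u / (real n + 1) powr s" and ?D = "\<lambda>n \<omega>. C n \<omega> \<bullet> v / (real n + 1) powr s"
  have "lam \<noteq> 1" using lam by auto
  from stationary_decomposition[OF Q(2) \<xi> this, of ?sq]
  obtain \<gamma> where \<gamma>: "?sq = (\<pi>Q \<bullet> ?sq) *\<^sub>R 1 + \<gamma> *\<^sub>R \<xi>" .
  let ?\<alpha> = "\<pi>Q \<bullet> ?sq"
  have S: "tendsto_L2 M ?S U" by (rule U_renormalized(2)) real_asymp
  have D: "tendsto_L2 M ?D (\<lambda>_. 0)" by (rule v_negligible_L2)
  have SU: "integrable M (\<lambda>\<omega>. \<bar>?S n \<omega> - U \<omega>\<bar>)" for n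
  proof -
    have "integrable M U"
      by (rule square_integrable_imp_integrable) (use S U(1) in \<open>auto simp: tendsto_L2_def\<close>)
    then show ?thesis
      using adapted_integrable[OF adapted_comp[OF adapted_C[of n], where g="\<lambda>x. x \<bullet> u / (real n + 1) powr s"]]
      by simp
  qed
  have DI: "integrable M (\<lambda>\<omega>. F (?D n \<omega>))" for n and F :: "real \<Rightarrow> real"
    by (rule adapted_integrable[OF adapted_comp[OF adapted_C]])
  define e where "e n = (s * lam)\<^sup>2 * (\<bar>?\<alpha>\<bar> * (\<integral>\<omega>. \<bar>?S n \<omega> - U \<omega>\<bar> \<partial>M)
      + \<bar>\<gamma>\<bar> * (\<integral>\<omega>. \<bar>?D n \<omega> - 0\<bar> \<partial>M) + (\<integral>\<omega>. (?D n \<omega> - 0)\<^sup>2 \<partial>M) * (real n + 1) powr (s - 1))" for n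
  have le: "(\<integral>\<omega>. \<bar>rescaled_variance n \<omega> - limit_variance \<omega>\<bar> \<partial>M) \<le> e n" for n
  proof -
    have "(\<integral>\<omega>. \<bar>rescaled_variance n \<omega> - limit_variance \<omega>\<bar> \<partial>M) \<le> (\<integral>\<omega>. (s * lam)\<^sup>2 * (\<bar>?\<alpha>\<bar> * \<bar>?S n \<omega> - U \<omega>\<bar>
        + \<bar>\<gamma>\<bar> * \<bar>?D n \<omega>\<bar> + (?D n \<omega>)\<^sup>2 * (real n + 1) powr (s - 1)) \<partial>M)"
    proof (rule integral_mono_AE')
      show "integrable M (\<lambda>\<omega>. (s * lam)\<^sup>2 * (\<bar>?\<alpha>\<bar> * \<bar>?S n \<omega> - U \<omega>\<bar>
        + \<bar>\<gamma>\<bar> * \<bar>?D n \<omega>\<bar> + (?D n \<omega>)\<^sup>2 * (real n + 1) powr (s - 1)))"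
        by (intro integrable_mult_right Bochner_Integration.integrable_add SU
            DI[of "\<lambda>x. \<bar>x\<bar>"] DI[of "\<lambda>x. x\<^sup>2 * (real n + 1) powr (s - 1)"])
      show "AE \<omega> in M. \<bar>rescaled_variance n \<omega> - limit_variance \<omega>\<bar> \<le> (s * lam)\<^sup>2 * (\<bar>?\<alpha>\<bar> * \<bar>?S n \<omega> - U \<omega>\<bar>
        + \<bar>\<gamma>\<bar> * \<bar>?D n \<omega>\<bar> + (?D n \<omega>)\<^sup>2 * (real n + 1) powr (s - 1))"
      proof (rule AE_I2)
        fix \<omega>
        let ?N = "real n + 1"
        have "(\<chi> i. ((R *v v) $ i)\<^sup>2) = (s * lam)\<^sup>2 *\<^sub>R append_vec ?sq 0"
          unfolding v_eigen
          by (simp add: vec_eq_iff append_vec_def power_mult_distrib split: sum.split)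
        then have "C n \<omega> \<bullet> (\<chi> i. ((R *v v) $ i)\<^sup>2) = (s * lam)\<^sup>2 * (first_block (C n \<omega>) \<bullet> ?sq)"
          by (simp add: inner_first_block)
        also have "first_block (C n \<omega>) \<bullet> ?sq = ?\<alpha> * (C n \<omega> \<bullet> u) + \<gamma> * (C n \<omega> \<bullet> v)"
          by (subst \<gamma>) (simp add: inner_first_block inner_add_right)
        finally have nv: "noise_variance v n \<omega> = (s * lam)\<^sup>2 *
            ((?\<alpha> * (C n \<omega> \<bullet> u) + \<gamma> * (C n \<omega> \<bullet> v)) / ?N - (C n \<omega> \<bullet> v / ?N)\<^sup>2)"
          unfolding noise_variance_def v_eigen
          by (simp add: power_mult_distrib power_divide right_diff_distrib)
        have p1: "?N powr (1 - s) / ?N = 1 / ?N powr s"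
          by (simp add: powr_diff)
        \<comment> \<open>the square of \<open>C n \<bullet> v\<close> keeps the vanishing factor \<open>n powr (s - 1)\<close>\<close>
        have p2: "?N powr (1 - s) / ?N\<^sup>2 = ?N powr (s - 1) / (?N powr s)\<^sup>2"
          by (simp add: powr_diff power2_eq_square)
        have "rescaled_variance n \<omega> = (s * lam)\<^sup>2 * ((?\<alpha> * (C n \<omega> \<bullet> u) + \<gamma> * (C n \<omega> \<bullet> v)) * (?N powr (1 - s) / ?N)
            - (C n \<omega> \<bullet> v)\<^sup>2 * (?N powr (1 - s) / ?N\<^sup>2))"
          unfolding rescaled_variance_def nv by (simp add: power_divide left_diff_distrib mult.assoc)
        also have "\<dots> = (s * lam)\<^sup>2 * (?\<alpha> * ?S n \<omega> + \<gamma> * ?D n \<omega> - (?D n \<omega>)\<^sup>2 * ?N powr (s - 1))"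
          unfolding p1 p2 by (simp add: power_divide add_divide_distrib distrib_right mult.assoc)
        finally have "rescaled_variance n \<omega> - limit_variance \<omega> = (s * lam)\<^sup>2 *
            (?\<alpha> * (?S n \<omega> - U \<omega>) + \<gamma> * ?D n \<omega> - (?D n \<omega>)\<^sup>2 * ?N powr (s - 1))"
          unfolding limit_variance_def by (simp add: algebra_simps)
        then have "\<bar>rescaled_variance n \<omega> - limit_variance \<omega>\<bar> = (s * lam)\<^sup>2 *
            \<bar>?\<alpha> * (?S n \<omega> - U \<omega>) + \<gamma> * ?D n \<omega> - (?D n \<omega>)\<^sup>2 * ?N powr (s - 1)\<bar>"
          by (simp add: abs_mult)
        also have "\<dots> \<le> (s * lam)\<^sup>2 * (\<bar>?\<alpha> * (?S n \<omega> - U \<omega>)\<bar> + \<bar>\<gamma> * ?D n \<omega>\<bar> + \<bar>(?D n \<omega>)\<^sup>2 * ?N powr (s - 1)\<bar>)"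
        proof (rule mult_left_mono)
          have "\<bar>x + y - z\<bar> \<le> \<bar>x\<bar> + \<bar>y\<bar> + \<bar>z\<bar>" for x y z :: real by linarith
          then show "\<bar>?\<alpha> * (?S n \<omega> - U \<omega>) + \<gamma> * ?D n \<omega> - (?D n \<omega>)\<^sup>2 * ?N powr (s - 1)\<bar> \<le>
              \<bar>?\<alpha> * (?S n \<omega> - U \<omega>)\<bar> + \<bar>\<gamma> * ?D n \<omega>\<bar> + \<bar>(?D n \<omega>)\<^sup>2 * ?N powr (s - 1)\<bar>" .
        qed simp
        finally show "\<bar>rescaled_variance n \<omega> - limit_variance \<omega>\<bar> \<le> (s * lam)\<^sup>2 * (\<bar>?\<alpha>\<bar> * \<bar>?S n \<omega> - U \<omega>\<bar>
          + \<bar>\<gamma>\<bar> * \<bar>?D n \<omega>\<bar> + (?D n \<omega>)\<^sup>2 * ?N powr (s - 1))"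
          by (simp add: abs_mult)
      qed
    qed (auto intro!: AE_I2 add_nonneg_nonneg mult_nonneg_nonneg)
    also have "\<dots> = e n"
      by (simp only: e_def diff_zero integral_mult_right_zero integral_mult_left_zero
          Bochner_Integration.integral_add Bochner_Integration.integrable_add
          integrable_mult_right integrable_mult_left SU DI[of "\<lambda>x. \<bar>x\<bar>"] DI[of "\<lambda>x. x\<^sup>2"])
    finally show ?thesis .
  qed
  have "e \<longlonglongrightarrow> (s * lam)\<^sup>2 * (\<bar>?\<alpha>\<bar> * 0 + \<bar>\<gamma>\<bar> * 0 + 0 * 0)"
    unfolding e_def
  proof (intro tendsto_intros tendsto_L2_imp_L1 S D)
    show "(\<lambda>n. \<integral>\<omega>. (?D n \<omega> - 0)\<^sup>2 \<partial>M) \<longlonglongrightarrow> 0" using D by (simp only: tendsto_L2_def)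
    show "(\<lambda>n. (real n + 1) powr (s - 1)) \<longlonglongrightarrow> 0" using s by real_asymp
  qed
  then have "e \<longlonglongrightarrow> 0" by simp
  then show ?thesis
    by (rule tendsto_sandwich[OF _ _ tendsto_const, rotated 2]) (use le in auto)
qed

text \<open>The deterministic part of the conditional variance of the \<open>n\<close>-th increment of the martingale
  belonging to \<open>v\<close>; \<open>rescaled_variance\<close> is the other factor.\<close>

definition variance_weight :: "nat \<Rightarrow> real" where
  "variance_weight n = (real n + 1) powr (s - 1) / (growth (s * lam) (Suc n))\<^sup>2"

lemma variance_weight_pos: "0 < variance_weight n"
  unfolding variance_weight_def using growth_pos[OF second_eigenvalue(1), of "Suc n"] by simp

text \<open>Divided by \<open>growth (s * lam) n\<close>, the functional is a martingale to which
  \<open>martingale_characteristic_limit\<close> applies. The sequence \<open>t n\<close> there absorbs the quotient of the martingale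
  normalization and \<open>N n\<close>, whose limit is \<open>\<sigma>\<close>. That \<open>N\<close> tends to infinity makes single increments negligible.\<close>

theorem second_eigenvector_limit_law:
  assumes W: "filterlim (\<lambda>n. \<Sum>m<n. variance_weight m) at_top sequentially"
    and N: "filterlim N at_top sequentially"
    and \<sigma>: "(\<lambda>n. growth (s * lam) n * sqrt (\<Sum>m<n. variance_weight m) / N n) \<longlonglongrightarrow> \<sigma>" "0 < \<sigma>"
  shows "converges_in_law_to M (\<lambda>n \<omega>. C n \<omega> \<bullet> v / N n) (normal_mixture M (\<lambda>\<omega>. \<sigma>\<^sup>2 * limit_variance \<omega>))"
proof (rule converges_in_law_to_normal_mixture)
  note [measurable] = U(1)
  show "(\<lambda>\<omega>. C n \<omega> \<bullet> v / N n) \<in> borel_measurable M" for n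
    by (rule adapted_measurable[OF adapted_comp[OF adapted_C]])
  show "(\<lambda>\<omega>. \<sigma>\<^sup>2 * limit_variance \<omega>) \<in> borel_measurable M" unfolding limit_variance_def by measurable
  have "0 \<le> \<pi>Q \<bullet> (\<chi> i. (\<xi> $ i)\<^sup>2)"
    using Q(2) by (auto simp: inner_vec_def stationary_distribution_def probability_vector_def intro!: sum_nonneg)
  then have limit_variance_nonneg: "AE \<omega> in M. 0 \<le> limit_variance \<omega>"
    using U_pos by (auto simp: limit_variance_def)
  then show "AE \<omega> in M. 0 \<le> \<sigma>\<^sup>2 * limit_variance \<omega>" by eventually_elim simp
  fix t :: real
  let ?\<mu> = "s * lam" and ?B = "\<lambda>n. \<Sum>m<n. variance_weight m"
  let ?g = "\<lambda>n. growth (s * lam) (Suc n)"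
  define K where "K = (\<Sum>i\<in>UNIV. \<bar>(R *v v) $ i\<bar>)"
  have K: "\<bar>(R *v v) $ i\<bar> \<le> K" for i
    unfolding K_def by (rule member_le_sum) auto
  have g_pos: "?g n > 0" for n by (rule growth_pos[OF second_eigenvalue(1)])
  have B_pos: "?B n > 0" if "n > 0" for n
    using variance_weight_pos that by (intro sum_pos) auto
  have top: "filterlim (\<lambda>n. ?g n * sqrt (?B n)) at_top sequentially"
  proof -
    have "(\<lambda>n. growth ?\<mu> n * sqrt (?B n) / N n * (1 + ?\<mu> / (real n + 1))) \<longlonglongrightarrow> \<sigma> * (1 + 0)"
      by (intro tendsto_mult \<sigma> tendsto_add tendsto_const) real_asymp
    from filterlim_tendsto_pos_mult_at_top[OF this _ N] \<sigma>(2)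
    have "filterlim (\<lambda>n. growth ?\<mu> n * sqrt (?B n) / N n * (1 + ?\<mu> / (real n + 1)) * N n) at_top sequentially"
      by simp
    moreover have "\<forall>\<^sub>F n in sequentially. growth ?\<mu> n * sqrt (?B n) / N n * (1 + ?\<mu> / (real n + 1)) * N n =
        ?g n * sqrt (?B n)"
    proof -
      have "\<forall>\<^sub>F n in sequentially. N n > 0" using N unfolding filterlim_at_top_dense by blast
      then show ?thesis by eventually_elim (simp add: growth_Suc)
    qed
    ultimately show ?thesis using filterlim_cong[OF refl refl] by fast
  qed
  have "(\<lambda>n. \<integral>\<omega>. iexp (t * (growth ?\<mu> n * sqrt (?B n) / N n) / sqrt (?B n) *
        (c \<bullet> v + (\<Sum>m<n. 1 / ?g m * noise v m \<omega>))) \<partial>M)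
      \<longlonglongrightarrow> of_real (\<integral>\<omega>. exp (- ((t * \<sigma>)\<^sup>2 / 2 * limit_variance \<omega>)) \<partial>M)"
  proof (rule martingale_characteristic_limit[where \<rho>=rescaled_variance and \<delta>="\<lambda>n. 2 * K / ?g n"])
    show "adapted (Suc n) (\<lambda>\<omega>. 1 / ?g n * noise v n \<omega>)" for n
      by (rule adapted_comp[OF adapted_noise])
    show "(\<integral>\<omega>. (1 / ?g n * noise v n \<omega>) *\<^sub>R H \<omega> \<partial>M) = 0" if H: "adapted n H" for n and H :: "'a \<Rightarrow> complex"
    proof -
      have "(\<integral>\<omega>. (1 / ?g n * noise v n \<omega>) *\<^sub>R H \<omega> \<partial>M) = (1 / ?g n) *\<^sub>R (\<integral>\<omega>. noise v n \<omega> *\<^sub>R H \<omega> \<partial>M)"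
        by (simp only: scaleR_scaleR[symmetric] integral_scaleR_right)
      then show ?thesis by (simp add: noise_mean[OF H])
    qed
    show "(\<integral>\<omega>. (1 / ?g n * noise v n \<omega>)\<^sup>2 *\<^sub>R H \<omega> \<partial>M) = (\<integral>\<omega>. (variance_weight n * rescaled_variance n \<omega>) *\<^sub>R H \<omega> \<partial>M)"
      if H: "adapted n H" for n and H :: "'a \<Rightarrow> complex"
    proof -
      have "(\<integral>\<omega>. (1 / ?g n * noise v n \<omega>)\<^sup>2 *\<^sub>R H \<omega> \<partial>M) = (1 / ?g n)\<^sup>2 *\<^sub>R (\<integral>\<omega>. (noise v n \<omega>)\<^sup>2 *\<^sub>R H \<omega> \<partial>M)"
        by (simp only: power_mult_distrib scaleR_scaleR[symmetric] integral_scaleR_right)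
      also have "\<dots> = (\<integral>\<omega>. ((1 / ?g n)\<^sup>2 * noise_variance v n \<omega>) *\<^sub>R H \<omega> \<partial>M)"
        unfolding noise_square[OF H] by (simp only: scaleR_scaleR[symmetric] integral_scaleR_right)
      also have "\<dots> = (\<integral>\<omega>. (variance_weight n * rescaled_variance n \<omega>) *\<^sub>R H \<omega> \<partial>M)"
      proof (intro Bochner_Integration.integral_cong refl arg_cong2[where f=scaleR])
        fix \<omega>
        have "(real n + 1) powr (s - 1) * (real n + 1) powr (1 - s) = 1"
          by (simp add: powr_add[symmetric])
        then have "variance_weight n * rescaled_variance n \<omega> = 1 * noise_variance v n \<omega> / (?g n)\<^sup>2"
          unfolding variance_weight_def rescaled_variance_def by (simp add: mult_ac)
        then show "(1 / ?g n)\<^sup>2 * noise_variance v n \<omega> = variance_weight n * rescaled_variance n \<omega>" by (simp add: power_divide)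
      qed
      finally show ?thesis .
    qed
    show "\<bar>1 / ?g n * noise v n \<omega>\<bar> \<le> 2 * K / ?g n" if "\<omega> \<in> space M" for n \<omega>
      using noise_bound[OF K that, of n] g_pos[of n] by (simp add: abs_mult divide_right_mono)
    show "adapted n (rescaled_variance n)" for n
      unfolding rescaled_variance_def using adapted_comp[OF adapted_noise_variance, where g="\<lambda>x. x * (real n + 1) powr (1 - s)"] .
    show "0 \<le> rescaled_variance n \<omega>" if "\<omega> \<in> space M" for n \<omega>
      unfolding rescaled_variance_def using noise_variance_nonneg[OF that] by simp
    show "integrable M limit_variance"
    proof -
      have "integrable M (\<lambda>\<omega>. (U \<omega>)\<^sup>2)"
        using U(3) s Gamma_real_pos[of "1 + s"] unfolding tendsto_L2_def
        by (simp add: power_mult_distrib less_imp_neq[symmetric])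
      then have "integrable M U" by (rule square_integrable_imp_integrable[rotated]) measurable
      then show ?thesis unfolding limit_variance_def by simp
    qed
    show "AE \<omega> in M. 0 \<le> limit_variance \<omega>" by (rule limit_variance_nonneg)
    show "(\<lambda>n. \<integral>\<omega>. \<bar>rescaled_variance n \<omega> - limit_variance \<omega>\<bar> \<partial>M) \<longlonglongrightarrow> 0" by (rule rescaled_variance_limit)
    show "0 \<le> variance_weight n" for n using variance_weight_pos[of n] by simp
    show "filterlim ?B at_top sequentially" by (rule W)
    show "(\<lambda>n. 2 * K / ?g n / sqrt (1 + ?B n)) \<longlonglongrightarrow> 0"
    proof (rule Lim_null_comparison)
      show "(\<lambda>n. 2 * K / (?g n * sqrt (?B n))) \<longlonglongrightarrow> 0"
        by (intro real_tendsto_divide_at_top[OF tendsto_const top])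
      show "\<forall>\<^sub>F n in sequentially. norm (2 * K / ?g n / sqrt (1 + ?B n)) \<le> 2 * K / (?g n * sqrt (?B n))"
        using eventually_gt_at_top[of 0]
      proof eventually_elim
        case (elim n)
        have "0 \<le> K" using K[of undefined] by simp
        moreover have "0 < ?B n" by (rule B_pos[OF elim])
        ultimately show ?case
          using g_pos[of n] by (simp add: divide_left_mono mult_pos_pos)
      qed
    qed
    show "(\<lambda>n. variance_weight n / (1 + ?B n)) \<longlonglongrightarrow> 0"
    proof (rule Lim_null_comparison)
      have "(\<lambda>n. (real n + 1) powr (s - 1)) \<longlonglongrightarrow> 0" using s by real_asymp
      from real_tendsto_divide_at_top[OF this filterlim_at_top_mult_at_top[OF top top]]
      show "(\<lambda>n. (real n + 1) powr (s - 1) / (?g n * sqrt (?B n) * (?g n * sqrt (?B n)))) \<longlonglongrightarrow> 0" .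
      show "\<forall>\<^sub>F n in sequentially. norm (variance_weight n / (1 + ?B n)) \<le>
          (real n + 1) powr (s - 1) / (?g n * sqrt (?B n) * (?g n * sqrt (?B n)))"
        using eventually_gt_at_top[of 0]
      proof eventually_elim
        case (elim n)
        have B: "0 < ?B n" by (rule B_pos[OF elim])
        have "variance_weight n / (1 + ?B n) \<le> variance_weight n / ?B n"
          using variance_weight_pos[of n] B by (intro divide_left_mono) auto
        also have "\<dots> = (real n + 1) powr (s - 1) / (?g n * sqrt (?B n) * (?g n * sqrt (?B n)))"
          using B unfolding variance_weight_def by (simp add: power2_eq_square mult_ac)
        finally show ?case using variance_weight_pos[of n] B by simp
      qed
    qed
    show "(\<lambda>n. t * (growth ?\<mu> n * sqrt (?B n) / N n)) \<longlonglongrightarrow> t * \<sigma>"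
      by (intro tendsto_intros \<sigma>)
  qed
  moreover have "\<forall>\<^sub>F n in sequentially.
      (\<integral>\<omega>. iexp (t * (growth ?\<mu> n * sqrt (?B n) / N n) / sqrt (?B n) *
        (c \<bullet> v + (\<Sum>m<n. 1 / ?g m * noise v m \<omega>))) \<partial>M) = (\<integral>\<omega>. iexp (t * (C n \<omega> \<bullet> v / N n)) \<partial>M)"
    using eventually_gt_at_top[of 0]
  proof eventually_elim
    case (elim n)
    show ?case
    proof (intro Bochner_Integration.integral_cong refl)
      fix \<omega> assume \<omega>: "\<omega> \<in> space M"
      have "t * (growth ?\<mu> n * sqrt (?B n) / N n) / sqrt (?B n) = t * (growth ?\<mu> n / N n)"
        using B_pos[OF elim] by simp
      then have "t * (growth ?\<mu> n * sqrt (?B n) / N n) / sqrt (?B n) * (c \<bullet> v + (\<Sum>m<n. 1 / ?g m * noise v m \<omega>)) =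
          t * (C n \<omega> \<bullet> v / N n)"
        unfolding eigenvector_martingale[OF v_eigen second_eigenvalue(1) \<omega>] by simp
      then show "iexp (t * (growth ?\<mu> n * sqrt (?B n) / N n) / sqrt (?B n) *
        (c \<bullet> v + (\<Sum>m<n. 1 / ?g m * noise v m \<omega>))) = iexp (t * (C n \<omega> \<bullet> v / N n))"
        by (simp only:)
    qed
  qed
  ultimately have "(\<lambda>n. \<integral>\<omega>. iexp (t * (C n \<omega> \<bullet> v / N n)) \<partial>M)
      \<longlonglongrightarrow> of_real (\<integral>\<omega>. exp (- ((t * \<sigma>)\<^sup>2 / 2 * limit_variance \<omega>)) \<partial>M)"
    by (rule Lim_transform_eventually)
  then show "(\<lambda>n. \<integral>\<omega>. iexp (t * (C n \<omega> \<bullet> v / N n)) \<partial>M)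
      \<longlonglongrightarrow> of_real (\<integral>\<omega>. exp (- (t\<^sup>2 / 2 * (\<sigma>\<^sup>2 * limit_variance \<omega>))) \<partial>M)"
    by (simp add: power_mult_distrib mult_ac)
qed

lemma variance_weight_ratio:
  assumes b: "(\<lambda>n. (real n + 1) powr (s - 1 - 2 * (s * lam)) / b n) \<longlonglongrightarrow> l"
  shows "(\<lambda>n. variance_weight n / b n) \<longlonglongrightarrow> l * (Gamma (1 + s * lam))\<^sup>2"
proof -
  have "(\<lambda>n. growth (s * lam) (Suc n) / real (Suc n) powr (s * lam)) \<longlonglongrightarrow> inverse (Gamma (1 + s * lam))"
    using growth_asymptotics[OF second_eigenvalue(1)] by (rule LIMSEQ_Suc)
  moreover have G: "Gamma (1 + s * lam) \<noteq> 0"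
    using second_eigenvalue Gamma_real_pos[of "1 + s * lam"] by (simp add: less_imp_neq[symmetric])
  ultimately have "(\<lambda>n. (real n + 1) powr (s - 1 - 2 * (s * lam)) / b n /
      (growth (s * lam) (Suc n) / real (Suc n) powr (s * lam))\<^sup>2) \<longlonglongrightarrow> l / (inverse (Gamma (1 + s * lam)))\<^sup>2"
    by (intro tendsto_divide tendsto_power b) auto
  moreover have "(real n + 1) powr (s - 1 - 2 * (s * lam)) / b n /
      (growth (s * lam) (Suc n) / real (Suc n) powr (s * lam))\<^sup>2 = variance_weight n / b n" for n
  proof -
    have "(real n + 1) powr (s - 1 - 2 * (s * lam)) = (real n + 1) powr (s - 1) / ((real n + 1) powr (s * lam))\<^sup>2"
      by (simp only: powr_diff mult_2 powr_add power2_eq_square)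
    then show ?thesis
      by (simp add: variance_weight_def power_divide add.commute)
  qed
  moreover have "l / (inverse (Gamma (1 + s * lam)))\<^sup>2 = l * (Gamma (1 + s * lam))\<^sup>2"
    by (simp add: power_inverse divide_inverse)
  ultimately show ?thesis by (simp only:)
qed

text \<open>The weights have order \<open>n powr (p - 1)\<close> with \<open>p = s - 2 * s * lam > 0\<close>, so by Stolz's theorem their sum
  has order \<open>n powr p\<close>, and \<open>\<sigma>\<^sup>2 = 1 / p\<close>.\<close>

lemma second_eigenvector_limit_law_subcritical:
  assumes less: "lam < 1 / 2"
  shows "converges_in_law_to M (\<lambda>n \<omega>. C n \<omega> \<bullet> v / real n powr (s / 2))
    (normal_mixture M (\<lambda>\<omega>. 1 / (s - 2 * (s * lam)) * limit_variance \<omega>))"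
proof -
  define p where "p = s - 2 * (s * lam)"
  have p: "p > 0" using less s mult_strict_left_mono[of lam "1/2" s] by (simp add: p_def)
  let ?G = "Gamma (1 + s * lam)"
  have G: "?G > 0" using second_eigenvalue by simp
  have ratio: "(\<lambda>n. (\<Sum>m<n. variance_weight m) / real n powr p) \<longlonglongrightarrow> 1 / p * ?G\<^sup>2"
  proof (rule stolz_cesaro)
    show "strict_mono (\<lambda>n. real n powr p)"
      using p by (intro strict_monoI powr_less_mono2) auto
    show "filterlim (\<lambda>n. real n powr p) at_top sequentially" using p by real_asymp
    have exponent: "s - 1 - 2 * (s * lam) = p - 1" by (simp add: p_def)
    have "(\<lambda>n. (real n + 1) powr (s - 1 - 2 * (s * lam)) / (real (Suc n) powr p - real n powr p)) \<longlonglongrightarrow> inverse p"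
      unfolding exponent using p by real_asymp
    then show "(\<lambda>n. variance_weight n / (real (Suc n) powr p - real n powr p)) \<longlonglongrightarrow> 1 / p * ?G\<^sup>2"
      unfolding inverse_eq_divide by (rule variance_weight_ratio)
  qed
  have b: "filterlim (\<lambda>n. real n powr p) at_top sequentially" using p by real_asymp
  have W: "filterlim (\<lambda>n. \<Sum>m<n. variance_weight m) at_top sequentially"
    using p G by (intro filterlim_at_top_of_ratio[OF ratio _ b]) simp
  have "(\<lambda>n. growth (s * lam) n / real n powr (s * lam) * sqrt ((\<Sum>m<n. variance_weight m) / real n powr p))
      \<longlonglongrightarrow> inverse ?G * sqrt (1 / p * ?G\<^sup>2)"
    by (intro tendsto_mult growth_asymptotics[OF second_eigenvalue(1)] tendsto_real_sqrt ratio)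
  moreover have "growth (s * lam) n / real n powr (s * lam) * sqrt ((\<Sum>m<n. variance_weight m) / real n powr p) =
      growth (s * lam) n * sqrt (\<Sum>m<n. variance_weight m) / real n powr (s / 2)" for n
  proof -
    have "real n powr p = (real n powr (p / 2))\<^sup>2"
      by (simp add: power2_eq_square powr_add[symmetric])
    then have "sqrt (real n powr p) = real n powr (p / 2)" by simp
    moreover have "real n powr (s * lam) * real n powr (p / 2) = real n powr (s / 2)"
      by (simp add: powr_add[symmetric] p_def field_simps)
    ultimately show ?thesis by (simp add: real_sqrt_divide)
  qed
  moreover have "inverse ?G * sqrt (1 / p * ?G\<^sup>2) = sqrt (1 / p)"
    unfolding real_sqrt_mult[of "1 / p"] using G by simp
  ultimately have "(\<lambda>n. growth (s * lam) n * sqrt (\<Sum>m<n. variance_weight m) / real n powr (s / 2)) \<longlonglongrightarrow> sqrt (1 / p)"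
    by (simp only:)
  moreover have "filterlim (\<lambda>n. real n powr (s / 2)) at_top sequentially" using s by real_asymp
  ultimately have "converges_in_law_to M (\<lambda>n \<omega>. C n \<omega> \<bullet> v / real n powr (s / 2))
      (normal_mixture M (\<lambda>\<omega>. (sqrt (1 / p))\<^sup>2 * limit_variance \<omega>))"
    using p by (intro second_eigenvector_limit_law W) auto
  then show ?thesis using p by (simp add: p_def)
qed

text \<open>Here the weights have order \<open>1 / n\<close> and sum to order \<open>ln n\<close>. Comparing with \<open>ln (n + 1)\<close> avoids the zero
  of the logarithm at \<open>n = 1\<close> and its default value at \<open>n = 0\<close>.\<close>

lemma second_eigenvector_limit_law_critical:
  assumes eq: "lam = 1 / 2"
  shows "converges_in_law_to M (\<lambda>n \<omega>. C n \<omega> \<bullet> v / sqrt (real n powr s * ln (real n)))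
    (normal_mixture M limit_variance)"
proof -
  let ?G = "Gamma (1 + s * lam)"
  have G: "?G > 0" using second_eigenvalue by simp
  have ratio: "(\<lambda>n. (\<Sum>m<n. variance_weight m) / ln (real n + 1)) \<longlonglongrightarrow> 1 * ?G\<^sup>2"
  proof (rule stolz_cesaro)
    show "strict_mono (\<lambda>n. ln (real n + 1))"
      by (intro strict_monoI) simp
    show "filterlim (\<lambda>n. ln (real n + 1)) at_top sequentially" by real_asymp
    have "(\<lambda>n. (real n + 1) powr (- 1) / (ln (real (Suc n) + 1) - ln (real n + 1))) \<longlonglongrightarrow> 1"
      by real_asymp
    then show "(\<lambda>n. variance_weight n / (ln (real (Suc n) + 1) - ln (real n + 1))) \<longlonglongrightarrow> 1 * ?G\<^sup>2"
      by (intro variance_weight_ratio) (simp add: eq)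
  qed
  have b: "filterlim (\<lambda>n. ln (real n + 1)) at_top sequentially" by real_asymp
  have W: "filterlim (\<lambda>n. \<Sum>m<n. variance_weight m) at_top sequentially"
    using G by (intro filterlim_at_top_of_ratio[OF ratio _ b]) simp
  have quot: "(\<lambda>n. ln (real n + 1) / ln (real n)) \<longlonglongrightarrow> 1" by real_asymp
  have "(\<lambda>n. growth (s * lam) n / real n powr (s * lam) *
        sqrt ((\<Sum>m<n. variance_weight m) / ln (real n + 1) * (ln (real n + 1) / ln (real n))))
      \<longlonglongrightarrow> inverse ?G * sqrt (1 * ?G\<^sup>2 * 1)"
    by (intro tendsto_mult[OF growth_asymptotics[OF second_eigenvalue(1)]] tendsto_real_sqrt tendsto_mult[OF ratio quot])
  moreover have "\<forall>\<^sub>F n in sequentially. growth (s * lam) n / real n powr (s * lam) *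
        sqrt ((\<Sum>m<n. variance_weight m) / ln (real n + 1) * (ln (real n + 1) / ln (real n))) =
      growth (s * lam) n * sqrt (\<Sum>m<n. variance_weight m) / sqrt (real n powr s * ln (real n))"
    using eventually_gt_at_top[of 1]
  proof eventually_elim
    case (elim n)
    have "real n powr s = (real n powr (s * lam))\<^sup>2"
      by (simp add: power2_eq_square powr_add[symmetric] eq)
    then have "sqrt (real n powr s) = real n powr (s * lam)" by simp
    then show ?case using elim by (simp add: real_sqrt_divide real_sqrt_mult)
  qed
  moreover have "inverse ?G * sqrt (1 * ?G\<^sup>2 * 1) = 1"
    using G by simp
  ultimately have "(\<lambda>n. growth (s * lam) n * sqrt (\<Sum>m<n. variance_weight m) / sqrt (real n powr s * ln (real n))) \<longlonglongrightarrow> 1"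
    by (auto elim: Lim_transform_eventually)
  moreover have "filterlim (\<lambda>n. sqrt (real n powr s * ln (real n))) at_top sequentially" using s by real_asymp
  ultimately have "converges_in_law_to M (\<lambda>n \<omega>. C n \<omega> \<bullet> v / sqrt (real n powr s * ln (real n)))
      (normal_mixture M (\<lambda>\<omega>. 1\<^sup>2 * limit_variance \<omega>))"
    by (intro second_eigenvector_limit_law W) auto
  then show ?thesis by simp
qed

end

section \<open>The four color urn\<close>

theorem proposition4p2:
  fixes M :: "'a measure"
    and P Q E :: "real^2^2"
    and s lam \<beta> W0 B0 G0 Y0 :: real
    and \<pi>P \<pi>Q \<xi> :: "real^2"
    and v1 v2 :: "real^(2+2)"
    and X :: "nat \<Rightarrow> 'a \<Rightarrow> 2 + 2"
    and C :: "nat \<Rightarrow> 'a \<Rightarrow> real^(2+2)"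
  assumes s: "0 < s" "s < 1"
    and P: "stochastic_matrix P" "irreducible_matrix P" "stationary_distribution P \<pi>P"
      "eigenvalues P = {\<beta>, 1}" "\<bar>\<beta>\<bar> < 1"
    and Q: "stochastic_matrix Q" "irreducible_matrix Q" "stationary_distribution Q \<pi>Q"
      "eigenvalues Q = {lam, 1}" "\<bar>lam\<bar> < 1"
    and urn: "urn_model M (block_matrix (s *\<^sub>R Q) E 0 P)
      (append_vec (vector [W0, B0]) (vector [G0, Y0])) X C"
    and pos: "W0 + B0 > 0"
    and xi: "right_eigenvector Q lam \<xi>"
    and v1: "v1 = append_vec (vector [1, 1]) (vector [0, 0])"
    and v2: "v2 = append_vec \<xi> (vector [0, 0])"
  shows "\<exists>U V. U \<in> borel_measurable M \<and> V \<in> borel_measurable M \<and> (AE \<omega> in M. 0 < U \<omega>) \<and>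
    (\<forall>n. \<forall>\<omega>\<in>space M. C n \<omega> \<bullet> append_vec (vector [1, 1]) (vector [1, 1]) / (real n + 1) = 1) \<and>
    (AE \<omega> in M. (\<lambda>n. C n \<omega> /\<^sub>R real n) \<longlonglongrightarrow> append_vec (vector [0, 0]) \<pi>P) \<and>
    (AE \<omega> in M. (\<lambda>n. first_block (C n \<omega>) /\<^sub>R (real n powr s)) \<longlonglongrightarrow> U \<omega> *\<^sub>R \<pi>Q) \<and>
    (AE \<omega> in M. (\<lambda>n. C n \<omega> \<bullet> v1 / real n powr s) \<longlonglongrightarrow> U \<omega>) \<and>
    tendsto_L2 M (\<lambda>n \<omega>. C n \<omega> \<bullet> v1 / real n powr s) U \<and>
    (lam < 1/2 \<longrightarrow>
      converges_in_law_to M (\<lambda>n \<omega>. C n \<omega> \<bullet> v2 / real n powr (s / 2))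
        (normal_mixture M (\<lambda>\<omega>. s\<^sup>2 * lam\<^sup>2 / (s * (1 - 2 * lam)) * U \<omega> * (\<pi>Q \<bullet> (\<chi> i. (\<xi> $ i)\<^sup>2))))) \<and>
    (lam = 1/2 \<longrightarrow>
      converges_in_law_to M (\<lambda>n \<omega>. C n \<omega> \<bullet> v2 / sqrt (real n powr s * ln (real n)))
        (normal_mixture M (\<lambda>\<omega>. s\<^sup>2 * lam\<^sup>2 * U \<omega> * (\<pi>Q \<bullet> (\<chi> i. (\<xi> $ i)\<^sup>2))))) \<and>
    (lam > 1/2 \<longrightarrow>
      (AE \<omega> in M. (\<lambda>n. C n \<omega> \<bullet> v2 / real n powr (s * lam)) \<longlonglongrightarrow> V \<omega>) \<and>
      tendsto_L2 M (\<lambda>n \<omega>. C n \<omega> \<bullet> v2 / real n powr (s * lam)) V) \<and>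
    (\<forall>(M' :: 'b measure) (X' :: nat \<Rightarrow> 'b \<Rightarrow> 2 + 1) (C' :: nat \<Rightarrow> 'b \<Rightarrow> real^(2+1)).
      urn_model M' (block_matrix (s *\<^sub>R Q) ((1 - s) *\<^sub>R (\<chi> i j. 1)) 0 (mat 1))
        (append_vec (vector [W0, B0]) (vector [G0 + Y0])) X' C' \<longrightarrow>
      (\<exists>U' V'. U' \<in> borel_measurable M' \<and> V' \<in> borel_measurable M' \<and>
        (AE \<omega> in M'. 0 < U' \<omega>) \<and>
        (AE \<omega> in M'. (\<lambda>n. (C' n \<omega> $ Inl 1 + C' n \<omega> $ Inl 2) / (real n + 1) powr s) \<longlonglongrightarrow> U' \<omega>) \<and>
        tendsto_L2 M' (\<lambda>n \<omega>. (C' n \<omega> $ Inl 1 + C' n \<omega> $ Inl 2) / (real n + 1) powr s) U' \<and>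
        distr M borel U = distr M' borel U' \<and>
        (lam > 1/2 \<longrightarrow>
          (AE \<omega> in M'. (\<lambda>n. first_block (C' n \<omega>) \<bullet> \<xi> / real n powr (s * lam)) \<longlonglongrightarrow> V' \<omega>) \<and>
          tendsto_L2 M' (\<lambda>n \<omega>. first_block (C' n \<omega>) \<bullet> \<xi> / real n powr (s * lam)) V' \<and>
          distr M borel V = distr M' borel V')))"
proof -
  have vec0: "vector [0, 0] = (0 :: real^2)" and vec1: "vector [1, 1] = (1 :: real^2)"
    by (simp_all add: vec_eq_iff forall_2)
  interpret A: reducible_urn M s Q E P "append_vec (vector [W0, B0]) (vector [G0, Y0])" X C lam \<pi>Q \<xi>
    using s Q xi pos by (intro reducible_urn.intro urn reducible_urn_axioms.intro)
      (simp_all add: inner_vec_def sum_2)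
  note v1' = v1[unfolded vec0 vec1] and v2' = v2[unfolded vec0]
  define V where "V = (if lam > 1/2 then (SOME V. V \<in> borel_measurable M \<and>
      (AE \<omega> in M. (\<lambda>n. C n \<omega> \<bullet> A.v / real n powr (s * lam)) \<longlonglongrightarrow> V \<omega>) \<and>
      tendsto_L2 M (\<lambda>n \<omega>. C n \<omega> \<bullet> A.v / real n powr (s * lam)) V) else (\<lambda>_. 0))"
  have V: "V \<in> borel_measurable M"
      "AE \<omega> in M. (\<lambda>n. C n \<omega> \<bullet> A.v / real n powr (s * lam)) \<longlonglongrightarrow> V \<omega>"
      "tendsto_L2 M (\<lambda>n \<omega>. C n \<omega> \<bullet> A.v / real n powr (s * lam)) V" if "lam > 1/2"
  proof -
    have "\<exists>V. V \<in> borel_measurable M \<and>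
      (AE \<omega> in M. (\<lambda>n. C n \<omega> \<bullet> A.v / real n powr (s * lam)) \<longlonglongrightarrow> V \<omega>) \<and>
      tendsto_L2 M (\<lambda>n \<omega>. C n \<omega> \<bullet> A.v / real n powr (s * lam)) V"
      by (rule A.V_exists[OF that]) blast
    from someI_ex[OF this] that
    show "V \<in> borel_measurable M"
      "AE \<omega> in M. (\<lambda>n. C n \<omega> \<bullet> A.v / real n powr (s * lam)) \<longlonglongrightarrow> V \<omega>"
      "tendsto_L2 M (\<lambda>n \<omega>. C n \<omega> \<bullet> A.v / real n powr (s * lam)) V"
      unfolding V_def by simp_all
  qed
  have V_meas: "V \<in> borel_measurable M"
    using V(1) by (cases "lam > 1/2") (simp_all add: V_def)
  have total: "\<forall>n. \<forall>\<omega>\<in>space M. C n \<omega> \<bullet> append_vec (vector [1, 1]) (vector [1, 1]) / (real n + 1) = 1"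
  proof (intro allI ballI)
    fix n \<omega> assume "\<omega> \<in> space M"
    then show "C n \<omega> \<bullet> append_vec (vector [1, 1]) (vector [1, 1]) / (real n + 1) = 1"
      using A.C_total[of \<omega> n]
      by (simp add: vec1 inner_vec_def append_vec_def sum_UNIV_sum_type)
  qed
  have blocks: "AE \<omega> in M. (\<lambda>n. first_block (C n \<omega>) /\<^sub>R (real n powr s)) \<longlonglongrightarrow> A.U \<omega> *\<^sub>R \<pi>Q"
    using A.first_block_limit
  proof eventually_elim
    case (elim \<omega>)
    show ?case
    proof (rule vec_tendstoI)
      fix i
      show "(\<lambda>n. (first_block (C n \<omega>) /\<^sub>R (real n powr s)) $ i) \<longlonglongrightarrow> (A.U \<omega> *\<^sub>R \<pi>Q) $ i"
        using elim[rule_format, of "axis i 1"] by (simp add: inner_axis divide_inverse mult.commute)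
    qed
  qed
  have proportions: "AE \<omega> in M. (\<lambda>n. C n \<omega> /\<^sub>R real n) \<longlonglongrightarrow> append_vec (vector [0, 0]) \<pi>P"
  proof -
    have "\<beta> \<in> eigenvalues P" using P by simp
    then obtain \<eta> where \<eta>: "right_eigenvector P \<beta> \<eta>" by (auto simp: eigenvalues_def)
    have \<beta>: "\<beta> \<noteq> 1" "-1 \<le> \<beta>" "\<beta> < 1" using P(5) by auto
    let ?w = "append_vec 0 \<eta> :: real^(2+2)" and ?g = "append_vec (E *v \<eta>) 0 :: real^(2+2)"
    have w: "A.R *v ?w = \<beta> *\<^sub>R ?w + ?g"
      using \<eta> unfolding block_matrix_mult_append_vec right_eigenvector_def
      by (simp add: vec_eq_iff append_vec_def split: sum.split)
    have "AE \<omega> in M. summable (\<lambda>n. C n \<omega> \<bullet> ?g / ((real n + 1) * (real n + 2)))"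
      using A.first_block_limit
    proof eventually_elim
      case (elim \<omega>)
      have "(\<lambda>n. C n \<omega> \<bullet> ?g / real n powr s) \<longlonglongrightarrow> A.U \<omega> * (\<pi>Q \<bullet> (E *v \<eta>))"
        using elim by (simp add: A.inner_first_block)
      then have "(\<lambda>n. C n \<omega> \<bullet> ?g) \<in> O(\<lambda>n. real n powr s)"
        by (rule bigoI_tendsto) (use eventually_gt_at_top[of 0] in eventually_elim, simp)
      then have "(\<lambda>n. C n \<omega> \<bullet> ?g / ((real n + 1) * (real n + 2))) \<in>
          O(\<lambda>n. real n powr s / ((real n + 1) * (real n + 2)))"
        by (intro landau_o.big.divide_right) auto
      also have "(\<lambda>n. real n powr s / ((real n + 1) * (real n + 2))) \<in> O(\<lambda>n. real n powr (s - 2))"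
        by real_asymp
      finally show ?case
        by (rule summable_comparison_test_bigo[rotated]) (use s in \<open>simp add: summable_real_powr_iff\<close>)
    qed
    from A.perturbed_eigenvector[OF w \<beta>(2,3) this]
    have F: "AE \<omega> in M. (\<lambda>n. C n \<omega> \<bullet> ?w / (real n + 1)) \<longlonglongrightarrow> 0" .
    show ?thesis
      using F A.first_block_limit AE_space
    proof eventually_elim
      case (elim \<omega>)
      have first: "(\<lambda>n. first_block (C n \<omega>) \<bullet> g / real n) \<longlonglongrightarrow> 0" for g
      proof -
        have "(\<lambda>n. first_block (C n \<omega>) \<bullet> g / real n powr s * (real n powr s / real n)) \<longlonglongrightarrow> A.U \<omega> * (\<pi>Q \<bullet> g) * 0"
        proof (intro tendsto_mult)
          show "(\<lambda>n. first_block (C n \<omega>) \<bullet> g / real n powr s) \<longlonglongrightarrow> A.U \<omega> * (\<pi>Q \<bullet> g)" using elim(2) by blast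
          show "(\<lambda>n. real n powr s / real n) \<longlonglongrightarrow> 0" using s by real_asymp
        qed
        moreover have "first_block (C n \<omega>) \<bullet> g / real n powr s * (real n powr s / real n) = first_block (C n \<omega>) \<bullet> g / real n" for n
          by (cases "n = 0") simp_all
        ultimately show ?thesis by (simp only: mult_zero_right)
      qed
      have w': "(\<lambda>n. C n \<omega> \<bullet> ?w / real n) \<longlonglongrightarrow> 0"
      proof -
        have "(\<lambda>n. C n \<omega> \<bullet> ?w / (real n + 1) * ((real n + 1) / real n)) \<longlonglongrightarrow> 0 * 1"
          by (intro tendsto_mult elim(1)) real_asymp
        moreover have "C n \<omega> \<bullet> ?w / (real n + 1) * ((real n + 1) / real n) = C n \<omega> \<bullet> ?w / real n" for n
        proof -
          have "real n + 1 \<noteq> 0" by simp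
          then show ?thesis by simp
        qed
        ultimately show ?thesis by simp
      qed
      have second_total: "(\<lambda>n. (\<Sum>j\<in>UNIV. C n \<omega> $ Inr j) / real n) \<longlonglongrightarrow> 1"
      proof -
        have "(\<Sum>j\<in>UNIV. C n \<omega> $ Inr j) = real n + 1 - first_block (C n \<omega>) \<bullet> 1" for n
          using A.C_total[OF elim(3), of n] by (simp add: sum_UNIV_sum_type inner_vec_def first_block_def)
        moreover have "(\<lambda>n. (real n + 1) / real n - first_block (C n \<omega>) \<bullet> 1 / real n) \<longlonglongrightarrow> 1 - 0"
          by (intro tendsto_diff first) real_asymp
        ultimately show ?thesis by (simp add: diff_divide_distrib)
      qed
      show ?case
      proof (rule vec_tendstoI)
        fix k :: "2 + 2"
        show "(\<lambda>n. (C n \<omega> /\<^sub>R real n) $ k) \<longlonglongrightarrow> (append_vec (vector [0, 0]) \<pi>P :: real^(2+2)) $ k"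
        proof (cases k)
          case (Inl i)
          then show ?thesis
            using first[of "axis i 1"]
            by (simp add: vec0 append_vec_def inner_axis first_block_def divide_inverse mult.commute)
        next
          case (Inr j)
          obtain \<gamma> where \<gamma>: "axis j 1 = (\<pi>P \<bullet> axis j 1) *\<^sub>R 1 + \<gamma> *\<^sub>R \<eta>"
            using stationary_decomposition[OF P(3) \<eta> \<beta>(1), of "axis j 1"] by blast
          have "(\<Sum>l\<in>UNIV. C n \<omega> $ Inr l * axis j 1 $ l) =
              \<pi>P $ j * (\<Sum>l\<in>UNIV. C n \<omega> $ Inr l) + \<gamma> * (C n \<omega> \<bullet> ?w)" for n
          proof -
            have "axis j 1 $ l = \<pi>P $ j + \<gamma> * \<eta> $ l" for l
              using arg_cong[OF \<gamma>, of "\<lambda>x. x $ l"] by (simp add: inner_axis)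
            then have "(\<Sum>l\<in>UNIV. C n \<omega> $ Inr l * axis j 1 $ l) =
                (\<Sum>l\<in>UNIV. \<pi>P $ j * C n \<omega> $ Inr l + \<gamma> * (C n \<omega> $ Inr l * \<eta> $ l))"
              by (intro sum.cong refl) (simp only: distrib_left mult_ac)
            then show ?thesis
              by (simp add: sum.distrib sum_distrib_left[symmetric] inner_append_vec)
          qed
          moreover have "(\<Sum>l\<in>UNIV. C n \<omega> $ Inr l * axis j 1 $ l) = C n \<omega> $ Inr j" for n
            by (simp add: axis_def if_distrib[where f="\<lambda>x. _ * x"] cong: if_cong)
          ultimately have "C n \<omega> $ k / real n = \<pi>P $ j * ((\<Sum>l\<in>UNIV. C n \<omega> $ Inr l) / real n) + \<gamma> * (C n \<omega> \<bullet> ?w / real n)" for n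
            using Inr by (simp add: add_divide_distrib)
          moreover have "(\<lambda>n. \<pi>P $ j * ((\<Sum>l\<in>UNIV. C n \<omega> $ Inr l) / real n) + \<gamma> * (C n \<omega> \<bullet> ?w / real n)) \<longlonglongrightarrow> \<pi>P $ j * 1 + \<gamma> * 0"
            by (intro tendsto_intros second_total w')
          ultimately show ?thesis
            using Inr by (simp add: append_vec_def divide_inverse mult.commute)
        qed
      qed
    qed
  qed
  have three_colors: "\<exists>U' V'. U' \<in> borel_measurable M' \<and> V' \<in> borel_measurable M' \<and>
        (AE \<omega> in M'. 0 < U' \<omega>) \<and>
        (AE \<omega> in M'. (\<lambda>n. (C' n \<omega> $ Inl 1 + C' n \<omega> $ Inl 2) / (real n + 1) powr s) \<longlonglongrightarrow> U' \<omega>) \<and>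
        tendsto_L2 M' (\<lambda>n \<omega>. (C' n \<omega> $ Inl 1 + C' n \<omega> $ Inl 2) / (real n + 1) powr s) U' \<and>
        distr M borel A.U = distr M' borel U' \<and>
        (lam > 1/2 \<longrightarrow>
          (AE \<omega> in M'. (\<lambda>n. first_block (C' n \<omega>) \<bullet> \<xi> / real n powr (s * lam)) \<longlonglongrightarrow> V' \<omega>) \<and>
          tendsto_L2 M' (\<lambda>n \<omega>. first_block (C' n \<omega>) \<bullet> \<xi> / real n powr (s * lam)) V' \<and>
          distr M borel V = distr M' borel V')"
    if urn': "urn_model M' (block_matrix (s *\<^sub>R Q) ((1 - s) *\<^sub>R (\<chi> i j. 1)) 0 (mat 1))
        (append_vec (vector [W0, B0]) (vector [G0 + Y0])) X' C'"
    for M' :: "'b measure" and X' :: "nat \<Rightarrow> 'b \<Rightarrow> 2 + 1" and C' :: "nat \<Rightarrow> 'b \<Rightarrow> real^(2+1)"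
  proof -
    interpret B: reducible_urn M' s Q "(1 - s) *\<^sub>R (\<chi> i j. 1)" "mat 1"
        "append_vec (vector [W0, B0]) (vector [G0 + Y0])" X' C' lam \<pi>Q \<xi>
      using s Q xi pos by (intro reducible_urn.intro urn' reducible_urn_axioms.intro)
        (simp_all add: inner_vec_def sum_2)
    have law: "(\<integral>\<omega>. iexp (t * (C n \<omega> \<bullet> append_vec y 0 / N)) \<partial>M) =
        (\<integral>\<omega>. iexp (t * (C' n \<omega> \<bullet> append_vec y 0 / N)) \<partial>M')" for t n N y
      unfolding A.inner_first_block B.inner_first_block
      by (rule first_block_law[OF urn urn', where f="\<lambda>x. iexp (t * (x \<bullet> y / N))"]) simp
    have meas: "(\<lambda>\<omega>. C n \<omega> \<bullet> y / N) \<in> borel_measurable M" for n y N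
      by (rule A.adapted_measurable[OF A.adapted_comp[OF A.adapted_C]])
    have meas': "(\<lambda>\<omega>. C' n \<omega> \<bullet> y / N) \<in> borel_measurable M'" for n y N
      by (rule B.adapted_measurable[OF B.adapted_comp[OF B.adapted_C]])
    have U_law: "distr M borel A.U = distr M' borel B.U"
      by (rule limit_distribution_eq[OF A.prob_space_axioms B.prob_space_axioms
            meas A.U(1) A.U_limit meas' B.U(1) B.U_limit law])
    have sum: "C' n \<omega> $ Inl 1 + C' n \<omega> $ Inl 2 = C' n \<omega> \<bullet> B.u" for n \<omega>
      unfolding B.inner_first_block by (simp add: inner_vec_def sum_2 first_block_def)
    have N: "(\<lambda>n. real n powr s / (real n + 1) powr s) \<longlonglongrightarrow> 1" by real_asymp
    show ?thesis
    proof (cases "lam > 1/2")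
      case True
      from B.V_exists[OF True] obtain V' where V': "V' \<in> borel_measurable M'"
        "AE \<omega> in M'. (\<lambda>n. C' n \<omega> \<bullet> B.v / real n powr (s * lam)) \<longlonglongrightarrow> V' \<omega>"
        "tendsto_L2 M' (\<lambda>n \<omega>. C' n \<omega> \<bullet> B.v / real n powr (s * lam)) V'" .
      have "distr M borel V = distr M' borel V'"
        by (rule limit_distribution_eq[OF A.prob_space_axioms B.prob_space_axioms
              meas V(1,2)[OF True] meas' V'(1,2) law])
      then show ?thesis
        using B.U(1) B.U_pos B.U_renormalized[OF N] U_law V'
        unfolding sum B.inner_first_block by (intro exI[of _ B.U] exI[of _ V']) simp
    next
      case False
      then show ?thesis
        using B.U(1) B.U_pos B.U_renormalized[OF N] U_law
        unfolding sum by (intro exI[of _ B.U] exI[of _ "\<lambda>_. 0"]) simp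
    qed
  qed
  have powr_s: "(\<lambda>n. real n powr s / real n powr s) \<longlonglongrightarrow> 1" by real_asymp
  have U_limits: "AE \<omega> in M. (\<lambda>n. C n \<omega> \<bullet> v1 / real n powr s) \<longlonglongrightarrow> A.U \<omega>"
      "tendsto_L2 M (\<lambda>n \<omega>. C n \<omega> \<bullet> v1 / real n powr s) A.U"
    unfolding v1' by (rule A.U_renormalized[OF powr_s])+
  have subcritical: "lam < 1/2 \<longrightarrow>
      converges_in_law_to M (\<lambda>n \<omega>. C n \<omega> \<bullet> v2 / real n powr (s / 2))
        (normal_mixture M (\<lambda>\<omega>. s\<^sup>2 * lam\<^sup>2 / (s * (1 - 2 * lam)) * A.U \<omega> * (\<pi>Q \<bullet> (\<chi> i. (\<xi> $ i)\<^sup>2))))"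
  proof
    assume "lam < 1/2"
    moreover have "(\<lambda>\<omega>. 1 / (s - 2 * (s * lam)) * A.limit_variance \<omega>) =
        (\<lambda>\<omega>. s\<^sup>2 * lam\<^sup>2 / (s * (1 - 2 * lam)) * A.U \<omega> * (\<pi>Q \<bullet> (\<chi> i. (\<xi> $ i)\<^sup>2)))"
      by (simp add: fun_eq_iff A.limit_variance_def power_mult_distrib right_diff_distrib mult_ac)
    ultimately show "converges_in_law_to M (\<lambda>n \<omega>. C n \<omega> \<bullet> v2 / real n powr (s / 2))
        (normal_mixture M (\<lambda>\<omega>. s\<^sup>2 * lam\<^sup>2 / (s * (1 - 2 * lam)) * A.U \<omega> * (\<pi>Q \<bullet> (\<chi> i. (\<xi> $ i)\<^sup>2))))"
      using A.second_eigenvector_limit_law_subcritical unfolding v2' by (simp only:)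
  qed
  have critical: "lam = 1/2 \<longrightarrow>
      converges_in_law_to M (\<lambda>n \<omega>. C n \<omega> \<bullet> v2 / sqrt (real n powr s * ln (real n)))
        (normal_mixture M (\<lambda>\<omega>. s\<^sup>2 * lam\<^sup>2 * A.U \<omega> * (\<pi>Q \<bullet> (\<chi> i. (\<xi> $ i)\<^sup>2))))"
  proof
    assume "lam = 1/2"
    moreover have "A.limit_variance = (\<lambda>\<omega>. s\<^sup>2 * lam\<^sup>2 * A.U \<omega> * (\<pi>Q \<bullet> (\<chi> i. (\<xi> $ i)\<^sup>2)))"
      by (simp add: fun_eq_iff A.limit_variance_def power_mult_distrib mult.assoc)
    ultimately show "converges_in_law_to M (\<lambda>n \<omega>. C n \<omega> \<bullet> v2 / sqrt (real n powr s * ln (real n)))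
        (normal_mixture M (\<lambda>\<omega>. s\<^sup>2 * lam\<^sup>2 * A.U \<omega> * (\<pi>Q \<bullet> (\<chi> i. (\<xi> $ i)\<^sup>2))))"
      using A.second_eigenvector_limit_law_critical unfolding v2' by metis
  qed
  have supercritical: "lam > 1/2 \<longrightarrow>
      (AE \<omega> in M. (\<lambda>n. C n \<omega> \<bullet> v2 / real n powr (s * lam)) \<longlonglongrightarrow> V \<omega>) \<and>
      tendsto_L2 M (\<lambda>n \<omega>. C n \<omega> \<bullet> v2 / real n powr (s * lam)) V"
    unfolding v2' by (intro impI conjI V(2,3))
  show ?thesis
    by (intro exI[of _ A.U] exI[of _ V] conjI A.U(1) V_meas A.U_pos total proportions blocks
        U_limits subcritical critical supercritical) (intro allI impI three_colors)
qed

end
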